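(* Let $I$ be an ideal in $\mathcal{O}_0$ or in $\hat{O}$. Then the closed Gröbner fan $\bar{\mathcal{E}}(I,\mathcal{U}_{\mathrm{loc}})$ is a rational polyhedral fan.
   Context: Fix $n\ge 1$, a field $\mathbf{k}$ and $x=(x_1,\dots,x_n)$. $\hat{O}=\mathbf{k}[[x]]$ is the ring of formal power series; when $\mathbf{k}=\mathbb{C}$, $\mathcal{O}_0\subset\hat O$ is the ring of germs at $0$ of analytic functions (convergent power series). Let $\mathcal{C}$ be one of $\hat O,\mathcal{O}_0$. $\mathcal{U}_{\mathrm{loc}}=\{u\in\mathbb{R}^n : u_i\le 0\ \forall i\}$. For nonzero $f=\sum_\alpha c_\alpha x^\alpha\in\mathcal{C}$ let $\mathrm{Supp}(f)=\{\alpha: c_\alpha\neq0\}$, and for $u\in \mathcal{U}_{\mathrm{loc}}$ let $\mathrm{ord}^u(f)=\max\{u\cdot\alpha:\alpha\in\mathrm{Supp}(f)\}$. Put $F^u_k=\{f\in\mathcal{C}:\mathrm{ord}^u(f)\le k\}$ and $\mathrm{gr}^u(\mathcal{C})=\bigoplus_k F^u_k/F^u_{<k}$. With $M=\{i:u_i\ne0\}$, $\mathrm{gr}^u(\hat O)$ is identified with the subring $\mathbf{k}[[x_i: i\notin M]][x_i:i\in M]$ of $\hat O$, and $\mathrm{gr}^u(\mathcal{O}_0)$ with the subring $\mathbb{C}\{x_i:i\notin M\}[x_i:i\in M]$ of $\mathcal{O}_0$. The initial form $\mathrm{in}_u(f)\in\mathrm{gr}^u(\mathcal{C})$ is the class of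 $f$ in $F^u_k/F^u_{<k}$, $k=\mathrm{ord}^u(f)$, i.e. the sum of the terms $c_\alpha x^\alpha$ of $f$ with $u\cdot\alpha=\mathrm{ord}^u(f)$; $\mathrm{in}_u(0)=0$. For an ideal $I\subset\mathcal{C}$, $\mathrm{in}_u(I)$ is the ideal of $\mathrm{gr}^u(\mathcal{C})$ generated by all $\mathrm{in}_u(f)$, $f\in I$. $S_{\mathcal{C}}(u)=\{u'\in\mathcal{U}_{\mathrm{loc}}:\mathrm{gr}^{u'}(\mathcal{C})=\mathrm{gr}^{u}(\mathcal{C})\}$ (equality as subrings), i.e. the set of $u'$ with $\{i:u'_i\ne0\}=\{i:u_i\neq0\}$. On $\mathcal{U}_{\mathrm{loc}}$ define $u\sim u'$ iff $u'\in S_{\mathcal{C}}(u)$ and $\mathrm{in}_u(I)=\mathrm{in}_{u'}(I)$; the class of $u$ is the Gröbner cone $C_I[u]$. The open Gröbner fan $\mathcal{E}(I,\mathcal{U}_{\mathrm{loc}})$ is the set of all $C_I[u]$, $u\in\mathcal{U}_{\mathrm{loc}}$, and the closed Gröbner fan $\bar{\mathcal{E}}(I,\mathcal{U}_{\mathrm{loc}})$ is the set of their closures in $\mathbb{R}^n$. A polyhedral fan is a finite collection of closed polyhedral cones such that (1) every face of a cone in the collection is again in the collection, and (2) the intersection of any two cones of the collection is a face of both. It is rational if every cone is generated by finitely many rational vectors. *)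

theory Defs
  imports "HOL-Analysis.Analysis" "HOL-Algebra.Subrings"
begin

section \<open>Power series in the variables indexed by a finite type\<close>

text \<open>
  A power series is its family of coefficients, indexed by exponent vectors. The index type \<open>'n\<close>
  is non-empty, so \<open>n = CARD('n) \<ge> 1\<close>.
\<close>

type_synonym ('k, 'n) pow_series = "(nat, 'n) vec \<Rightarrow> 'k"

definition formal_ring :: "('k::field, 'n::finite) pow_series ring" where
  "formal_ring = \<lparr>carrier = UNIV,
     mult = (\<lambda>f g \<alpha>. \<Sum>(\<beta>, \<gamma>) | \<beta> + \<gamma> = \<alpha>. f \<beta> * g \<gamma>),
     one = (\<lambda>\<alpha>. if \<alpha> = 0 then 1 else 0),
     zero = (\<lambda>\<alpha>. 0),
     add = (\<lambda>f g \<alpha>. f \<alpha> + g \<alpha>)\<rparr>"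

definition convergent_series :: "(complex, 'n::finite) pow_series \<Rightarrow> bool" where
  "convergent_series f \<longleftrightarrow>
     (\<exists>r>0. \<forall>z :: complex ^ 'n. (\<forall>i. norm (z $ i) < r) \<longrightarrow>
        (\<lambda>\<alpha>. f \<alpha> * (\<Prod>i\<in>UNIV. (z $ i) ^ (\<alpha> $ i))) summable_on UNIV)"

definition germ_ring :: "(complex, 'n::finite) pow_series ring" where
  "germ_ring = formal_ring\<lparr>carrier := {f. convergent_series f}\<rparr>"

definition Supp :: "('k::field, 'n::finite) pow_series \<Rightarrow> (nat ^ 'n) set" where
  "Supp f = {\<alpha>. f \<alpha> \<noteq> 0}"


section \<open>Initial forms and initial ideals\<close>

text \<open>
  Below, \<open>C\<close> is \<open>formal_ring\<close> or \<open>germ_ring\<close>; all the rings \<open>gr C u\<close> differ from \<open>C\<close> only in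
  the carrier, so equality of these records is equality of subrings.
\<close>

definition U_loc :: "(real ^ 'n::finite) set" where
  "U_loc = {u. \<forall>i. u $ i \<le> 0}"

definition weight :: "real ^ 'n::finite \<Rightarrow> nat ^ 'n \<Rightarrow> real" where
  "weight u \<alpha> = (\<Sum>i\<in>UNIV. u $ i * real (\<alpha> $ i))"

text \<open>
  The maximum over the (possibly infinite) support; it exists for \<open>u \<in> U_loc\<close> and \<open>f \<noteq> 0\<close>, see
  \<open>ord_attained\<close> below.
\<close>
definition ord_wt :: "real ^ 'n::finite \<Rightarrow> ('k::field, 'n) pow_series \<Rightarrow> real" where
  "ord_wt u f = (GREATEST k. k \<in> weight u ` Supp f)"

definition initial_form ::
    "real ^ 'n::finite \<Rightarrow> ('k::field, 'n) pow_series \<Rightarrow> ('k, 'n) pow_series" where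
  "initial_form u f = (\<lambda>\<alpha>. if weight u \<alpha> = ord_wt u f then f \<alpha> else 0)"

text \<open>The part of an exponent vector that involves the variables \<open>x\<^sub>i\<close> with \<open>u\<^sub>i \<noteq> 0\<close>.\<close>
definition restrict_exp :: "real ^ 'n::finite \<Rightarrow> nat ^ 'n \<Rightarrow> nat ^ 'n" where
  "restrict_exp u \<alpha> = (\<chi> i. if u $ i \<noteq> 0 then \<alpha> $ i else 0)"

text \<open>
  The elements of \<open>C\<close> that are polynomial in the variables \<open>x\<^sub>i\<close> with \<open>u\<^sub>i \<noteq> 0\<close>. For convergent
  series the coefficients of such a polynomial, which are series in the remaining variables, are
  automatically convergent.
\<close>
definition gr :: "('k::field, 'n::finite) pow_series ring \<Rightarrow> real ^ 'n \<Rightarrow> ('k, 'n) pow_series ring" where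
  "gr C u = C\<lparr>carrier := {f \<in> carrier C. finite (restrict_exp u ` Supp f)}\<rparr>"

definition initial_ideal ::
    "('k::field, 'n::finite) pow_series ring \<Rightarrow> ('k, 'n) pow_series set \<Rightarrow> real ^ 'n
      \<Rightarrow> ('k, 'n) pow_series set" where
  "initial_ideal C I u = Idl\<^bsub>gr C u\<^esub> (initial_form u ` I)"


section \<open>Groebner fans\<close>

definition same_gr :: "('k::field, 'n::finite) pow_series ring \<Rightarrow> real ^ 'n \<Rightarrow> (real ^ 'n) set" where
  "same_gr C u = {u' \<in> U_loc. gr C u' = gr C u}"

definition groebner_cone ::
    "('k::field, 'n::finite) pow_series ring \<Rightarrow> ('k, 'n) pow_series set \<Rightarrow> real ^ 'n
      \<Rightarrow> (real ^ 'n) set" where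
  "groebner_cone C I u = {u' \<in> same_gr C u. initial_ideal C I u = initial_ideal C I u'}"

definition open_groebner_fan ::
    "('k::field, 'n::finite) pow_series ring \<Rightarrow> ('k, 'n) pow_series set \<Rightarrow> (real ^ 'n) set set" where
  "open_groebner_fan C I = groebner_cone C I ` U_loc"

definition closed_groebner_fan ::
    "('k::field, 'n::finite) pow_series ring \<Rightarrow> ('k, 'n) pow_series set \<Rightarrow> (real ^ 'n) set set" where
  "closed_groebner_fan C I = closure ` open_groebner_fan C I"


section \<open>Rational polyhedral fans\<close>

text \<open>
  The library relation \<open>face_of\<close> admits the empty face, which does not count as a face of a cone.
  In the second condition the intersection contains \<open>0\<close>.
\<close>
definition polyhedral_fan :: "'a::euclidean_space set set \<Rightarrow> bool" where
  "polyhedral_fan F \<longleftrightarrow>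
     finite F \<and>
     (\<forall>\<sigma>\<in>F. polyhedron \<sigma> \<and> convex_cone \<sigma>) \<and>
     (\<forall>\<sigma>\<in>F. \<forall>\<tau>. \<tau> face_of \<sigma> \<and> \<tau> \<noteq> {} \<longrightarrow> \<tau> \<in> F) \<and>
     (\<forall>\<sigma>\<in>F. \<forall>\<tau>\<in>F. \<sigma> \<inter> \<tau> face_of \<sigma> \<and> \<sigma> \<inter> \<tau> face_of \<tau>)"

definition rational_cone :: "(real ^ 'n::finite) set \<Rightarrow> bool" where
  "rational_cone \<sigma> \<longleftrightarrow>
     (\<exists>G. finite G \<and> (\<forall>v\<in>G. \<forall>i. v $ i \<in> \<rat>) \<and> \<sigma> = convex_cone hull G)"

definition rational_polyhedral_fan :: "(real ^ 'n::finite) set set \<Rightarrow> bool" where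
  "rational_polyhedral_fan F \<longleftrightarrow> polyhedral_fan F \<and> (\<forall>\<sigma>\<in>F. rational_cone \<sigma>)"


section \<open>Well-definedness\<close>

lemma finite_bounded_exps: "finite {\<alpha> :: nat ^ 'n::finite. \<forall>i. \<alpha> $ i \<le> N i}"
proof -
  have "{\<alpha> :: nat ^ 'n. \<forall>i. \<alpha> $ i \<le> N i} \<subseteq> vec_lambda ` (PiE UNIV (\<lambda>i. {..N i}))"
  proof
    fix \<alpha> :: "nat ^ 'n" assume "\<alpha> \<in> {\<alpha>. \<forall>i. \<alpha> $ i \<le> N i}"
    then have "vec_nth \<alpha> \<in> PiE UNIV (\<lambda>i. {..N i})" by auto
    then show "\<alpha> \<in> vec_lambda ` (PiE UNIV (\<lambda>i. {..N i}))"
      by (metis image_eqI vec_nth_inverse)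
  qed
  then show ?thesis
    by (rule finite_subset) (auto intro!: finite_PiE)
qed

lemma finite_splittings: "finite {(\<beta>, \<gamma>). \<beta> + \<gamma> = (\<alpha> :: nat ^ 'n::finite)}"
proof (rule finite_subset)
  show "{(\<beta>, \<gamma>). \<beta> + \<gamma> = \<alpha>} \<subseteq> {\<beta>. \<forall>i. \<beta> $ i \<le> \<alpha> $ i} \<times> {\<beta>. \<forall>i. \<beta> $ i \<le> \<alpha> $ i}"
    by auto
qed (simp add: finite_bounded_exps)

lemma formal_ring_simps:
  "carrier formal_ring = UNIV"
  "f \<otimes>\<^bsub>formal_ring\<^esub> g = (\<lambda>\<alpha>. \<Sum>(\<beta>, \<gamma>) | \<beta> + \<gamma> = \<alpha>. f \<beta> * g \<gamma>)"
  "\<one>\<^bsub>formal_ring\<^esub> = (\<lambda>\<alpha>. if \<alpha> = 0 then 1 else 0)"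
  "\<zero>\<^bsub>formal_ring\<^esub> = (\<lambda>\<alpha>. 0)"
  "f \<oplus>\<^bsub>formal_ring\<^esub> g = (\<lambda>\<alpha>. f \<alpha> + g \<alpha>)"
  by (simp_all add: formal_ring_def)

lemma formal_mult_assoc:
  fixes f g h :: "('k::field, 'n::finite) pow_series"
  shows "(\<Sum>(\<beta>, \<gamma>) | \<beta> + \<gamma> = \<alpha>. (\<Sum>(\<delta>, \<epsilon>) | \<delta> + \<epsilon> = \<beta>. f \<delta> * g \<epsilon>) * h \<gamma>)
       = (\<Sum>(\<beta>, \<gamma>) | \<beta> + \<gamma> = \<alpha>. f \<beta> * (\<Sum>(\<delta>, \<epsilon>) | \<delta> + \<epsilon> = \<gamma>. g \<delta> * h \<epsilon>))"
proof -
  let ?S = "\<lambda>\<alpha> :: nat ^ 'n. {(\<beta>, \<gamma>). \<beta> + \<gamma> = \<alpha>}"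
  have "(\<Sum>(\<beta>, \<gamma>)\<in>?S \<alpha>. (\<Sum>(\<delta>, \<epsilon>)\<in>?S \<beta>. f \<delta> * g \<epsilon>) * h \<gamma>)
      = (\<Sum>p\<in>?S \<alpha>. \<Sum>q\<in>?S (fst p). f (fst q) * g (snd q) * h (snd p))"
    by (simp add: case_prod_beta sum_distrib_right)
  also have "\<dots> = (\<Sum>(p, q)\<in>Sigma (?S \<alpha>) (\<lambda>p. ?S (fst p)). f (fst q) * g (snd q) * h (snd p))"
    by (rule sum.Sigma) (auto simp: finite_splittings)
  also have "\<dots> = (\<Sum>(p, q)\<in>Sigma (?S \<alpha>) (\<lambda>p. ?S (snd p)). f (fst p) * (g (fst q) * h (snd q)))"
    by (rule sum.reindex_bij_witness[of _
          "\<lambda>(p, q). ((fst p + fst q, snd q), (fst p, fst q))"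
          "\<lambda>(p, q). ((fst q, snd q + snd p), (snd q, snd p))"])
       (auto simp: add.assoc mult.assoc)
  also have "\<dots> = (\<Sum>p\<in>?S \<alpha>. \<Sum>q\<in>?S (snd p). f (fst p) * (g (fst q) * h (snd q)))"
    by (rule sum.Sigma[symmetric]) (auto simp: finite_splittings)
  also have "\<dots> = (\<Sum>(\<beta>, \<gamma>)\<in>?S \<alpha>. f \<beta> * (\<Sum>(\<delta>, \<epsilon>)\<in>?S \<gamma>. g \<delta> * h \<epsilon>))"
    by (simp add: case_prod_beta sum_distrib_left)
  finally show ?thesis .
qed

lemma formal_mult_comm:
  fixes f g :: "('k::field, 'n::finite) pow_series"
  shows "(\<Sum>(\<beta>, \<gamma>) | \<beta> + \<gamma> = \<alpha>. f \<beta> * g \<gamma>) = (\<Sum>(\<beta>, \<gamma>) | \<beta> + \<gamma> = \<alpha>. g \<beta> * f \<gamma>)"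
  by (rule sum.reindex_bij_witness[of _ prod.swap prod.swap]) (auto simp: add.commute mult.commute)

lemma formal_one_mult:
  fixes f :: "('k::field, 'n::finite) pow_series"
  shows "(\<Sum>(\<beta>, \<gamma>) | \<beta> + \<gamma> = \<alpha>. (if \<beta> = 0 then 1 else 0) * f \<gamma>) = f \<alpha>"
proof -
  have "(\<Sum>p\<in>{(\<beta>, \<gamma>). \<beta> + \<gamma> = \<alpha>}. (if fst p = 0 then 1 else 0) * f (snd p))
      = (\<Sum>p\<in>{(0 :: nat ^ 'n, \<alpha>)}. (if fst p = 0 then 1 else 0) * f (snd p))"
    by (rule sum.mono_neutral_right) (auto simp: finite_splittings)
  then show ?thesis by (simp add: case_prod_beta)
qed

lemma formal_cring: "cring (formal_ring :: ('k::field, 'n::finite) pow_series ring)"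
proof (rule cringI)
  show "abelian_group (formal_ring :: ('k, 'n) pow_series ring)"
  proof (rule abelian_groupI)
    fix f :: "('k, 'n) pow_series"
    show "\<exists>g\<in>carrier formal_ring. g \<oplus>\<^bsub>formal_ring\<^esub> f = \<zero>\<^bsub>formal_ring\<^esub>"
      by (rule bexI[of _ "\<lambda>\<alpha>. - f \<alpha>"]) (simp_all add: formal_ring_simps)
  qed (simp_all add: formal_ring_simps add_ac)
  show "comm_monoid (formal_ring :: ('k, 'n) pow_series ring)"
  proof (rule comm_monoidI)
    fix f g h :: "('k, 'n) pow_series"
    show "f \<otimes>\<^bsub>formal_ring\<^esub> g \<otimes>\<^bsub>formal_ring\<^esub> h = f \<otimes>\<^bsub>formal_ring\<^esub> (g \<otimes>\<^bsub>formal_ring\<^esub> h)"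
      unfolding formal_ring_simps by (rule ext, rule formal_mult_assoc)
    show "f \<otimes>\<^bsub>formal_ring\<^esub> g = g \<otimes>\<^bsub>formal_ring\<^esub> f"
      unfolding formal_ring_simps by (rule ext, rule formal_mult_comm)
    show "\<one>\<^bsub>formal_ring\<^esub> \<otimes>\<^bsub>formal_ring\<^esub> f = f"
      unfolding formal_ring_simps by (rule ext, rule formal_one_mult)
  qed (simp_all add: formal_ring_simps(1))
  show "(f \<oplus>\<^bsub>formal_ring\<^esub> g) \<otimes>\<^bsub>formal_ring\<^esub> h
      = f \<otimes>\<^bsub>formal_ring\<^esub> h \<oplus>\<^bsub>formal_ring\<^esub> g \<otimes>\<^bsub>formal_ring\<^esub> h"
    for f g h :: "('k, 'n) pow_series"
    by (auto simp: formal_ring_simps fun_eq_iff case_prod_beta distrib_right sum.distrib)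
qed

lemma formal_a_inv: "\<ominus>\<^bsub>formal_ring\<^esub> f = (\<lambda>\<alpha>. - f \<alpha>)"
proof -
  interpret cring formal_ring by (rule formal_cring)
  show ?thesis
    by (rule minus_equality) (auto simp: formal_ring_simps)
qed

lemma convergent_mult:
  fixes f g :: "(complex, 'n::finite) pow_series"
  assumes "convergent_series f" "convergent_series g"
  shows "convergent_series (f \<otimes>\<^bsub>formal_ring\<^esub> g)"
proof -
  let ?m = "\<lambda>(z :: complex ^ 'n) (\<alpha> :: nat ^ 'n). \<Prod>i\<in>UNIV. (z $ i) ^ (\<alpha> $ i)"
  let ?S = "\<lambda>\<alpha> :: nat ^ 'n. {(\<beta>, \<gamma>). \<beta> + \<gamma> = \<alpha>}"
  obtain r where r: "r > 0"
    "\<And>z. (\<forall>i. norm (z $ i) < r) \<Longrightarrow> (\<lambda>\<alpha>. f \<alpha> * ?m z \<alpha>) summable_on UNIV"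
    using assms(1) unfolding convergent_series_def by blast
  obtain s where s: "s > 0"
    "\<And>z. (\<forall>i. norm (z $ i) < s) \<Longrightarrow> (\<lambda>\<alpha>. g \<alpha> * ?m z \<alpha>) summable_on UNIV"
    using assms(2) unfolding convergent_series_def by blast
  have "(\<lambda>\<alpha>. (f \<otimes>\<^bsub>formal_ring\<^esub> g) \<alpha> * ?m z \<alpha>) summable_on UNIV"
    if z: "\<forall>i. norm (z $ i) < min r s" for z
  proof -
    have "Infinite_Set_Sum.abs_summable_on (\<lambda>\<alpha>. f \<alpha> * ?m z \<alpha>) UNIV"
         "Infinite_Set_Sum.abs_summable_on (\<lambda>\<alpha>. g \<alpha> * ?m z \<alpha>) UNIV"
      using r(2)[of z] s(2)[of z] z
      by (simp_all add: summable_on_iff_abs_summable_on_complex flip: abs_summable_equivalent)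
    then have "Infinite_Set_Sum.abs_summable_on
        (\<lambda>(\<beta>, \<gamma>). (f \<beta> * ?m z \<beta>) * (g \<gamma> * ?m z \<gamma>)) (UNIV \<times> UNIV)"
      by (intro abs_summable_on_product) auto
    then have "(\<lambda>p. (f (fst p) * ?m z (fst p)) * (g (snd p) * ?m z (snd p))) summable_on UNIV"
      by (simp add: summable_on_iff_abs_summable_on_complex case_prod_unfold flip: abs_summable_equivalent)
    moreover have "bij_betw snd (Sigma UNIV ?S) UNIV"
      by (rule bij_betwI[where g = "\<lambda>p. (fst p + snd p, p)"]) auto
    ultimately have "(\<lambda>q. (f (fst (snd q)) * ?m z (fst (snd q))) *
        (g (snd (snd q)) * ?m z (snd (snd q)))) summable_on Sigma UNIV ?S"
      by (subst (asm) summable_on_reindex_bij_betw[symmetric]) auto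
    then have "(\<lambda>(\<alpha>, p). (f (fst p) * ?m z (fst p)) * (g (snd p) * ?m z (snd p)))
        summable_on Sigma UNIV ?S"
      by (simp add: case_prod_unfold)
    then have "(\<lambda>\<alpha>. \<Sum>\<^sub>\<infinity>p\<in>?S \<alpha>. (f (fst p) * ?m z (fst p)) * (g (snd p) * ?m z (snd p)))
        summable_on UNIV"
      by (rule summable_on_Sigma_banach)
    moreover have "(\<Sum>\<^sub>\<infinity>p\<in>?S \<alpha>. (f (fst p) * ?m z (fst p)) * (g (snd p) * ?m z (snd p)))
        = (f \<otimes>\<^bsub>formal_ring\<^esub> g) \<alpha> * ?m z \<alpha>" for \<alpha>
    proof -
      have "(\<Sum>\<^sub>\<infinity>p\<in>?S \<alpha>. (f (fst p) * ?m z (fst p)) * (g (snd p) * ?m z (snd p)))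
          = (\<Sum>p\<in>?S \<alpha>. (f (fst p) * ?m z (fst p)) * (g (snd p) * ?m z (snd p)))"
        by (simp add: finite_splittings)
      also have "\<dots> = (\<Sum>p\<in>?S \<alpha>. f (fst p) * g (snd p) * ?m z \<alpha>)"
        by (rule sum.cong) (auto simp: power_add prod.distrib)
      finally show ?thesis
        by (simp add: formal_ring_simps case_prod_beta sum_distrib_right)
    qed
    ultimately show ?thesis by simp
  qed
  then show ?thesis
    unfolding convergent_series_def using r(1) s(1) by (intro exI[of _ "min r s"]) auto
qed

lemma convergent_add:
  assumes "convergent_series f" "convergent_series g"
  shows "convergent_series (f \<oplus>\<^bsub>formal_ring\<^esub> g)"
proof -
  from assms obtain r s where "r > 0" "s > 0" and
    "\<And>z. (\<forall>i. norm (z $ i) < r) \<Longrightarrow> (\<lambda>\<alpha>. f \<alpha> * (\<Prod>i\<in>UNIV. (z $ i) ^ (\<alpha> $ i))) summable_on UNIV"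
    "\<And>z. (\<forall>i. norm (z $ i) < s) \<Longrightarrow> (\<lambda>\<alpha>. g \<alpha> * (\<Prod>i\<in>UNIV. (z $ i) ^ (\<alpha> $ i))) summable_on UNIV"
    unfolding convergent_series_def by blast
  then show ?thesis
    unfolding convergent_series_def
    by (intro exI[of _ "min r s"]) (auto simp: formal_ring_simps distrib_right intro!: summable_on_add)
qed

lemma convergent_uminus: "convergent_series f \<Longrightarrow> convergent_series (\<ominus>\<^bsub>formal_ring\<^esub> f)"
  by (simp add: convergent_series_def formal_a_inv summable_on_uminus)

lemma convergent_one: "convergent_series (\<one>\<^bsub>formal_ring\<^esub> :: (complex, 'n::finite) pow_series)"
proof -
  have "(\<lambda>\<alpha>. (if \<alpha> = 0 then 1 else 0) * (\<Prod>i\<in>UNIV. (z $ i) ^ (\<alpha> $ i))) summable_on UNIV"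
    for z :: "complex ^ 'n"
    by (rule finite_nonzero_values_imp_summable_on) (rule finite_subset[of _ "{0}"], auto)
  then show ?thesis
    unfolding convergent_series_def by (intro exI[of _ 1]) (simp add: formal_ring_simps)
qed

lemma germ_cring: "cring (germ_ring :: (complex, 'n::finite) pow_series ring)"
proof -
  interpret cring "formal_ring :: (complex, 'n) pow_series ring" by (rule formal_cring)
  have "subcring {f. convergent_series f} (formal_ring :: (complex, 'n) pow_series ring)"
    by (rule subcringI', rule subringI)
       (auto simp: convergent_mult convergent_add convergent_uminus convergent_one formal_ring_simps(1))
  then show ?thesis
    unfolding germ_ring_def by (subst subcring_iff[symmetric]) (auto simp: formal_ring_simps(1))
qed

lemma Supp_add: "Supp (f \<oplus>\<^bsub>formal_ring\<^esub> g) \<subseteq> Supp f \<union> Supp g"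
  by (auto simp: Supp_def formal_ring_simps)

lemma Supp_mult: "Supp (f \<otimes>\<^bsub>formal_ring\<^esub> g) \<subseteq> (\<lambda>(\<beta>, \<gamma>). \<beta> + \<gamma>) ` (Supp f \<times> Supp g)"
proof
  fix \<alpha> assume "\<alpha> \<in> Supp (f \<otimes>\<^bsub>formal_ring\<^esub> g)"
  then obtain p where "p \<in> {(\<beta>, \<gamma>). \<beta> + \<gamma> = \<alpha>}" "(case p of (\<beta>, \<gamma>) \<Rightarrow> f \<beta> * g \<gamma>) \<noteq> 0"
    unfolding Supp_def formal_ring_simps by (metis (mono_tags, lifting) mem_Collect_eq sum.neutral)
  then show "\<alpha> \<in> (\<lambda>(\<beta>, \<gamma>). \<beta> + \<gamma>) ` (Supp f \<times> Supp g)"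
    by (auto simp: Supp_def image_iff split: prod.splits)
qed

lemma restrict_exp_add: "restrict_exp u (\<alpha> + \<beta>) = restrict_exp u \<alpha> + restrict_exp u \<beta>"
  by (simp add: restrict_exp_def vec_eq_iff)

lemma gr_subcring:
  "subcring {f. finite (restrict_exp u ` Supp f)} (formal_ring :: ('k::field, 'n::finite) pow_series ring)"
proof -
  interpret cring "formal_ring :: ('k, 'n) pow_series ring" by (rule formal_cring)
  show ?thesis
  proof (rule subcringI', rule subringI)
    show "\<one>\<^bsub>formal_ring\<^esub> \<in> {f :: ('k, 'n) pow_series. finite (restrict_exp u ` Supp f)}"
      by (auto simp: formal_ring_simps Supp_def)
    fix f g :: "('k, 'n) pow_series"
    assume f: "f \<in> {f. finite (restrict_exp u ` Supp f)}"
    show "\<ominus>\<^bsub>formal_ring\<^esub> f \<in> {f. finite (restrict_exp u ` Supp f)}"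
      using f by (simp add: formal_a_inv Supp_def)
    assume g: "g \<in> {f. finite (restrict_exp u ` Supp f)}"
    have "restrict_exp u ` Supp (f \<oplus>\<^bsub>formal_ring\<^esub> g)
        \<subseteq> restrict_exp u ` Supp f \<union> restrict_exp u ` Supp g"
      using Supp_add[of f g] by blast
    then show "f \<oplus>\<^bsub>formal_ring\<^esub> g \<in> {f. finite (restrict_exp u ` Supp f)}"
      using f g by (simp add: finite_subset)
    have "restrict_exp u ` Supp (f \<otimes>\<^bsub>formal_ring\<^esub> g)
        \<subseteq> (\<lambda>(\<beta>, \<gamma>). \<beta> + \<gamma>) ` ((restrict_exp u ` Supp f) \<times> (restrict_exp u ` Supp g))"
    proof
      fix \<delta> assume "\<delta> \<in> restrict_exp u ` Supp (f \<otimes>\<^bsub>formal_ring\<^esub> g)"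
      then obtain \<beta> \<gamma> where "\<beta> \<in> Supp f" "\<gamma> \<in> Supp g" "\<delta> = restrict_exp u \<beta> + restrict_exp u \<gamma>"
        using Supp_mult[of f g] by (fastforce simp: restrict_exp_add)
      then show "\<delta> \<in> (\<lambda>(\<beta>, \<gamma>). \<beta> + \<gamma>) ` ((restrict_exp u ` Supp f) \<times> (restrict_exp u ` Supp g))"
        by auto
    qed
    then show "f \<otimes>\<^bsub>formal_ring\<^esub> g \<in> {f. finite (restrict_exp u ` Supp f)}"
      using f g by (simp add: finite_subset)
  qed (simp add: formal_ring_simps(1))
qed

lemma gr_formal_cring: "cring (gr (formal_ring :: ('k::field, 'n::finite) pow_series ring) u)"
proof -
  interpret cring "formal_ring :: ('k, 'n) pow_series ring" by (rule formal_cring)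
  show ?thesis
    using subcring_iff[THEN iffD1, OF _ gr_subcring[of u]]
    by (simp add: gr_def formal_ring_simps(1))
qed

lemma gr_germ_cring: "cring (gr (germ_ring :: (complex, 'n::finite) pow_series ring) u)"
proof -
  interpret cring "formal_ring :: (complex, 'n) pow_series ring" by (rule formal_cring)
  let ?A = "{f :: (complex, 'n) pow_series. convergent_series f}"
  let ?B = "{f :: (complex, 'n) pow_series. finite (restrict_exp u ` Supp f)}"
  have "subcring ?A formal_ring"
    using germ_cring subcring_iff[of ?A] by (simp add: germ_ring_def formal_ring_simps(1))
  then have "subcring (?A \<inter> ?B) formal_ring"
    using gr_subcring by (rule subcring_inter)
  moreover have "gr germ_ring u = formal_ring\<lparr>carrier := ?A \<inter> ?B\<rparr>"
    by (simp add: gr_def germ_ring_def Collect_conj_eq)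
  ultimately show ?thesis
    using subcring_iff[of "?A \<inter> ?B"] by (simp add: formal_ring_simps(1))
qed

lemma finite_restrict_exp_weight:
  fixes u :: "real ^ 'n::finite"
  assumes "u \<in> U_loc"
  shows "finite (restrict_exp u ` {\<alpha>. weight u \<alpha> \<ge> c})"
proof (rule finite_subset)
  show "restrict_exp u ` {\<alpha>. weight u \<alpha> \<ge> c} \<subseteq> {\<alpha>. \<forall>i. \<alpha> $ i \<le> nat \<lceil>c / u $ i\<rceil>}"
  proof clarify
    fix \<alpha> i assume \<alpha>: "weight u \<alpha> \<ge> c"
    show "restrict_exp u \<alpha> $ i \<le> nat \<lceil>c / u $ i\<rceil>"
    proof (cases "u $ i = 0")
      case False
      then have neg: "u $ i < 0" using assms by (auto simp: U_loc_def order.strict_iff_order)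
      have "weight u \<alpha> = u $ i * real (\<alpha> $ i) + (\<Sum>j\<in>UNIV - {i}. u $ j * real (\<alpha> $ j))"
        unfolding weight_def by (subst sum.remove[of _ i]) auto
      moreover have "(\<Sum>j\<in>UNIV - {i}. u $ j * real (\<alpha> $ j)) \<le> 0"
        using assms by (auto simp: U_loc_def intro!: sum_nonpos mult_nonpos_nonneg)
      ultimately have "c \<le> u $ i * real (\<alpha> $ i)" using \<alpha> by linarith
      then have "real (\<alpha> $ i) \<le> c / u $ i" using neg by (simp add: neg_le_divide_eq mult.commute)
      then have "\<alpha> $ i \<le> nat \<lceil>c / u $ i\<rceil>" by linarith
      then show ?thesis by (simp add: restrict_exp_def False)
    qed (simp add: restrict_exp_def)
  qed
qed (rule finite_bounded_exps)

lemma weight_restrict_exp: "weight u (restrict_exp u \<alpha>) = weight u \<alpha>"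
  unfolding weight_def restrict_exp_def by (rule sum.cong) auto

lemma ord_attained:
  assumes "u \<in> U_loc" "f \<noteq> (\<lambda>\<alpha>. 0)"
  shows "ord_wt u f \<in> weight u ` Supp f" "\<And>\<alpha>. \<alpha> \<in> Supp f \<Longrightarrow> weight u \<alpha> \<le> ord_wt u f"
proof -
  obtain \<alpha>0 where \<alpha>0: "\<alpha>0 \<in> Supp f" using assms(2) by (auto simp: Supp_def)
  let ?W = "weight u ` (Supp f \<inter> {\<alpha>. weight u \<alpha> \<ge> weight u \<alpha>0})"
  have "?W \<subseteq> weight u ` restrict_exp u ` {\<alpha>. weight u \<alpha> \<ge> weight u \<alpha>0}"
    by (auto simp: image_image weight_restrict_exp)
  then have fin: "finite ?W"
    using finite_restrict_exp_weight[OF assms(1)] by (meson finite_imageI finite_subset)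
  have ne: "?W \<noteq> {}" using \<alpha>0 by auto
  have M: "Max ?W \<in> weight u ` Supp f" using Max_in[OF fin ne] by auto
  have le: "weight u \<alpha> \<le> Max ?W" if "\<alpha> \<in> Supp f" for \<alpha>
  proof (cases "weight u \<alpha> \<ge> weight u \<alpha>0")
    case True
    then show ?thesis using that by (intro Max_ge[OF fin]) auto
  next
    case False
    moreover have "weight u \<alpha>0 \<le> Max ?W" using \<alpha>0 by (intro Max_ge[OF fin]) auto
    ultimately show ?thesis by linarith
  qed
  have eq: "ord_wt u f = Max ?W"
    unfolding ord_wt_def by (rule Greatest_equality) (use M le in auto)
  show "ord_wt u f \<in> weight u ` Supp f" using M by (simp only: eq)
  show "\<And>\<alpha>. \<alpha> \<in> Supp f \<Longrightarrow> weight u \<alpha> \<le> ord_wt u f" using le by (simp only: eq)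
qed

end

theory Submission
  imports Defs "HOL-Computational_Algebra.Primes"
begin

text \<open>
  The theorem holds because the equivalence classes of weights are the relatively open cells of
  finitely many systems of linear inequalities with integer coefficients, and whenever a weight
  satisfies one of these systems, its whole class is a cell of this system.

  The systems come from reduced standard bases. A \<open>standard_basis\<close> consists of a staircase \<open>E\<close>, the
  set of leading exponents of \<open>I\<close> for some local order, and for each minimal exponent \<open>e\<close> of \<open>E\<close> of
  the unique element \<open>g e\<close> of \<open>I\<close> that is \<open>x\<^sup>e\<close> plus terms outside \<open>E\<close>. Its inequalities say that
  \<open>e\<close> has the largest \<open>u\<close>-weight in \<open>g e\<close>. If \<open>u\<close> satisfies them, the initial forms of the \<open>g e\<close>
  generate \<open>in\<^sub>u(I)\<close> (\<open>initial_ideal_standard_basis\<close>), and conversely \<open>in\<^sub>u(I)\<close> determines the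
  exponents of these initial forms (\<open>initial_ideal_determines_leading_parts\<close>). Hence the class of
  \<open>u\<close> is a cell (\<open>groebner_cone_eq_cell\<close>).

  Both facts rest on division with remainder. The order that defines \<open>E\<close> may refine a weight with
  zero coordinates, and then infinitely many exponents can precede a given one. But by Dickson's lemma
  only finitely many exponents of the divisors have to be compared, so the leading exponents are also
  the leading ones for a strictly positive weight \<open>\<omega>\<close>. Along \<open>\<omega>\<close>, division is a well-founded recursion on
  coefficients, and it preserves convergence because it is contracting on small polydiscs
  (\<open>convergent_division\<close>). It does not increase the \<open>u\<close>-weight for any \<open>u\<close> that satisfies the
  inequalities of the basis.

  Each weight \<open>u\<close> satisfies the inequalities of the standard basis for an order refining \<open>u\<close>
  (\<open>standard_basis_exists\<close>). There are only finitely many staircases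
  (\<open>finitely_many_staircases\<close>), by noetherian induction on monomial ideals. From this the fan axioms
  follow by convex geometry alone (\<open>rational_polyhedral_fan_of_cells\<close>).
\<close>

section \<open>Fans cut out by finite systems of linear inequalities\<close>

definition polar_cone :: "'a::real_inner set \<Rightarrow> 'a set" where
  "polar_cone D = {u. \<forall>d\<in>D. u \<bullet> d \<le> 0}"

definition cell :: "'a::real_inner set \<Rightarrow> 'a \<Rightarrow> 'a set" where
  "cell D u = {v \<in> polar_cone D. \<forall>d\<in>D. v \<bullet> d = 0 \<longleftrightarrow> u \<bullet> d = 0}"

definition closed_cell :: "'a::real_inner set \<Rightarrow> 'a \<Rightarrow> 'a set" where
  "closed_cell D u = {v \<in> polar_cone D. \<forall>d\<in>D. u \<bullet> d = 0 \<longrightarrow> v \<bullet> d = 0}"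

lemma closed_cell_as_polar_cone:
  "closed_cell D u = polar_cone (D \<union> uminus ` {d \<in> D. u \<bullet> d = 0})" (is "_ = polar_cone ?D")
proof (intro Set.set_eqI iffI)
  fix v assume v: "v \<in> polar_cone ?D"
  have "v \<bullet> d = 0" if "d \<in> D" "u \<bullet> d = 0" for d
  proof (rule antisym)
    have "v \<bullet> (- d) \<le> 0" using v that unfolding polar_cone_def by blast
    then show "v \<bullet> d \<ge> 0" by simp
  qed (use v that in \<open>simp add: polar_cone_def\<close>)
  then show "v \<in> closed_cell D u" using v by (simp add: closed_cell_def polar_cone_def)
qed (auto simp: closed_cell_def polar_cone_def)

lemma polar_cone_Inter: "polar_cone D = (\<Inter>d\<in>D. {u. d \<bullet> u \<le> 0})"
  by (auto simp: polar_cone_def inner_commute)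

lemma closed_polar_cone: "closed (polar_cone D)"
  unfolding polar_cone_Inter by (intro closed_INT ballI closed_halfspace_le)

lemma polyhedron_polar_cone:
  fixes D :: "'a::euclidean_space set"
  shows "finite D \<Longrightarrow> polyhedron (polar_cone D)"
  unfolding polar_cone_Inter by (rule polyhedron_Inter) (auto simp: polyhedron_halfspace_le)

lemma convex_cone_polar_cone: "convex_cone (polar_cone D)"
  by (auto simp: convex_cone_iff polar_cone_def inner_left_distrib mult_nonneg_nonpos add_nonpos_nonpos)

lemma closed_closed_cell: "closed (closed_cell D u)"
  by (simp add: closed_cell_as_polar_cone closed_polar_cone)

text \<open>
  A point of the closed cell is approached from inside the cell by adding small positive multiples of
  \<open>u\<close>: these turn precisely those equalities into strict inequalities that are strict at \<open>u\<close>.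
\<close>
lemma closure_cell:
  fixes u :: "'a::real_inner"
  assumes u: "u \<in> polar_cone D"
  shows "closure (cell D u) = closed_cell D u"
proof
  show "closure (cell D u) \<subseteq> closed_cell D u"
    by (rule closure_minimal[OF _ closed_closed_cell]) (auto simp: cell_def closed_cell_def)
  show "closed_cell D u \<subseteq> closure (cell D u)"
  proof
    fix v assume v: "v \<in> closed_cell D u"
    have "v + inverse (real (Suc n)) *\<^sub>R u \<in> cell D u" for n
    proof -
      have *: "inverse (real (Suc n)) * (u \<bullet> d) < 0 \<or> u \<bullet> d = 0" if "d \<in> D" for d
      proof (cases "u \<bullet> d = 0")
        case False
        then have "u \<bullet> d < 0" using u that by (force simp: polar_cone_def)
        then show ?thesis by (simp add: mult_pos_neg)
      qed simp
      show ?thesis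
        using v u * by (fastforce simp: cell_def closed_cell_def polar_cone_def inner_left_distrib)
    qed
    moreover have "(\<lambda>n. v + inverse (real (Suc n)) *\<^sub>R u) \<longlonglongrightarrow> v + 0 *\<^sub>R u"
      by (intro tendsto_intros LIMSEQ_inverse_real_of_nat)
    ultimately show "v \<in> closure (cell D u)"
      unfolding closure_sequential by (intro exI[of _ "\<lambda>n. v + inverse (real (Suc n)) *\<^sub>R u"]) simp
  qed
qed

text \<open>
  The point \<open>w\<close> is taken in the relative interior of the face, so that a segment from any point of
  the face to \<open>w\<close> can be prolonged within the face: inequalities that are tight at \<open>w\<close> must then be
  tight at every point of the face.
\<close>
lemma face_of_closed_cell:
  fixes u :: "'a::euclidean_space"
  assumes D: "finite D" and face: "\<tau> face_of closed_cell D u" and ne: "\<tau> \<noteq> {}"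
  obtains w where "w \<in> polar_cone D" "\<tau> = closed_cell D w"
proof -
  have cvx: "convex \<tau>" using face by (rule face_of_imp_convex)
  then obtain w where w: "w \<in> rel_interior \<tau>" using ne by (metis all_not_in_conv rel_interior_eq_empty)
  have w\<tau>: "w \<in> \<tau>" using w rel_interior_subset by blast
  have \<tau>: "\<tau> \<subseteq> closed_cell D u" using face by (rule face_of_imp_subset)
  have wu: "w \<in> closed_cell D u" using w\<tau> \<tau> by blast
  have "\<tau> \<subseteq> closed_cell D w"
  proof
    fix v assume v: "v \<in> \<tau>"
    obtain e where e: "e > 1" "(1 - e) *\<^sub>R v + e *\<^sub>R w \<in> \<tau>"
      using convex_rel_interior_iff[OF cvx ne] w v by blast
    have "v \<bullet> d = 0" if "d \<in> D" "w \<bullet> d = 0" for d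
    proof -
      have "((1 - e) *\<^sub>R v + e *\<^sub>R w) \<bullet> d \<le> 0" "v \<bullet> d \<le> 0"
        using e v \<tau> that by (auto simp: closed_cell_def polar_cone_def)
      then show ?thesis using e that
        by (simp add: inner_left_distrib mult_le_0_iff)
    qed
    then show "v \<in> closed_cell D w" using v \<tau> by (auto simp: closed_cell_def)
  qed
  moreover have "closed_cell D w \<subseteq> \<tau>"
  proof
    fix v assume v: "v \<in> closed_cell D w"
    show "v \<in> \<tau>"
    proof (cases "v = w")
      case False
      \<comment> \<open>Prolong the segment from \<open>v\<close> to \<open>w\<close> slightly beyond \<open>w\<close> without leaving the cell; then
        \<open>w\<close> is an inner point of a segment with ends in the cell, and the face contains both ends.\<close>
      have "\<exists>t>0. \<forall>d\<in>D. (w + t *\<^sub>R (w - v)) \<bullet> d \<le> 0"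
        using D v wu
      proof (induction D)
        case empty
        then show ?case by (auto intro: exI[of _ 1])
      next
        case (insert d D)
        have *: "v \<in> closed_cell D w" "w \<in> closed_cell D u"
          using insert.prems by (auto simp: closed_cell_def polar_cone_def)
        obtain t where t: "t > 0" "\<forall>d\<in>D. (w + t *\<^sub>R (w - v)) \<bullet> d \<le> 0" using insert.IH[OF *] by blast
        have wd: "w \<bullet> d \<le> 0" "w \<bullet> d = 0 \<longrightarrow> v \<bullet> d = 0"
          "\<forall>c\<in>D. w \<bullet> c \<le> 0"
          using insert.prems by (auto simp: closed_cell_def polar_cone_def)
        define s where "s = (if w \<bullet> d = 0 then 1 else - (w \<bullet> d) / (1 + \<bar>(w - v) \<bullet> d\<bar>))"
        have s: "s > 0" using wd by (auto simp: s_def divide_less_0_iff)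
        have sd: "w \<bullet> d + s * ((w - v) \<bullet> d) \<le> 0"
        proof (cases "w \<bullet> d = 0")
          case True
          then show ?thesis using wd by (simp add: inner_diff_left)
        next
          case F: False
          have "s * ((w - v) \<bullet> d) \<le> s * (1 + \<bar>(w - v) \<bullet> d\<bar>)"
            using s by (intro mult_left_mono) auto
          also have "\<dots> = - (w \<bullet> d)" using F by (simp add: s_def)
          finally show ?thesis by simp
        qed
        have shrink: "w \<bullet> c + r * ((w - v) \<bullet> c) \<le> 0"
          if "w \<bullet> c \<le> 0" "w \<bullet> c + q * ((w - v) \<bullet> c) \<le> 0" "0 < r" "r \<le> q" for c q r
        proof (cases "(w - v) \<bullet> c \<le> 0")
          case True
          then have "r * ((w - v) \<bullet> c) \<le> 0" using that(3) by (simp add: mult_nonneg_nonpos)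
          then show ?thesis using that by linarith
        next
          case False
          then have "r * ((w - v) \<bullet> c) \<le> q * ((w - v) \<bullet> c)"
            using that by (intro mult_right_mono) auto
          then show ?thesis using that by linarith
        qed
        show ?case
        proof (intro exI[of _ "min s t"] conjI ballI)
          show "min s t > 0" using s t by simp
          fix c assume "c \<in> insert d D"
          then show "(w + min s t *\<^sub>R (w - v)) \<bullet> c \<le> 0"
            using shrink[of d s "min s t"] shrink[of c t "min s t"] s t wd sd
            by (auto simp: inner_left_distrib)
        qed
      qed
      then obtain t where t: "t > 0" "\<forall>d\<in>D. (w + t *\<^sub>R (w - v)) \<bullet> d \<le> 0" by blast
      let ?w = "w + t *\<^sub>R (w - v)"
      have v': "v \<in> closed_cell D u" using v wu by (auto simp: closed_cell_def)
      moreover have "?w \<in> closed_cell D u"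
        using t v' wu by (auto simp: closed_cell_def polar_cone_def inner_left_distrib inner_diff_left)
      moreover have "w \<in> open_segment v ?w"
        unfolding in_segment
      proof (intro conjI exI[of _ "1 / (1 + t)"])
        have "w = (1 / (1+t)) *\<^sub>R ((1 + t) *\<^sub>R w)" using t by simp
        also have "(1 + t) *\<^sub>R w = t *\<^sub>R v + ?w" by (simp add: algebra_simps)
        also have "(1 / (1+t)) *\<^sub>R \<dots> = (1 - 1 / (1+t)) *\<^sub>R v + (1 / (1+t)) *\<^sub>R ?w"
          using t by (simp add: scaleR_add_right field_simps)
        finally show "w = (1 - 1 / (1+t)) *\<^sub>R v + (1 / (1+t)) *\<^sub>R ?w" .
        show "v \<noteq> ?w"
        proof
          assume "v = ?w"
          then have "(1 + t) *\<^sub>R (v - w) = 0" by (simp add: algebra_simps)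
          then show False using t False by auto
        qed
      qed (use t in auto)
      ultimately show ?thesis using face w\<tau> unfolding face_of_def by blast
    qed (simp add: w\<tau>)
  qed
  ultimately have "\<tau> = closed_cell D w" by blast
  moreover have "w \<in> polar_cone D" using wu by (simp add: closed_cell_def)
  ultimately show ?thesis using that by blast
qed

subsection \<open>Rational generators\<close>

lemma rational_inner:
  fixes x y :: "real ^ 'n::finite"
  assumes "\<forall>i. x $ i \<in> \<rat>" "\<forall>i. y $ i \<in> \<rat>"
  shows "x \<bullet> y \<in> \<rat>"
  using assms by (auto simp: inner_vec_def)

lemma in_convex_cone_hull_finite:
  assumes "finite G" "x \<in> convex_cone hull G"
  shows "\<exists>c. (\<forall>g\<in>G. 0 \<le> c g) \<and> x = (\<Sum>g\<in>G. c g *\<^sub>R g)"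
  using assms
proof (induction G arbitrary: x)
  case (insert g G)
  have "convex_cone hull {g} = {c *\<^sub>R g | c. 0 \<le> c}"
    by (auto simp: convex_cone_hull_convex_hull_nonempty)
  then obtain c y where c: "c \<ge> 0" and y: "y \<in> convex_cone hull G" and x: "x = c *\<^sub>R g + y"
    using insert.prems convex_cone_hull_Un[of "{g}" G] by auto
  obtain b where b: "\<forall>g\<in>G. 0 \<le> b g" "y = (\<Sum>g\<in>G. b g *\<^sub>R g)" using insert.IH[OF y] by blast
  have "(\<Sum>h\<in>G. (b(g := c)) h *\<^sub>R h) = (\<Sum>h\<in>G. b h *\<^sub>R h)"
    using insert.hyps by (intro sum.cong) auto
  then show ?case using insert.hyps b c x by (intro exI[of _ "b(g := c)"]) auto
qed simp

lemma convex_cone_hull_sum: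
  "(\<And>i. i \<in> S \<Longrightarrow> x i \<in> convex_cone hull G) \<Longrightarrow> sum x S \<in> convex_cone hull G"
  by (induction S rule: infinite_finite_induct)
     (auto simp: convex_cone_hull_contains_0 convex_cone_hull_add)

text \<open>
  The double description step: the generators on the wrong side of the hyperplane are replaced by
  the points in which the hyperplane cuts the two-dimensional cones that they span with the
  generators on the right side.
\<close>
lemma rational_cone_inter_halfspace:
  fixes d :: "real ^ 'n::finite"
  assumes "rational_cone \<sigma>" and d: "\<forall>i. d $ i \<in> \<rat>"
  shows "rational_cone (\<sigma> \<inter> {u. u \<bullet> d \<le> 0})"
proof -
  obtain G where G: "finite G" "\<forall>v\<in>G. \<forall>i. v $ i \<in> \<rat>" and \<sigma>: "\<sigma> = convex_cone hull G"
    using assms(1) unfolding rational_cone_def by blast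
  define P where "P = {g \<in> G. g \<bullet> d > 0}"
  define N where "N = {g \<in> G. g \<bullet> d < 0}"
  define Z where "Z = {g \<in> G. g \<bullet> d = 0}"
  define mix where "mix = (\<lambda>g h. (g \<bullet> d) *\<^sub>R h - (h \<bullet> d) *\<^sub>R g)"
  define H where "H = N \<union> Z \<union> (\<lambda>(g, h). mix g h) ` (P \<times> N)"
  have fin: "finite P" "finite N" "finite Z" using G by (auto simp: P_def N_def Z_def)
  have "H \<subseteq> \<sigma> \<inter> {u. u \<bullet> d \<le> 0}"
  proof -
    have in\<sigma>: "g \<in> \<sigma>" if "g \<in> G" for g using that \<sigma> by (simp add: hull_inc)
    have "mix g h \<in> \<sigma>" if "g \<in> P" "h \<in> N" for g h
    proof -
      have "(g \<bullet> d) *\<^sub>R h + (- (h \<bullet> d)) *\<^sub>R g \<in> convex_cone hull G"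
        using that by (intro convex_cone_hull_add convex_cone_hull_mul) (auto simp: P_def N_def hull_inc)
      then show ?thesis by (simp add: mix_def \<sigma>)
    qed
    then show ?thesis
      unfolding H_def using in\<sigma> by (auto simp: N_def Z_def mix_def inner_diff_left)
  qed
  moreover have "convex_cone (\<sigma> \<inter> {u. u \<bullet> d \<le> 0})"
  proof -
    have "{u. u \<bullet> d \<le> 0} = polar_cone {d}" by (simp add: polar_cone_def)
    then show ?thesis
      using convex_cone_convex_cone_hull[of G] convex_cone_polar_cone[of "{d}"]
      by (simp add: \<sigma> convex_cone_iff)
  qed
  ultimately have sub: "convex_cone hull H \<subseteq> \<sigma> \<inter> {u. u \<bullet> d \<le> 0}"
    by (rule hull_minimal)
  have "\<sigma> \<inter> {u. u \<bullet> d \<le> 0} \<subseteq> convex_cone hull H"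
  proof
    fix x assume x: "x \<in> \<sigma> \<inter> {u. u \<bullet> d \<le> 0}"
    then obtain c where c: "\<forall>g\<in>G. 0 \<le> c g" and xc: "x = (\<Sum>g\<in>G. c g *\<^sub>R g)"
      using in_convex_cone_hull_finite[OF G(1)] \<sigma> by blast
    have split: "sum f G = sum f P + sum f N + sum f Z" for f :: "real ^ 'n \<Rightarrow> 'b::comm_monoid_add"
    proof -
      have "G = (P \<union> N) \<union> Z" by (auto simp: P_def N_def Z_def)
      then have "sum f G = sum f ((P \<union> N) \<union> Z)" by simp
      also have "\<dots> = sum f (P \<union> N) + sum f Z"
        using fin by (intro sum.union_disjoint) (auto simp: P_def N_def Z_def)
      also have "sum f (P \<union> N) = sum f P + sum f N"
        using fin by (intro sum.union_disjoint) (auto simp: P_def N_def)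
      finally show ?thesis .
    qed
    define p where "p = (\<Sum>g\<in>P. c g * (g \<bullet> d))"
    define n where "n = (\<Sum>h\<in>N. c h * - (h \<bullet> d))"
    have p0: "p \<ge> 0" unfolding p_def using c by (intro sum_nonneg) (auto simp: P_def)
    have n0: "n \<ge> 0" unfolding n_def using c
      by (intro sum_nonneg) (auto simp: N_def mult_nonneg_nonpos less_imp_le)
    have "x \<bullet> d = (\<Sum>g\<in>G. c g * (g \<bullet> d))" by (simp add: xc inner_sum_left)
    also have "\<dots> = p - n" by (simp add: split p_def n_def Z_def sum_negf)
    finally have pn: "p \<le> n" using x by simp
    have xs: "x = (\<Sum>g\<in>P. c g *\<^sub>R g) + (\<Sum>g\<in>N. c g *\<^sub>R g) + (\<Sum>g\<in>Z. c g *\<^sub>R g)"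
      using xc split by simp
    have inH: "c g *\<^sub>R g \<in> convex_cone hull H" if "g \<in> N \<union> Z" for g
      using that c by (intro convex_cone_hull_mul hull_inc) (auto simp: H_def N_def Z_def)
    show "x \<in> convex_cone hull H"
    proof (cases "n = 0")
      case True
      then have "p = 0" using pn p0 by simp
      then have "\<forall>g\<in>P. c g * (g \<bullet> d) = 0"
        unfolding p_def using c fin by (subst (asm) sum_nonneg_eq_0_iff) (auto simp: P_def)
      then have "\<forall>g\<in>P. c g = 0" by (auto simp: P_def)
      then show ?thesis
        unfolding xs using inH by (auto intro!: convex_cone_hull_add convex_cone_hull_sum)
    next
      case False
      then have npos: "n > 0" using n0 by simp
      \<comment> \<open>The share \<open>p / n\<close> of the generators in \<open>N\<close> exactly cancels the excess of those in \<open>P\<close>.\<close>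
      have "(\<Sum>g\<in>P. \<Sum>h\<in>N. (c g * c h / n) *\<^sub>R mix g h)
          = (\<Sum>g\<in>P. \<Sum>h\<in>N. (c g * (g \<bullet> d) / n) *\<^sub>R (c h *\<^sub>R h))
          + (\<Sum>g\<in>P. \<Sum>h\<in>N. (c h * - (h \<bullet> d) / n) *\<^sub>R (c g *\<^sub>R g))"
        unfolding mix_def sum.distrib[symmetric]
        by (intro sum.cong refl) (simp add: algebra_simps)
      also have "(\<Sum>g\<in>P. \<Sum>h\<in>N. (c g * (g \<bullet> d) / n) *\<^sub>R (c h *\<^sub>R h))
          = (p / n) *\<^sub>R (\<Sum>h\<in>N. c h *\<^sub>R h)"
        unfolding scaleR_sum_right[symmetric] scaleR_sum_left[symmetric] sum_divide_distrib[symmetric]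
        by (simp add: p_def)
      also have "(\<Sum>g\<in>P. \<Sum>h\<in>N. (c h * - (h \<bullet> d) / n) *\<^sub>R (c g *\<^sub>R g)) = (\<Sum>g\<in>P. c g *\<^sub>R g)"
        unfolding scaleR_sum_left[symmetric] sum_divide_distrib[symmetric] n_def[symmetric]
        using npos by simp
      finally have "x = (\<Sum>g\<in>P. \<Sum>h\<in>N. (c g * c h / n) *\<^sub>R mix g h)
          + (\<Sum>h\<in>N. (1 - p / n) *\<^sub>R (c h *\<^sub>R h)) + (\<Sum>g\<in>Z. c g *\<^sub>R g)"
        unfolding xs scaleR_sum_right[symmetric] by (simp add: algebra_simps)
      moreover have "(c g * c h / n) *\<^sub>R mix g h \<in> convex_cone hull H" if "g \<in> P" "h \<in> N" for g h
        using that c npos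
        by (intro convex_cone_hull_mul hull_inc) (auto simp: H_def P_def N_def)
      moreover have "(1 - p / n) *\<^sub>R (c h *\<^sub>R h) \<in> convex_cone hull H" if "h \<in> N" for h
        using that inH[of h] pn npos by (intro convex_cone_hull_mul[of "c h *\<^sub>R h"]) auto
      ultimately show ?thesis
        using inH by (auto intro!: convex_cone_hull_add convex_cone_hull_sum)
    qed
  qed
  with sub have "\<sigma> \<inter> {u. u \<bullet> d \<le> 0} = convex_cone hull H" by blast
  moreover have "finite H" using fin by (simp add: H_def)
  moreover have "v $ i \<in> \<rat>" if "v \<in> H" for v i
    using that G d rational_inner[of _ d] by (auto simp: H_def mix_def P_def N_def Z_def)
  ultimately show ?thesis unfolding rational_cone_def by blast
qed

lemma U_loc_eq_polar_cone: "(U_loc :: (real ^ 'n::finite) set) = polar_cone (range (\<lambda>i. axis i 1))"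
  by (simp add: U_loc_def polar_cone_def inner_axis)

lemma rational_cone_U_loc: "rational_cone (U_loc :: (real ^ 'n::finite) set)"
proof -
  let ?G = "range (\<lambda>i. - axis i 1) :: (real ^ 'n) set"
  have "x \<in> convex_cone hull ?G" if "x \<in> U_loc" for x
  proof -
    have x: "x = (\<Sum>i\<in>UNIV. (- (x $ i)) *\<^sub>R (- axis i 1))"
      by (simp add: vec_eq_iff axis_def if_distrib sum.delta cong: if_cong)
    have "(- (x $ i)) *\<^sub>R (- axis i 1) \<in> convex_cone hull ?G" for i
      using that by (intro convex_cone_hull_mul hull_inc) (auto simp: U_loc_def)
    then have "(\<Sum>i\<in>UNIV. (- (x $ i)) *\<^sub>R (- axis i 1)) \<in> convex_cone hull ?G"
      by (rule convex_cone_hull_sum)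
    with x show ?thesis by simp
  qed
  moreover have "convex_cone hull ?G \<subseteq> U_loc"
    unfolding U_loc_eq_polar_cone
  proof (rule hull_minimal)
    show "?G \<subseteq> polar_cone (range (\<lambda>i. axis i 1))"
      by (auto simp: polar_cone_def inner_axis) (simp add: axis_def)
  qed (rule convex_cone_polar_cone)
  ultimately have "U_loc = convex_cone hull ?G" by blast
  then show ?thesis
    unfolding rational_cone_def by (intro exI[of _ ?G]) (auto simp: axis_def)
qed

lemma rational_cone_polar_cone:
  fixes D :: "(real ^ 'n::finite) set"
  assumes "finite D" "\<forall>d\<in>D. \<forall>i. d $ i \<in> \<rat>"
  shows "rational_cone (U_loc \<inter> polar_cone D)"
  using assms
proof (induction D)
  case (insert d D)
  have "U_loc \<inter> polar_cone (insert d D) = (U_loc \<inter> polar_cone D) \<inter> {u. u \<bullet> d \<le> 0}"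
    by (auto simp: polar_cone_def)
  then show ?case using insert by (simp add: rational_cone_inter_halfspace)
qed (simp add: polar_cone_def rational_cone_U_loc)

text \<open>
  Closures of cells are closed cells, so faces are no problem: a face of a closed cell is again one.
  The intersection of two closed cells that come from different systems is a face because both are
  unions of classes and the classes do not depend on the system: the smallest face around a common
  point is the closure of the class of this point.
\<close>
theorem rational_polyhedral_fan_of_cells:
  fixes cls :: "real ^ 'n::finite \<Rightarrow> (real ^ 'n) set"
  assumes fin: "finite \<D>"
    and D: "\<And>D. D \<in> \<D> \<Longrightarrow> finite D \<and> range (\<lambda>i. axis i 1) \<subseteq> D \<and> (\<forall>d\<in>D. \<forall>i. d $ i \<in> \<rat>)"
    and cover: "\<And>u. u \<in> U_loc \<Longrightarrow> \<exists>D\<in>\<D>. u \<in> polar_cone D"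
    and cls: "\<And>D u. D \<in> \<D> \<Longrightarrow> u \<in> polar_cone D \<Longrightarrow> cls u = cell D u"
  shows "rational_polyhedral_fan (closure ` cls ` U_loc)"
proof -
  let ?F = "closure ` cls ` U_loc"
  have sub_U: "polar_cone D \<subseteq> U_loc" if "D \<in> \<D>" for D
    using D[OF that] unfolding U_loc_eq_polar_cone by (auto simp: polar_cone_def)
  have cl: "closure (cls u) = closed_cell D u" if "D \<in> \<D>" "u \<in> polar_cone D" for D u
    using that by (simp add: cls closure_cell)
  have F: "\<exists>D\<in>\<D>. \<exists>u\<in>polar_cone D. \<sigma> = closed_cell D u" if "\<sigma> \<in> ?F" for \<sigma>
    using that cover cl by fastforce
  have F': "closed_cell D u \<in> ?F" if "D \<in> \<D>" "u \<in> polar_cone D" for D u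
    using that cl[OF that] sub_U by blast
  have "?F \<subseteq> (\<lambda>(D, D'). polar_cone (D \<union> uminus ` D')) ` (SIGMA D:\<D>. Pow D)"
    using F by (force simp: closed_cell_as_polar_cone)
  moreover have "finite (SIGMA D:\<D>. Pow D)" using fin D by (intro finite_SigmaI) auto
  ultimately have finite_F: "finite ?F" by (meson finite_imageI finite_subset)
  have cones: "polyhedron \<sigma> \<and> convex_cone \<sigma> \<and> rational_cone \<sigma>" if \<sigma>: "\<sigma> \<in> ?F" for \<sigma>
  proof -
    obtain D u where u: "D \<in> \<D>" "u \<in> polar_cone D" "\<sigma> = closed_cell D u" using F[OF \<sigma>] by blast
    let ?D = "D \<union> uminus ` {d \<in> D. u \<bullet> d = 0}"
    have eq: "\<sigma> = polar_cone ?D" using u(3) closed_cell_as_polar_cone by blast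
    have "U_loc \<inter> polar_cone ?D = polar_cone ?D"
      using sub_U[OF u(1)] by (auto simp: polar_cone_def)
    moreover have "finite ?D" "\<forall>d\<in>?D. \<forall>i. d $ i \<in> \<rat>" using D[OF u(1)] by auto
    ultimately have "rational_cone \<sigma>"
      using rational_cone_polar_cone[of ?D] eq by simp
    with eq show ?thesis
      using polyhedron_polar_cone[OF \<open>finite ?D\<close>] convex_cone_polar_cone[of ?D] by simp
  qed
  have faces: "\<tau> \<in> ?F" if \<sigma>: "\<sigma> \<in> ?F" and \<tau>: "\<tau> face_of \<sigma>" "\<tau> \<noteq> {}" for \<sigma> \<tau>
  proof -
    obtain D u where u: "D \<in> \<D>" "\<sigma> = closed_cell D u" using F[OF \<sigma>] by blast
    moreover have "finite D" using D[OF u(1)] by blast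
    ultimately obtain w where "w \<in> polar_cone D" "\<tau> = closed_cell D w"
      using face_of_closed_cell \<tau> by metis
    then show ?thesis using F' u(1) by blast
  qed
  have meet: "\<sigma> \<inter> \<tau> face_of \<sigma>" if \<sigma>: "\<sigma> \<in> ?F" and \<tau>: "\<tau> \<in> ?F" for \<sigma> \<tau>
  proof -
    obtain D u where u: "D \<in> \<D>" "u \<in> polar_cone D" "\<sigma> = closed_cell D u" using F[OF \<sigma>] by blast
    obtain D' u' where u': "D' \<in> \<D>" "u' \<in> polar_cone D'" "\<tau> = closed_cell D' u'" using F[OF \<tau>] by blast
    have convex: "convex \<sigma>" "convex \<tau>"
      using convex_cone_polar_cone unfolding u u' closed_cell_as_polar_cone convex_cone_def by blast+
    \<comment> \<open>Both cones are unions of classes; a point \<open>x\<close> common to both brings its whole class along.\<close>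
    have key: "closed_cell D x \<subseteq> \<tau>" if "x \<in> \<sigma> \<inter> \<tau>" for x
    proof -
      have "x \<in> polar_cone D" "x \<in> polar_cone D'" using that by (auto simp: u u' closed_cell_def)
      then have "closed_cell D x = closed_cell D' x" using cl u(1) u'(1) by metis
      also have "\<dots> \<subseteq> \<tau>" using that by (auto simp: u' closed_cell_def)
      finally show ?thesis .
    qed
    have "a \<in> \<tau>" "b \<in> \<tau>" if "a \<in> \<sigma>" "b \<in> \<sigma>" "x \<in> \<sigma> \<inter> \<tau>" "x \<in> open_segment a b" for a b x
    proof -
      obtain t where t: "0 < t" "t < 1" and x: "x = (1 - t) *\<^sub>R a + t *\<^sub>R b"
        using \<open>x \<in> open_segment a b\<close> by (auto simp: in_segment)
      have "a \<bullet> d = 0 \<and> b \<bullet> d = 0" if d: "d \<in> D" "x \<bullet> d = 0" for d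
      proof -
        have "(1 - t) * (a \<bullet> d) + t * (b \<bullet> d) = 0" using d by (simp add: x inner_left_distrib)
        moreover have "a \<bullet> d \<le> 0" "b \<bullet> d \<le> 0"
          using \<open>a \<in> \<sigma>\<close> \<open>b \<in> \<sigma>\<close> d by (auto simp: u closed_cell_def polar_cone_def)
        then have "(1 - t) * (a \<bullet> d) \<le> 0" "t * (b \<bullet> d) \<le> 0" using t by (auto simp: mult_nonneg_nonpos)
        ultimately have "(1 - t) * (a \<bullet> d) = 0" "t * (b \<bullet> d) = 0" by linarith+
        then show ?thesis using t by simp
      qed
      then have "a \<in> closed_cell D x" "b \<in> closed_cell D x"
        using \<open>a \<in> \<sigma>\<close> \<open>b \<in> \<sigma>\<close> by (auto simp: u closed_cell_def)
      then show "a \<in> \<tau>" "b \<in> \<tau>" using key[OF \<open>x \<in> \<sigma> \<inter> \<tau>\<close>] by auto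
    qed
    then have "\<forall>a\<in>\<sigma>. \<forall>b\<in>\<sigma>. \<forall>x\<in>\<sigma> \<inter> \<tau>. x \<in> open_segment a b \<longrightarrow> a \<in> \<sigma> \<inter> \<tau> \<and> b \<in> \<sigma> \<inter> \<tau>"
      by blast
    then show ?thesis
      unfolding face_of_def using convex_Int[OF convex] by blast
  qed
  have "\<sigma> \<inter> \<tau> face_of \<tau>" if "\<sigma> \<in> ?F" "\<tau> \<in> ?F" for \<sigma> \<tau>
    by (subst Int_commute) (rule meet[OF that(2,1)])
  with meet have "\<forall>\<sigma>\<in>?F. \<forall>\<tau>\<in>?F. \<sigma> \<inter> \<tau> face_of \<sigma> \<and> \<sigma> \<inter> \<tau> face_of \<tau>"
    by (intro ballI conjI)
  moreover have "\<forall>\<sigma>\<in>?F. \<forall>\<tau>. \<tau> face_of \<sigma> \<and> \<tau> \<noteq> {} \<longrightarrow> \<tau> \<in> ?F"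
    by (intro ballI allI impI) (elim conjE, rule faces)
  moreover have "\<forall>\<sigma>\<in>?F. polyhedron \<sigma> \<and> convex_cone \<sigma>" "\<forall>\<sigma>\<in>?F. rational_cone \<sigma>"
    by (intro ballI conjI; drule cones; elim conjE; assumption)+
  ultimately show ?thesis
    unfolding rational_polyhedral_fan_def polyhedral_fan_def using finite_F by (intro conjI)
qed

section \<open>Exponent vectors and Dickson's lemma\<close>

lemma nondecreasing_subsequence:
  fixes s :: "nat \<Rightarrow> nat"
  obtains r where "strict_mono r" "incseq (s \<circ> r)"
proof -
  obtain f where f: "strict_mono f" "monoseq (\<lambda>n. s (f n))" using seq_monosub by blast
  show ?thesis
  proof (cases "incseq (\<lambda>n. s (f n))")
    case True
    then show ?thesis using f that by (simp add: o_def)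
  next
    case False
    then have dec: "decseq (\<lambda>n. s (f n))" using f by (simp add: monoseq_iff)
    obtain k where k: "\<And>n. s (f k) \<le> s (f n)"
      using ex_has_least_nat[of "\<lambda>_. True" 0 "\<lambda>n. s (f n)"] by auto
    show ?thesis
    proof (rule that[of "\<lambda>n. f (k + n)"])
      show "strict_mono (\<lambda>n. f (k + n))" using f by (simp add: strict_mono_def)
      have "s (f (k + n)) = s (f k)" for n
        using k[of "k + n"] decseqD[OF dec, of k "k + n"] by simp
      then show "incseq (s \<circ> (\<lambda>n. f (k + n)))" by (simp add: incseq_def)
    qed
  qed
qed

text \<open>
  Pass to a subsequence on which all coordinates are nondecreasing, one coordinate after the other.
\<close>
lemma Dickson:
  fixes s :: "nat \<Rightarrow> nat ^ 'n::finite"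
  obtains i j where "i < j" "s i \<le> s j"
proof -
  have "\<exists>r. strict_mono r \<and> (\<forall>i\<in>J. incseq (\<lambda>k. s (r k) $ i))" if "finite J" for J :: "'n set"
    using that
  proof (induction J)
    case empty
    then show ?case using strict_mono_id by auto
  next
    case (insert i J)
    then obtain r where r: "strict_mono r" "\<forall>i\<in>J. incseq (\<lambda>k. s (r k) $ i)" by blast
    obtain q where q: "strict_mono q" "incseq ((\<lambda>k. s (r k) $ i) \<circ> q)"
      by (rule nondecreasing_subsequence)
    show ?case
    proof (intro exI conjI ballI)
      show "strict_mono (r \<circ> q)" using r q by (simp add: strict_mono_o)
      fix j assume "j \<in> insert i J"
      moreover have "incseq (\<lambda>k. s (r (q k)) $ j)" if "j \<in> J"
        using r(2) that monoD[OF strict_mono_mono[OF q(1)]] by (auto simp: incseq_def)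
      ultimately show "incseq (\<lambda>k. s ((r \<circ> q) k) $ j)" using q(2) by (auto simp: o_def)
    qed
  qed
  from this[of UNIV] obtain r where r: "strict_mono r" "\<forall>i. incseq (\<lambda>k. s (r k) $ i)" by auto
  then have "r 0 < r 1" "s (r 0) \<le> s (r 1)"
    by (auto simp: strict_mono_less less_eq_vec_def incseq_def)
  then show ?thesis by (rule that)
qed

definition minimal_exps :: "(nat ^ 'n::finite) set \<Rightarrow> (nat ^ 'n) set" where
  "minimal_exps S = {\<alpha> \<in> S. \<forall>\<beta>\<in>S. \<beta> \<le> \<alpha> \<longrightarrow> \<beta> = \<alpha>}"

definition multiples :: "(nat ^ 'n::finite) set \<Rightarrow> (nat ^ 'n) set" where
  "multiples S = {\<alpha>. \<exists>\<beta>\<in>S. \<beta> \<le> \<alpha>}"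

lemma minimal_exps_subset: "minimal_exps S \<subseteq> S"
  by (auto simp: minimal_exps_def)

lemma finite_minimal_exps: "finite (minimal_exps (S :: (nat ^ 'n::finite) set))"
proof (rule ccontr)
  assume "infinite (minimal_exps S)"
  then obtain s :: "nat \<Rightarrow> nat ^ 'n" where s: "inj s" "range s \<subseteq> minimal_exps S"
    using infinite_countable_subset by blast
  obtain i j where "i < j" "s i \<le> s j" by (rule Dickson)
  moreover have "s i \<in> minimal_exps S" "s j \<in> minimal_exps S" using s(2) by auto
  ultimately have "s i = s j" by (auto simp: minimal_exps_def)
  then show False using s \<open>i < j\<close> by (simp add: inj_eq)
qed

lemma obtain_minimal_exp:
  assumes "\<alpha> \<in> S"
  obtains \<beta> where "\<beta> \<in> minimal_exps S" "\<beta> \<le> \<alpha>"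
proof -
  let ?size = "\<lambda>\<beta>. \<Sum>i\<in>UNIV. \<beta> $ i"
  obtain \<beta> where \<beta>: "\<beta> \<in> S" "\<beta> \<le> \<alpha>"
    and least: "\<And>\<gamma>. \<gamma> \<in> S \<Longrightarrow> \<gamma> \<le> \<alpha> \<Longrightarrow> ?size \<beta> \<le> ?size \<gamma>"
    using ex_has_least_nat[of "\<lambda>\<beta>. \<beta> \<in> S \<and> \<beta> \<le> \<alpha>" \<alpha> ?size] assms by blast
  have "\<gamma> = \<beta>" if "\<gamma> \<in> S" "\<gamma> \<le> \<beta>" for \<gamma>
  proof (rule ccontr)
    assume "\<gamma> \<noteq> \<beta>"
    then obtain i where "\<gamma> $ i \<noteq> \<beta> $ i" by (auto simp: vec_eq_iff)
    then have "?size \<gamma> < ?size \<beta>"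
      using that(2) by (intro sum_strict_mono_ex1) (auto simp: less_eq_vec_def order.strict_iff_order)
    then show False using least[OF that(1)] that \<beta> by (meson leD order_trans)
  qed
  then have "\<beta> \<in> minimal_exps S" using \<beta> by (auto simp: minimal_exps_def)
  then show ?thesis using that \<beta> by blast
qed

lemma multiples_minimal_exps: "\<forall>\<alpha>\<in>E. \<forall>\<beta>. \<alpha> \<le> \<beta> \<longrightarrow> \<beta> \<in> E \<Longrightarrow> multiples (minimal_exps E) = E"
  unfolding multiples_def using minimal_exps_subset[of E] by (blast elim: obtain_minimal_exp)

text \<open>
  The ascending chain condition for monomial ideals, as an induction principle.
\<close>
lemma wf_multiples: "wf {(multiples T, multiples S) | S T :: (nat ^ 'n::finite) set. multiples S \<subset> multiples T}"
  unfolding wf_iff_no_infinite_down_chain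
proof clarify
  fix F :: "nat \<Rightarrow> (nat ^ 'n) set"
  assume "\<forall>i. (F (Suc i), F i) \<in> {(multiples T, multiples S) | S T. multiples S \<subset> multiples T}"
  then have *: "\<exists>S T. F (Suc i) = multiples T \<and> F i = multiples S \<and> multiples S \<subset> multiples T" for i
    by auto
  have F: "\<exists>S. F i = multiples S" "F i \<subset> F (Suc i)" for i using *[of i] by auto
  have "\<forall>i. \<exists>x. x \<in> F (Suc i) - F i" using F(2) by blast
  then obtain m where m: "\<And>i. m i \<in> F (Suc i) - F i" by metis
  obtain i j where ij: "i < j" "m i \<le> m j" by (rule Dickson)
  obtain S where "F (Suc i) = multiples S" using F(1) by blast
  then have "m j \<in> F (Suc i)" using m[of i] ij(2) by (auto simp: multiples_def intro: order_trans)
  moreover have "incseq F" using F(2) by (intro incseq_SucI) blast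
  ultimately show False using m[of j] ij(1) incseqD[of F "Suc i" j] by auto
qed

lemma le_add_exp: "\<alpha> \<le> \<alpha> + (\<beta> :: nat ^ 'n::finite)" "\<alpha> \<le> \<beta> + \<alpha>"
  by (simp_all add: less_eq_vec_def)

lemma exp_diff_add: "\<beta> \<le> \<alpha> \<Longrightarrow> \<alpha> - \<beta> + \<beta> = (\<alpha> :: nat ^ 'n::finite)"
  "\<beta> \<le> \<alpha> \<Longrightarrow> \<beta> + (\<alpha> - \<beta>) = (\<alpha> :: nat ^ 'n::finite)"
  by (simp_all add: less_eq_vec_def vec_eq_iff)

lemma add_diff_exp: "\<alpha> + \<beta> - \<beta> = (\<alpha> :: nat ^ 'n::finite)" "\<beta> + \<alpha> - \<beta> = (\<alpha> :: nat ^ 'n::finite)"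
  by (simp_all add: vec_eq_iff)

lemma finite_divisors: "finite {\<beta>. \<beta> \<le> (\<alpha> :: nat ^ 'n::finite)}"
  using finite_bounded_exps[of "\<lambda>i. \<alpha> $ i"] by (simp add: less_eq_vec_def)

lemma weight_add: "weight u (\<alpha> + \<beta>) = weight u \<alpha> + weight u \<beta>"
  by (simp add: weight_def sum.distrib distrib_left)

lemma weight_diff: "\<beta> \<le> \<alpha> \<Longrightarrow> weight u (\<alpha> - \<beta>) = weight u \<alpha> - weight u \<beta>"
  using weight_add[of u "\<alpha> - \<beta>" \<beta>] by (simp add: exp_diff_add)

definition positive_weight :: "real ^ 'n::finite \<Rightarrow> bool" where
  "positive_weight \<omega> \<longleftrightarrow> (\<forall>i. 0 < \<omega> $ i)"

lemma weight_uminus: "weight (- u) \<alpha> = - weight u \<alpha>"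
  by (simp add: weight_def sum_negf)

lemma weight_nonpos: "u \<in> U_loc \<Longrightarrow> weight u \<alpha> \<le> 0"
  by (auto simp: weight_def U_loc_def intro!: sum_nonpos mult_nonpos_nonneg)

lemma positive_weight_uminus: "positive_weight \<omega> \<Longrightarrow> - \<omega> \<in> U_loc"
  by (auto simp: positive_weight_def U_loc_def less_imp_le)

lemma weight_nonneg: "positive_weight \<omega> \<Longrightarrow> weight \<omega> \<alpha> \<ge> 0"
  using weight_nonpos[OF positive_weight_uminus] by (simp add: weight_uminus)

lemma weight_pos:
  assumes "positive_weight \<omega>" "\<alpha> \<noteq> 0"
  shows "weight \<omega> \<alpha> > 0"
proof -
  obtain i where "\<alpha> $ i \<noteq> 0" using assms by (auto simp: vec_eq_iff)
  then show ?thesis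
    unfolding weight_def using assms
    by (intro sum_pos2[of _ i]) (auto simp: positive_weight_def less_imp_le)
qed

lemma weight_mono: "u \<in> U_loc \<Longrightarrow> \<alpha> \<le> \<beta> \<Longrightarrow> weight u \<beta> \<le> weight u \<alpha>"
  using weight_nonpos[of u "\<beta> - \<alpha>"] by (simp add: weight_diff)

lemma weight_strict_mono:
  assumes "positive_weight \<omega>" "\<alpha> \<le> \<beta>" "\<alpha> \<noteq> \<beta>"
  shows "weight \<omega> \<alpha> < weight \<omega> \<beta>"
proof -
  have "\<beta> - \<alpha> \<noteq> 0" using assms exp_diff_add(1)[of \<alpha> \<beta>] by auto
  then show ?thesis using weight_pos[OF assms(1)] weight_diff[OF assms(2), of \<omega>] by fastforce
qed

text \<open>
  This is what makes recursion along a strictly positive weight well-founded. A weight with zero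
  coordinates does not have this property.
\<close>
lemma finite_weight_le:
  assumes "positive_weight \<omega>"
  shows "finite {\<alpha>. weight \<omega> \<alpha> \<le> c}"
proof -
  have "restrict_exp (- \<omega>) \<alpha> = \<alpha>" for \<alpha>
    using assms by (auto simp: restrict_exp_def vec_eq_iff positive_weight_def) (metis less_irrefl)
  then show ?thesis
    using finite_restrict_exp_weight[OF positive_weight_uminus[OF assms], of "- c"]
    by (simp add: weight_uminus)
qed

lemma wf_weight:
  assumes "positive_weight \<omega>"
  shows "wf {(\<alpha>, \<beta>). weight \<omega> \<alpha> < weight \<omega> \<beta>}"
proof (rule wf_subset[OF Wellfounded.wf_measure])
  show "{(\<alpha>, \<beta>). weight \<omega> \<alpha> < weight \<omega> \<beta>} \<subseteq> Wellfounded.measure (\<lambda>\<beta>. card {\<alpha>. weight \<omega> \<alpha> < weight \<omega> \<beta>})"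
  proof clarify
    fix \<alpha> \<beta> assume "weight \<omega> \<alpha> < weight \<omega> \<beta>"
    then have "{\<gamma>. weight \<omega> \<gamma> < weight \<omega> \<alpha>} \<subset> {\<gamma>. weight \<omega> \<gamma> < weight \<omega> \<beta>}" by auto
    moreover have "finite {\<gamma>. weight \<omega> \<gamma> < weight \<omega> \<beta>}"
      by (rule finite_subset[OF _ finite_weight_le[OF assms, of "weight \<omega> \<beta>"]]) auto
    ultimately show "(\<alpha>, \<beta>) \<in> Wellfounded.measure (\<lambda>\<beta>. card {\<alpha>. weight \<omega> \<alpha> < weight \<omega> \<beta>})"
      by (simp add: psubset_card_mono)
  qed
qed

section \<open>Rings of power series with division\<close>

definition monomial :: "'k::field \<Rightarrow> nat ^ 'n::finite \<Rightarrow> ('k, 'n) pow_series" where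
  "monomial c \<gamma> = (\<lambda>\<alpha>. if \<alpha> = \<gamma> then c else 0)"

definition part :: "(nat ^ 'n::finite) set \<Rightarrow> ('k::field, 'n) pow_series \<Rightarrow> ('k, 'n) pow_series" where
  "part S f = (\<lambda>\<alpha>. if \<alpha> \<in> S then f \<alpha> else 0)"

abbreviation conv :: "('k::field, 'n::finite) pow_series \<Rightarrow> ('k, 'n) pow_series \<Rightarrow> ('k, 'n) pow_series"
    (infixl "\<star>" 70) where
  "f \<star> g \<equiv> f \<otimes>\<^bsub>formal_ring\<^esub> g"

lemma conv_eq: "(f \<star> g) \<alpha> = (\<Sum>\<beta> | \<beta> \<le> \<alpha>. f \<beta> * g (\<alpha> - \<beta>))"
  unfolding formal_ring_simps
  by (rule sum.reindex_bij_witness[of _ "\<lambda>\<beta>. (\<beta>, \<alpha> - \<beta>)" fst])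
     (auto simp: exp_diff_add le_add_exp add_diff_exp)

lemma conv_comm: "f \<star> g = g \<star> f"
  unfolding formal_ring_simps by (rule ext, rule formal_mult_comm)

lemma conv_nonzeroE:
  assumes "(f \<star> g) \<alpha> \<noteq> 0"
  obtains \<beta> \<gamma> where "\<alpha> = \<beta> + \<gamma>" "f \<beta> \<noteq> 0" "g \<gamma> \<noteq> 0"
  using Supp_mult[of f g] assms by (fastforce simp: Supp_def)

lemma conv_monomial: "(f \<star> monomial c \<gamma>) \<alpha> = (if \<gamma> \<le> \<alpha> then f (\<alpha> - \<gamma>) * c else 0)"
proof -
  have "(f \<star> monomial c \<gamma>) \<alpha> = (monomial c \<gamma> \<star> f) \<alpha>" by (simp add: conv_comm)
  also have "\<dots> = (\<Sum>\<beta> | \<beta> \<le> \<alpha>. if \<beta> = \<gamma> then c * f (\<alpha> - \<beta>) else 0)"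
    unfolding conv_eq by (intro sum.cong) (auto simp: monomial_def)
  also have "\<dots> = (if \<gamma> \<le> \<alpha> then c * f (\<alpha> - \<gamma>) else 0)"
    by (simp add: finite_divisors)
  finally show ?thesis by (simp add: mult.commute)
qed

lemma conv_diff: "(f \<star> (\<lambda>\<alpha>. g \<alpha> - h \<alpha>)) \<alpha> = (f \<star> g) \<alpha> - (f \<star> h) \<alpha>"
  by (simp add: conv_eq right_diff_distrib sum_subtractf)

text \<open>
  One step of the division algorithm by the series \<open>x\<^sup>b - t b\<close>, \<open>b \<in> B\<close>, applied to all terms of
  \<open>g\<close> at once: if \<open>s \<delta>\<close> is the chosen element of \<open>B\<close> that divides \<open>\<delta>\<close>, the power product with
  exponent \<open>\<delta>\<close> is traded for \<open>t (s \<delta>)\<close> times the power product with exponent \<open>\<delta> - s \<delta>\<close>.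
\<close>
definition rewrite_terms ::
    "(nat ^ 'n::finite) set \<Rightarrow> (nat ^ 'n \<Rightarrow> nat ^ 'n) \<Rightarrow> (nat ^ 'n \<Rightarrow> ('k::field, 'n) pow_series)
      \<Rightarrow> ('k, 'n) pow_series \<Rightarrow> ('k, 'n) pow_series" where
  "rewrite_terms B s t g \<alpha> =
     (\<Sum>\<delta> | \<delta> \<in> multiples B \<and> \<delta> - s \<delta> \<le> \<alpha>. g \<delta> * t (s \<delta>) (\<alpha> - (\<delta> - s \<delta>)))"

text \<open>
  What the two rings have in common. Formal power series satisfy all of this trivially; for
  convergent ones \<open>division_closed\<close> is the convergence statement of the Grauert-Hironaka division
  theorem: the solution \<open>g\<close> of \<open>g = h + rewrite_terms B s t g\<close> stays in the ring. The geometric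
  series is there to distinguish \<open>k[[x\<^sub>i]]\<close> from \<open>k[x\<^sub>i]\<close>.
\<close>
locale series_ring =
  fixes A :: "('k::field, 'n::finite) pow_series set"
  assumes subring: "subring A formal_ring"
    and monomial_closed: "monomial c \<gamma> \<in> A"
    and geometric_closed: "(\<lambda>\<alpha>. if \<forall>j. j \<noteq> i \<longrightarrow> \<alpha> $ j = 0 then 1 else 0) \<in> A"
    and part_closed: "f \<in> A \<Longrightarrow> part S f \<in> A"
    and shift_closed: "f \<in> A \<Longrightarrow> (\<lambda>\<alpha>. f (\<alpha> + \<gamma>)) \<in> A"
    and division_closed:
      "\<lbrakk>finite B; \<And>b. b \<in> B \<Longrightarrow> t b \<in> A; positive_weight \<omega>;
        \<And>b \<gamma>. b \<in> B \<Longrightarrow> t b \<gamma> \<noteq> 0 \<Longrightarrow> weight \<omega> b < weight \<omega> \<gamma>;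
        \<And>\<delta>. \<delta> \<in> multiples B \<Longrightarrow> s \<delta> \<in> B \<and> s \<delta> \<le> \<delta>;
        h \<in> A; \<And>\<alpha>. g \<alpha> = h \<alpha> + rewrite_terms B s t g \<alpha>\<rbrakk> \<Longrightarrow> g \<in> A"
begin

lemma closed:
  "(\<lambda>\<alpha>. 0) \<in> A"
  "f \<in> A \<Longrightarrow> g \<in> A \<Longrightarrow> (\<lambda>\<alpha>. f \<alpha> - g \<alpha>) \<in> A"
proof -
  show "(\<lambda>\<alpha>. 0) \<in> A" using subringE(2)[OF subring] by (simp add: formal_ring_simps)
  show "(\<lambda>\<alpha>. f \<alpha> - g \<alpha>) \<in> A" if "f \<in> A" "g \<in> A"
    using subringE(7)[OF subring that(1) subringE(5)[OF subring that(2)]]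
    by (simp add: formal_a_inv formal_ring_simps)
qed

end

lemma finite_rewrite_sources:
  assumes "finite B" "\<And>\<delta>. \<delta> \<in> multiples B \<Longrightarrow> s \<delta> \<in> B \<and> s \<delta> \<le> \<delta>"
  shows "finite {\<delta>. \<delta> \<in> multiples B \<and> \<delta> - s \<delta> \<le> (\<alpha> :: nat ^ 'n::finite)}"
proof (rule finite_subset)
  show "{\<delta>. \<delta> \<in> multiples B \<and> \<delta> - s \<delta> \<le> \<alpha>} \<subseteq> (\<Union>b\<in>B. {\<delta>. \<delta> \<le> \<alpha> + b})"
  proof clarify
    fix \<delta> assume \<delta>: "\<delta> \<in> multiples B" "\<delta> - s \<delta> \<le> \<alpha>"
    have "\<delta> \<le> \<alpha> + s \<delta>"
      using \<delta>(2) by (simp add: less_eq_vec_def le_diff_conv)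
    then show "\<delta> \<in> (\<Union>b\<in>B. {\<delta>. \<delta> \<le> \<alpha> + b})" using assms(2)[OF \<delta>(1)] by auto
  qed
qed (use assms(1) in \<open>simp add: finite_divisors\<close>)

text \<open>
  Rewriting strictly increases \<open>\<omega>\<close>, so the equation determines the coefficients of \<open>g\<close> by
  recursion on \<open>\<omega>\<close>.
\<close>
lemma rewrite_terms_solvable:
  fixes h :: "('k::field, 'n::finite) pow_series"
  assumes \<omega>: "positive_weight \<omega>"
    and s: "\<And>\<delta>. \<delta> \<in> multiples B \<Longrightarrow> s \<delta> \<in> B \<and> s \<delta> \<le> \<delta>"
    and t: "\<And>b \<gamma>. b \<in> B \<Longrightarrow> t b \<gamma> \<noteq> 0 \<Longrightarrow> weight \<omega> b < weight \<omega> \<gamma>"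
  obtains g where "\<And>\<alpha>. g \<alpha> = h \<alpha> + rewrite_terms B s t g \<alpha>"
proof -
  let ?R = "{(\<alpha>, \<beta>). weight \<omega> \<alpha> < weight \<omega> \<beta>}"
  let ?F = "\<lambda>g \<alpha>. h \<alpha> + rewrite_terms B s t g \<alpha>"
  define g where "g = wfrec ?R ?F"
  have "g \<alpha> = ?F g \<alpha>" for \<alpha>
  proof -
    have "g \<alpha> = ?F (cut g ?R \<alpha>) \<alpha>"
      unfolding g_def by (rule wfrec[OF wf_weight[OF \<omega>]])
    also have "rewrite_terms B s t (cut g ?R \<alpha>) \<alpha> = rewrite_terms B s t g \<alpha>"
      unfolding rewrite_terms_def
    proof (rule sum.cong[OF refl])
      fix \<delta> assume "\<delta> \<in> {\<delta>. \<delta> \<in> multiples B \<and> \<delta> - s \<delta> \<le> \<alpha>}"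
      then have \<delta>: "s \<delta> \<in> B" "s \<delta> \<le> \<delta>" "\<delta> - s \<delta> \<le> \<alpha>" using s by auto
      show "cut g ?R \<alpha> \<delta> * t (s \<delta>) (\<alpha> - (\<delta> - s \<delta>)) = g \<delta> * t (s \<delta>) (\<alpha> - (\<delta> - s \<delta>))"
      proof (cases "t (s \<delta>) (\<alpha> - (\<delta> - s \<delta>)) = 0")
        case False
        then have "weight \<omega> \<delta> < weight \<omega> \<alpha>" using t[OF \<delta>(1) False] \<delta> by (simp add: weight_diff)
        then show ?thesis by (simp add: cut_def)
      qed simp
    qed
    finally show ?thesis .
  qed
  then show ?thesis by (rule that)
qed

text \<open>
  Division is performed along one strictly positive weight \<open>\<omega>\<close>, but it respects every other weight
  \<open>u\<close> for which the \<open>b\<close> are maximal in the divisors. This is what makes one division serve a whole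
  cone of weights, including its boundary.
\<close>
lemma rewrite_terms_support:
  fixes u :: "real ^ 'n::finite"
  assumes \<omega>: "positive_weight \<omega>"
    and s: "\<And>\<delta>. \<delta> \<in> multiples B \<Longrightarrow> s \<delta> \<in> B \<and> s \<delta> \<le> \<delta>"
    and t: "\<And>b \<gamma>. b \<in> B \<Longrightarrow> t b \<gamma> \<noteq> 0 \<Longrightarrow> weight \<omega> b < weight \<omega> \<gamma>"
    and g: "\<And>\<alpha>. g \<alpha> = h \<alpha> + rewrite_terms B s t g \<alpha>"
    and u: "\<And>b \<gamma>. b \<in> B \<Longrightarrow> t b \<gamma> \<noteq> 0 \<Longrightarrow> weight u \<gamma> \<le> weight u b"
    and h: "\<And>\<alpha>. h \<alpha> \<noteq> 0 \<Longrightarrow> weight u \<alpha> \<le> c"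
  shows "g \<alpha> \<noteq> 0 \<Longrightarrow> weight u \<alpha> \<le> c"
  using wf_weight[OF \<omega>]
proof (induction \<alpha> rule: wf_induct_rule)
  case (less \<alpha>)
  show ?case
  proof (cases "h \<alpha> = 0")
    case True
    then have "rewrite_terms B s t g \<alpha> \<noteq> 0" using less.prems g[of \<alpha>] by simp
    then obtain \<delta> where \<delta>: "\<delta> \<in> multiples B" "\<delta> - s \<delta> \<le> \<alpha>"
        "g \<delta> \<noteq> 0" "t (s \<delta>) (\<alpha> - (\<delta> - s \<delta>)) \<noteq> 0"
      unfolding rewrite_terms_def by (auto elim!: sum.not_neutral_contains_not_neutral)
    have s\<delta>: "s \<delta> \<in> B" "s \<delta> \<le> \<delta>" using s \<delta>(1) by auto
    have "weight \<omega> \<delta> < weight \<omega> \<alpha>"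
      using t[OF s\<delta>(1) \<delta>(4)] \<delta>(2) s\<delta>(2) by (simp add: weight_diff)
    then have "weight u \<delta> \<le> c" using less.IH \<delta>(3) by simp
    moreover have "weight u \<alpha> - (weight u \<delta> - weight u (s \<delta>)) \<le> weight u (s \<delta>)"
      using u[OF s\<delta>(1) \<delta>(4)] \<delta>(2) s\<delta>(2) by (simp add: weight_diff)
    ultimately show ?thesis by simp
  qed (use h in blast)
qed

context series_ring
begin

text \<open>
  With \<open>g = h + rewrite_terms B s t g\<close>, the terms of \<open>g\<close> whose exponents are multiples of elements
  of \<open>B\<close> provide the quotients and the other terms the remainder.
\<close>
theorem division:
  assumes fin: "finite B" and \<omega>: "positive_weight \<omega>" and h: "h \<in> A"
    and f: "\<And>b. b \<in> B \<Longrightarrow> f b \<in> A \<and> f b b = 1"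
    and lead: "\<And>b \<gamma>. b \<in> B \<Longrightarrow> f b \<gamma> \<noteq> 0 \<Longrightarrow> \<gamma> \<noteq> b \<Longrightarrow> weight \<omega> b < weight \<omega> \<gamma>"
  obtains q r where "\<And>b. b \<in> B \<Longrightarrow> q b \<in> A" "r \<in> A" "\<And>\<alpha>. \<alpha> \<in> multiples B \<Longrightarrow> r \<alpha> = 0"
    "\<And>\<alpha>. h \<alpha> = (\<Sum>b\<in>B. (q b \<star> f b) \<alpha>) + r \<alpha>"
    "\<And>u c b \<beta>. (\<And>b \<gamma>. b \<in> B \<Longrightarrow> f b \<gamma> \<noteq> 0 \<Longrightarrow> weight u \<gamma> \<le> weight u b) \<Longrightarrow>
       (\<And>\<alpha>. h \<alpha> \<noteq> 0 \<Longrightarrow> weight u \<alpha> \<le> c) \<Longrightarrow>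
       b \<in> B \<Longrightarrow> q b \<beta> \<noteq> 0 \<Longrightarrow> weight u \<beta> + weight u b \<le> c"
proof -
  define t where "t b = (\<lambda>\<alpha>. monomial 1 b \<alpha> - f b \<alpha>)" for b
  have tA: "t b \<in> A" if "b \<in> B" for b
    unfolding t_def using that f monomial_closed by (intro closed(2)) auto
  have t: "f b \<gamma> \<noteq> 0 \<and> \<gamma> \<noteq> b" if "b \<in> B" "t b \<gamma> \<noteq> 0" for b \<gamma>
    using that f[of b] by (auto simp: t_def monomial_def split: if_splits)
  have t\<omega>: "weight \<omega> b < weight \<omega> \<gamma>" if "b \<in> B" "t b \<gamma> \<noteq> 0" for b \<gamma>
    using t[OF that] lead[OF that(1)] by blast
  have "\<exists>b. b \<in> B \<and> b \<le> \<delta>" if "\<delta> \<in> multiples B" for \<delta> using that by (auto simp: multiples_def)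
  then obtain s where s: "\<And>\<delta>. \<delta> \<in> multiples B \<Longrightarrow> s \<delta> \<in> B \<and> s \<delta> \<le> \<delta>" by metis
  obtain g where g: "\<And>\<alpha>. g \<alpha> = h \<alpha> + rewrite_terms B s t g \<alpha>"
    using rewrite_terms_solvable[OF \<omega> s t\<omega>] by metis
  have gA: "g \<in> A" by (rule division_closed[OF fin tA \<omega> t\<omega> s h g])
  define q where "q b = (\<lambda>\<beta>. part {\<delta>. s \<delta> = b} g (\<beta> + b))" for b
  define r where "r = part (- multiples B) g"
  have mult_B: "\<beta> + b \<in> multiples B" if "b \<in> B" for \<beta> b
    using that le_add_exp(2)[of b \<beta>] unfolding multiples_def by blast
  show ?thesis
  proof (rule that)
    show "q b \<in> A" if "b \<in> B" for b unfolding q_def by (intro shift_closed part_closed gA)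
    show "r \<in> A" unfolding r_def by (intro part_closed gA)
    show "r \<alpha> = 0" if "\<alpha> \<in> multiples B" for \<alpha> using that by (simp add: r_def part_def)
    show "h \<alpha> = (\<Sum>b\<in>B. (q b \<star> f b) \<alpha>) + r \<alpha>" for \<alpha>
    proof -
      have "rewrite_terms B s t g \<alpha>
          = (\<Sum>(b, \<beta>)\<in>(SIGMA b:B. {\<beta>. \<beta> \<le> \<alpha> \<and> s (\<beta> + b) = b}). g (\<beta> + b) * t b (\<alpha> - \<beta>))"
        unfolding rewrite_terms_def
        by (rule sum.reindex_bij_witness[of _ "\<lambda>(b, \<beta>). \<beta> + b" "\<lambda>\<delta>. (s \<delta>, \<delta> - s \<delta>)"])
           (use s mult_B in \<open>auto simp: exp_diff_add add_diff_exp\<close>)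
      also have "\<dots> = (\<Sum>b\<in>B. \<Sum>\<beta> | \<beta> \<le> \<alpha> \<and> s (\<beta> + b) = b. g (\<beta> + b) * t b (\<alpha> - \<beta>))"
        by (rule sum.Sigma[symmetric]) (auto simp: fin intro: finite_subset[OF _ finite_divisors])
      also have "\<dots> = (\<Sum>b\<in>B. (q b \<star> t b) \<alpha>)"
        unfolding conv_eq
        by (intro sum.cong refl sum.mono_neutral_cong_left)
           (auto simp: q_def part_def finite_divisors)
      also have "\<dots> = (\<Sum>b\<in>B. (q b \<star> monomial 1 b) \<alpha>) - (\<Sum>b\<in>B. (q b \<star> f b) \<alpha>)"
        unfolding t_def conv_diff by (rule sum_subtractf)
      also have "(\<Sum>b\<in>B. (q b \<star> monomial 1 b) \<alpha>) = (\<Sum>b\<in>B. if b \<le> \<alpha> \<and> s \<alpha> = b then g \<alpha> else 0)"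
        by (intro sum.cong refl) (auto simp: conv_monomial q_def part_def exp_diff_add)
      also have "\<dots> = (if \<alpha> \<in> multiples B then g \<alpha> else 0)"
      proof (cases "\<alpha> \<in> multiples B")
        case True
        have "(\<Sum>b\<in>B. if b \<le> \<alpha> \<and> s \<alpha> = b then g \<alpha> else 0) = (\<Sum>b\<in>B. if b = s \<alpha> then g \<alpha> else 0)"
          by (intro sum.cong) (use s[OF True] in auto)
        then show ?thesis using True s[OF True] fin by simp
      next
        case False
        then show ?thesis by (auto simp: multiples_def intro!: sum.neutral)
      qed
      finally have rw: "rewrite_terms B s t g \<alpha>
          = (if \<alpha> \<in> multiples B then g \<alpha> else 0) - (\<Sum>b\<in>B. (q b \<star> f b) \<alpha>)" .
      have "h \<alpha> = g \<alpha> - rewrite_terms B s t g \<alpha>" using g[of \<alpha>] by (simp only: add_diff_cancel_right')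
      then show ?thesis unfolding rw by (simp add: r_def part_def)
    qed
    show "weight u \<beta> + weight u b \<le> c"
      if u: "\<And>b \<gamma>. b \<in> B \<Longrightarrow> f b \<gamma> \<noteq> 0 \<Longrightarrow> weight u \<gamma> \<le> weight u b"
        and hu: "\<And>\<alpha>. h \<alpha> \<noteq> 0 \<Longrightarrow> weight u \<alpha> \<le> c"
        and b: "b \<in> B" and q: "q b \<beta> \<noteq> 0" for u c b \<beta>
    proof -
      have "g (\<beta> + b) \<noteq> 0" using q by (simp add: q_def part_def split: if_splits)
      moreover have "weight u \<gamma> \<le> weight u b" if "b \<in> B" "t b \<gamma> \<noteq> 0" for b \<gamma>
        using t[OF that] u[OF that(1)] by blast
      ultimately have "weight u (\<beta> + b) \<le> c"
        using rewrite_terms_support[where u = u, OF \<omega> s t\<omega> g _ hu] by blast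
      then show ?thesis by (simp add: weight_add)
    qed
  qed
qed

end

section \<open>Convergent power series\<close>

lemma series_ring_UNIV: "series_ring (UNIV :: ('k::field, 'n::finite) pow_series set)"
proof -
  interpret cring "formal_ring :: ('k, 'n) pow_series ring" by (rule formal_cring)
  show ?thesis
    using carrier_is_subring by unfold_locales (auto simp: formal_ring_simps(1) subring_def)
qed

text \<open>
  The terms of the norm of \<open>f\<close> on the polydisc with radii \<open>s powr \<omega>\<^sub>i\<close>; on these polydiscs all
  power products of the same weight have the same size.
\<close>
definition majorant :: "real ^ 'n::finite \<Rightarrow> real \<Rightarrow> (complex, 'n) pow_series \<Rightarrow> nat ^ 'n \<Rightarrow> real" where
  "majorant \<omega> s f \<alpha> = norm (f \<alpha>) * s powr weight \<omega> \<alpha>"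

lemma majorant_nonneg: "majorant \<omega> s f \<alpha> \<ge> 0"
  by (simp add: majorant_def)

lemma prod_powr_weight:
  assumes "s > 0"
  shows "(\<Prod>i\<in>UNIV. (s powr (\<omega> $ i)) ^ (\<alpha> $ i)) = s powr weight \<omega> \<alpha>"
  using assms by (simp add: weight_def powr_sum powr_power mult.commute)

lemma summable_on_le:
  fixes f g :: "'a \<Rightarrow> real"
  assumes "g summable_on S" "\<And>x. x \<in> S \<Longrightarrow> 0 \<le> f x" "\<And>x. x \<in> S \<Longrightarrow> f x \<le> g x"
  shows "f summable_on S"
proof -
  have "(\<lambda>x. norm (f x)) summable_on S"
  proof (rule Infinite_Sum.abs_summable_on_comparison_test)
    have "(\<lambda>x. norm (g x)) summable_on S \<longleftrightarrow> g summable_on S"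
      using assms(2,3) by (intro summable_on_cong) (force intro: order_trans)
    then show "(\<lambda>x. norm (g x)) summable_on S" using assms(1) by simp
    show "norm (f x) \<le> norm (g x)" if "x \<in> S" for x
      using assms(2,3)[OF that] by simp
  qed
  moreover have "(\<lambda>x. norm (f x)) summable_on S \<longleftrightarrow> f summable_on S"
    using assms(2) by (intro summable_on_cong) simp
  ultimately show ?thesis by simp
qed

lemma majorant_antimono:
  assumes "positive_weight \<omega>" "majorant \<omega> s f summable_on UNIV" "0 < s'" "s' \<le> s"
  shows "majorant \<omega> s' f summable_on UNIV"
  using assms(2)
  by (rule summable_on_le)
     (auto simp: majorant_def weight_nonneg[OF assms(1)] assms less_imp_le intro!: mult_left_mono powr_mono2)

lemma convergent_iff:
  fixes f :: "(complex, 'n::finite) pow_series"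
  assumes \<omega>: "positive_weight \<omega>"
  shows "convergent_series f \<longleftrightarrow> (\<exists>s>0. majorant \<omega> s f summable_on UNIV)"
proof
  assume "convergent_series f"
  then obtain r where r: "r > 0" and sum: "\<And>z :: complex ^ 'n. (\<forall>i. norm (z $ i) < r) \<Longrightarrow>
      (\<lambda>\<alpha>. f \<alpha> * (\<Prod>i\<in>UNIV. (z $ i) ^ (\<alpha> $ i))) summable_on UNIV"
    unfolding convergent_series_def by blast
  define s where "s = Min (range (\<lambda>i. (r / 2) powr (1 / \<omega> $ i)))"
  have s: "s > 0" unfolding s_def using r by (subst Min_gr_iff) auto
  define z :: "complex ^ 'n" where "z = (\<chi> i. of_real (s powr (\<omega> $ i)))"
  have "norm (z $ i) < r" for i
  proof -
    have pos: "\<omega> $ i > 0" using \<omega> by (simp add: positive_weight_def)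
    have "s \<le> (r / 2) powr (1 / \<omega> $ i)" unfolding s_def by (intro Min_le) auto
    then have "s powr (\<omega> $ i) \<le> ((r / 2) powr (1 / \<omega> $ i)) powr (\<omega> $ i)"
      using s pos by (intro powr_mono2) auto
    also have "\<dots> = r / 2" using pos r by (simp add: powr_powr)
    finally show ?thesis using r by (simp add: z_def)
  qed
  then have "(\<lambda>\<alpha>. f \<alpha> * (\<Prod>i\<in>UNIV. (z $ i) ^ (\<alpha> $ i))) summable_on UNIV" using sum by blast
  then have "(\<lambda>\<alpha>. norm (f \<alpha> * (\<Prod>i\<in>UNIV. (z $ i) ^ (\<alpha> $ i)))) summable_on UNIV"
    by (simp add: summable_on_iff_abs_summable_on_complex)
  moreover have "norm (f \<alpha> * (\<Prod>i\<in>UNIV. (z $ i) ^ (\<alpha> $ i))) = majorant \<omega> s f \<alpha>" for \<alpha>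
  proof -
    have "norm (\<Prod>i\<in>UNIV. (z $ i) ^ (\<alpha> $ i)) = (\<Prod>i\<in>UNIV. (s powr (\<omega> $ i)) ^ (\<alpha> $ i))"
      by (simp add: prod_norm[symmetric] norm_power z_def)
    then show ?thesis by (simp only: norm_mult majorant_def prod_powr_weight[OF s])
  qed
  ultimately have "majorant \<omega> s f summable_on UNIV" by simp
  then show "\<exists>s>0. majorant \<omega> s f summable_on UNIV" using s by blast
next
  assume "\<exists>s>0. majorant \<omega> s f summable_on UNIV"
  then obtain s where s: "s > 0" "majorant \<omega> s f summable_on UNIV" by blast
  define r where "r = Min (range (\<lambda>i. s powr (\<omega> $ i)))"
  have r: "r > 0" unfolding r_def using s by (subst Min_gr_iff) auto
  have "(\<lambda>\<alpha>. f \<alpha> * (\<Prod>i\<in>UNIV. (z $ i) ^ (\<alpha> $ i))) summable_on UNIV"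
    if z: "\<forall>i. norm (z $ i) < r" for z :: "complex ^ 'n"
  proof -
    have le: "norm (z $ i) \<le> s powr (\<omega> $ i)" for i
    proof -
      have "r \<le> s powr (\<omega> $ i)" unfolding r_def by (intro Min_le) auto
      then show ?thesis using z by (meson less_imp_le less_le_trans)
    qed
    have "norm (f \<alpha> * (\<Prod>i\<in>UNIV. (z $ i) ^ (\<alpha> $ i))) \<le> majorant \<omega> s f \<alpha>" for \<alpha>
    proof -
      have "norm (\<Prod>i\<in>UNIV. (z $ i) ^ (\<alpha> $ i)) \<le> (\<Prod>i\<in>UNIV. (s powr (\<omega> $ i)) ^ (\<alpha> $ i))"
        unfolding prod_norm[symmetric] norm_power using le by (intro prod_mono conjI power_mono) auto
      then show ?thesis
        unfolding norm_mult majorant_def prod_powr_weight[OF s(1)] by (intro mult_left_mono) auto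
    qed
    then have "(\<lambda>\<alpha>. norm (f \<alpha> * (\<Prod>i\<in>UNIV. (z $ i) ^ (\<alpha> $ i)))) summable_on UNIV"
      by (intro summable_on_le[OF s(2)]) auto
    then show ?thesis by (simp add: summable_on_iff_abs_summable_on_complex)
  qed
  then show "convergent_series f" unfolding convergent_series_def using r by blast
qed

lemma positive_weight_ones: "positive_weight (\<chi> i. 1)"
  by (simp add: positive_weight_def)

lemma convergent_monomial: "convergent_series (monomial c \<gamma>)"
proof -
  have "majorant (\<chi> i. 1) 1 (monomial c \<gamma>) summable_on UNIV"
    by (rule finite_nonzero_values_imp_summable_on)
       (rule finite_subset[of _ "{\<gamma>}"], auto simp: majorant_def monomial_def)
  then show ?thesis unfolding convergent_iff[OF positive_weight_ones] by (intro exI[of _ 1]) simp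
qed

lemma convergent_part:
  assumes "convergent_series f"
  shows "convergent_series (part S f)"
proof -
  obtain s where s: "s > 0" "majorant (\<chi> i. 1) s f summable_on UNIV"
    using assms unfolding convergent_iff[OF positive_weight_ones] by blast
  have "majorant (\<chi> i. 1) s (part S f) summable_on UNIV"
    using s(2) by (rule summable_on_le) (auto simp: majorant_def part_def)
  then show ?thesis unfolding convergent_iff[OF positive_weight_ones] using s(1) by blast
qed

lemma convergent_shift:
  fixes f :: "(complex, 'n::finite) pow_series"
  assumes "convergent_series f"
  shows "convergent_series (\<lambda>\<alpha>. f (\<alpha> + \<gamma>))"
proof -
  let ?\<omega> = "\<chi> i. 1 :: real ^ 'n"
  obtain s where s: "s > 0" "majorant ?\<omega> s f summable_on UNIV"
    using assms unfolding convergent_iff[OF positive_weight_ones] by blast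
  have "majorant ?\<omega> s f summable_on (range (\<lambda>\<alpha>. \<alpha> + \<gamma>))"
    using s(2) by (rule summable_on_subset_banach) simp
  then have "(\<lambda>\<alpha>. majorant ?\<omega> s f (\<alpha> + \<gamma>)) summable_on UNIV"
    by (subst (asm) summable_on_reindex) (auto simp: o_def inj_def)
  then have "(\<lambda>\<alpha>. majorant ?\<omega> s f (\<alpha> + \<gamma>) * s powr (- weight ?\<omega> \<gamma>)) summable_on UNIV"
    by (rule summable_on_cmult_left)
  moreover have "majorant ?\<omega> s f (\<alpha> + \<gamma>) * s powr (- weight ?\<omega> \<gamma>) = majorant ?\<omega> s (\<lambda>\<alpha>. f (\<alpha> + \<gamma>)) \<alpha>" for \<alpha>
    using s(1) by (simp add: majorant_def weight_add flip: powr_add)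
  ultimately show ?thesis unfolding convergent_iff[OF positive_weight_ones] using s(1) by auto
qed

lemma convergent_geometric:
  "convergent_series (\<lambda>\<alpha> :: nat ^ 'n::finite. if \<forall>j. j \<noteq> i \<longrightarrow> \<alpha> $ j = 0 then 1 else 0)" (is "convergent_series ?g")
proof -
  let ?h = "\<lambda>k :: nat. \<chi> j. if j = i then k else 0"
  let ?m = "majorant (\<chi> i. 1) (1/2) ?g"
  have "?m (?h k) = (1/2) ^ k" for k
    by (simp add: majorant_def weight_def if_distrib[of real] powr_realpow cong: if_cong)
  moreover have "(\<lambda>k::nat. (1/2 :: real) ^ k) summable_on UNIV"
    by (intro summable_nonneg_imp_summable_on summable_geometric) auto
  ultimately have "(?m \<circ> ?h) summable_on UNIV" by (simp add: o_def)
  moreover have "inj ?h" by (auto simp: inj_def vec_eq_iff)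
  ultimately have "?m summable_on (range ?h)" by (simp add: summable_on_reindex)
  moreover have "?m \<alpha> = 0" if "\<alpha> \<notin> range ?h" for \<alpha>
  proof -
    have "\<alpha> = ?h (\<alpha> $ i)" if "\<forall>j. j \<noteq> i \<longrightarrow> \<alpha> $ j = 0" using that by (simp add: vec_eq_iff)
    then have "\<not> (\<forall>j. j \<noteq> i \<longrightarrow> \<alpha> $ j = 0)" using \<open>\<alpha> \<notin> range ?h\<close> by blast
    then show ?thesis by (simp only: majorant_def if_False norm_zero mult_zero_left)
  qed
  ultimately have "?m summable_on UNIV"
    by (subst summable_on_cong_neutral[where T = "range ?h" and g = ?m]) auto
  then show ?thesis unfolding convergent_iff[OF positive_weight_ones] by (intro exI[of _ "1/2"]) simp
qed

text \<open>
  The \<open>\<omega>\<close>-weights of the exponents of \<open>t\<close> exceed that of \<open>b\<close> by at least some \<open>\<eta> > 0\<close>, because only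
  the finitely many minimal exponents matter. When the polydisc shrinks, the norm of \<open>t\<close> therefore
  decreases faster than the size of the power product with exponent \<open>b\<close>, by a factor proportional
  to \<open>s powr \<eta>\<close>.
\<close>
lemma small_tail:
  assumes \<omega>: "positive_weight \<omega>" and t: "convergent_series t"
    and gap: "\<And>\<gamma>. t \<gamma> \<noteq> 0 \<Longrightarrow> weight \<omega> b < weight \<omega> \<gamma>"
  obtains s0 where "s0 > 0"
    "\<And>s. 0 < s \<Longrightarrow> s \<le> s0 \<Longrightarrow> majorant \<omega> s t summable_on UNIV \<and>
       infsum (majorant \<omega> s t) UNIV \<le> s powr weight \<omega> b / 2"
proof -
  obtain r where r: "r > 0" "majorant \<omega> r t summable_on UNIV"
    using t convergent_iff[OF \<omega>] by blast
  define \<eta> where "\<eta> = Min (insert 1 ((\<lambda>\<gamma>. weight \<omega> \<gamma> - weight \<omega> b) ` minimal_exps (Supp t)))"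
  have fin: "finite (minimal_exps (Supp t))" by (rule finite_minimal_exps)
  have \<eta>: "\<eta> > 0"
    unfolding \<eta>_def using fin gap minimal_exps_subset[of "Supp t"]
    by (subst Min_gr_iff) (auto simp: Supp_def)
  have gap': "weight \<omega> b + \<eta> \<le> weight \<omega> \<gamma>" if "t \<gamma> \<noteq> 0" for \<gamma>
  proof -
    obtain \<beta> where \<beta>: "\<beta> \<in> minimal_exps (Supp t)" "\<beta> \<le> \<gamma>"
      using obtain_minimal_exp[of \<gamma> "Supp t"] \<open>t \<gamma> \<noteq> 0\<close> by (auto simp: Supp_def)
    have "\<eta> \<le> weight \<omega> \<beta> - weight \<omega> b" unfolding \<eta>_def using fin \<beta>(1) by (intro Min_le) auto
    moreover have "weight \<omega> \<beta> \<le> weight \<omega> \<gamma>"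
      using weight_mono[OF positive_weight_uminus[OF \<omega>] \<beta>(2)] by (simp add: weight_uminus)
    ultimately show ?thesis by simp
  qed
  define K where "K = infsum (majorant \<omega> r t) UNIV * r powr (- weight \<omega> b)"
  have K: "K \<ge> 0" unfolding K_def by (intro mult_nonneg_nonneg infsum_nonneg majorant_nonneg) auto
  define c where "c = 1 / (2 * K + 2)"
  have c: "c > 0" "c \<le> 1" "K * c \<le> 1 / 2" using K by (auto simp: c_def field_simps)
  define s0 where "s0 = r * c powr (1 / \<eta>)"
  show ?thesis
  proof (rule that[of s0])
    show "s0 > 0" using r c by (simp add: s0_def)
    fix s assume s: "0 < s" "s \<le> s0"
    have sr: "s / r \<le> c powr (1 / \<eta>)" using s r by (simp add: s0_def field_simps)
    moreover have "c powr (1 / \<eta>) \<le> 1" using c \<eta> by (simp add: powr_le1)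
    ultimately have "s / r \<le> 1" by linarith
    then have "s \<le> r" using r by (simp add: field_simps)
    then have sum: "majorant \<omega> s t summable_on UNIV" using majorant_antimono[OF \<omega> r(2)] s by blast
    have "majorant \<omega> s t \<gamma> \<le> (s / r) powr (weight \<omega> b + \<eta>) * majorant \<omega> r t \<gamma>" for \<gamma>
    proof (cases "t \<gamma> = 0")
      case False
      have "s powr weight \<omega> \<gamma> = (s / r) powr weight \<omega> \<gamma> * r powr weight \<omega> \<gamma>"
        using s r by (simp add: powr_divide)
      also have "\<dots> \<le> (s / r) powr (weight \<omega> b + \<eta>) * r powr weight \<omega> \<gamma>"
        using s r \<open>s \<le> r\<close> gap'[OF False] by (intro mult_right_mono powr_mono') auto
      finally show ?thesis by (simp add: majorant_def mult_left_mono mult.left_commute)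
    qed (simp add: majorant_def)
    then have "infsum (majorant \<omega> s t) UNIV \<le> infsum (\<lambda>\<gamma>. (s / r) powr (weight \<omega> b + \<eta>) * majorant \<omega> r t \<gamma>) UNIV"
      by (intro infsum_mono sum summable_on_cmult_right r(2))
    also have "\<dots> = (s / r) powr (weight \<omega> b + \<eta>) * infsum (majorant \<omega> r t) UNIV"
      by (rule infsum_cmult_right')
    also have "\<dots> = s powr weight \<omega> b * (K * (s / r) powr \<eta>)"
      using s r by (simp add: K_def powr_add powr_divide powr_minus field_simps)
    also have "(s / r) powr \<eta> \<le> (c powr (1 / \<eta>)) powr \<eta>"
      using s r \<eta> sr by (intro powr_mono2) auto
    also have "\<dots> = c" using \<eta> c by (simp add: powr_powr)
    also have "s powr weight \<omega> b * (K * c) \<le> s powr weight \<omega> b * (1 / 2)"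
      using c by (intro mult_left_mono) auto
    finally show "majorant \<omega> s t summable_on UNIV \<and> infsum (majorant \<omega> s t) UNIV \<le> s powr weight \<omega> b / 2"
      using sum K by (simp add: mult_left_mono)
  qed
qed

lemma common_small_radius:
  assumes "finite B" "\<And>b. b \<in> B \<Longrightarrow> \<exists>s0>0::real. \<forall>s. 0 < s \<longrightarrow> s \<le> s0 \<longrightarrow> P b s"
  shows "\<exists>s0>0. \<forall>b\<in>B. \<forall>s. 0 < s \<longrightarrow> s \<le> s0 \<longrightarrow> P b s"
  using assms
proof (induction B)
  case (insert b B)
  then obtain s1 s2 where "s1 > 0" "\<forall>s. 0 < s \<longrightarrow> s \<le> s1 \<longrightarrow> P b s"
    "s2 > 0" "\<forall>b\<in>B. \<forall>s. 0 < s \<longrightarrow> s \<le> s2 \<longrightarrow> P b s" by blast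
  then show ?case by (intro exI[of _ "min s1 s2"]) auto
qed (auto intro: exI[of _ 1])

text \<open>
  On a small polydisc rewriting halves the norm. Since \<open>g\<close> is already known as a formal series, a
  bound for its partial sums suffices, which the recursion gives directly.
\<close>
lemma convergent_division:
  fixes h :: "(complex, 'n::finite) pow_series"
  assumes fin: "finite B" and t: "\<And>b. b \<in> B \<Longrightarrow> convergent_series (t b)" and \<omega>: "positive_weight \<omega>"
    and gap: "\<And>b \<gamma>. b \<in> B \<Longrightarrow> t b \<gamma> \<noteq> 0 \<Longrightarrow> weight \<omega> b < weight \<omega> \<gamma>"
    and \<sigma>: "\<And>\<delta>. \<delta> \<in> multiples B \<Longrightarrow> \<sigma> \<delta> \<in> B \<and> \<sigma> \<delta> \<le> \<delta>"
    and h: "convergent_series h" and g: "\<And>\<alpha>. g \<alpha> = h \<alpha> + rewrite_terms B \<sigma> t g \<alpha>"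
  shows "convergent_series g"
proof -
  let ?small = "\<lambda>b s. majorant \<omega> s (t b) summable_on UNIV \<and>
          infsum (majorant \<omega> s (t b)) UNIV \<le> s powr weight \<omega> b / 2"
  have "\<exists>s0>0. \<forall>s. 0 < s \<longrightarrow> s \<le> s0 \<longrightarrow> ?small b s" if "b \<in> B" for b
    using small_tail[OF \<omega> t[OF that] gap[OF that]] by metis
  then have "\<exists>s0>0. \<forall>b\<in>B. \<forall>s. 0 < s \<longrightarrow> s \<le> s0 \<longrightarrow> ?small b s"
    by (intro common_small_radius fin)
  then obtain s0 where s0: "s0 > 0"
    "\<And>b s. b \<in> B \<Longrightarrow> 0 < s \<Longrightarrow> s \<le> s0 \<Longrightarrow> majorant \<omega> s (t b) summable_on UNIV \<and>
          infsum (majorant \<omega> s (t b)) UNIV \<le> s powr weight \<omega> b / 2" by blast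
  obtain s1 where s1: "s1 > 0" "majorant \<omega> s1 h summable_on UNIV" using h convergent_iff[OF \<omega>] by blast
  define s where "s = min s0 s1"
  have s: "s > 0" using s0 s1 by (simp add: s_def)
  have tB: "majorant \<omega> s (t b) summable_on UNIV" "infsum (majorant \<omega> s (t b)) UNIV \<le> s powr weight \<omega> b / 2"
    if "b \<in> B" for b using s0(2)[OF that, of s] s by (auto simp: s_def)
  have hs: "majorant \<omega> s h summable_on UNIV"
    using majorant_antimono[OF \<omega> s1(2) s] by (simp add: s_def)
  let ?H = "infsum (majorant \<omega> s h) UNIV"
  \<comment> \<open>The sets of bounded weight are closed under the recursion, so a partial sum over such a set
    satisfies \<open>X \<le> H + X / 2\<close>.\<close>
  have bound: "(\<Sum>\<alpha> | weight \<omega> \<alpha> \<le> c. majorant \<omega> s g \<alpha>) \<le> 2 * ?H" for c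
  proof -
    define C where "C = {\<alpha>. weight \<omega> \<alpha> \<le> c}"
    have C: "finite C" unfolding C_def by (rule finite_weight_le[OF \<omega>])
    define P where "P = C \<inter> multiples B"
    have P: "finite P" using C by (simp add: P_def)
    let ?T = "\<lambda>\<delta> \<alpha>. if \<delta> - \<sigma> \<delta> \<le> \<alpha> then majorant \<omega> s (t (\<sigma> \<delta>)) (\<alpha> - (\<delta> - \<sigma> \<delta>)) else 0"
    let ?G = "\<lambda>\<delta>. norm (g \<delta>) * s powr weight \<omega> (\<delta> - \<sigma> \<delta>)"
    have step: "majorant \<omega> s g \<alpha> \<le> majorant \<omega> s h \<alpha> + (\<Sum>\<delta>\<in>P. ?G \<delta> * ?T \<delta> \<alpha>)" if \<alpha>: "\<alpha> \<in> C" for \<alpha>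
    proof -
      let ?D = "{\<delta>. \<delta> \<in> multiples B \<and> \<delta> - \<sigma> \<delta> \<le> \<alpha>}"
      have D: "finite ?D" by (rule finite_rewrite_sources[OF fin \<sigma>])
      have "rewrite_terms B \<sigma> t g \<alpha> = (\<Sum>\<delta>\<in>P \<inter> ?D. g \<delta> * t (\<sigma> \<delta>) (\<alpha> - (\<delta> - \<sigma> \<delta>)))"
        unfolding rewrite_terms_def
      proof (rule sum.mono_neutral_right[OF D])
        show "\<forall>\<delta>\<in>?D - P \<inter> ?D. g \<delta> * t (\<sigma> \<delta>) (\<alpha> - (\<delta> - \<sigma> \<delta>)) = 0"
        proof
          fix \<delta> assume \<delta>: "\<delta> \<in> ?D - P \<inter> ?D"
          have \<sigma>\<delta>: "\<sigma> \<delta> \<in> B" "\<sigma> \<delta> \<le> \<delta>" using \<sigma> \<delta> by auto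
          have "\<not> weight \<omega> \<delta> < weight \<omega> \<alpha>" using \<delta> \<alpha> by (auto simp: P_def C_def)
          then have "t (\<sigma> \<delta>) (\<alpha> - (\<delta> - \<sigma> \<delta>)) = 0"
            using gap[OF \<sigma>\<delta>(1), of "\<alpha> - (\<delta> - \<sigma> \<delta>)"] \<delta> \<sigma>\<delta>(2) by (auto simp: weight_diff)
          then show "g \<delta> * t (\<sigma> \<delta>) (\<alpha> - (\<delta> - \<sigma> \<delta>)) = 0" by simp
        qed
      qed auto
      then have "norm (rewrite_terms B \<sigma> t g \<alpha>) * s powr weight \<omega> \<alpha>
          \<le> (\<Sum>\<delta>\<in>P \<inter> ?D. norm (g \<delta> * t (\<sigma> \<delta>) (\<alpha> - (\<delta> - \<sigma> \<delta>)))) * s powr weight \<omega> \<alpha>"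
        by (simp only:) (intro mult_right_mono norm_sum powr_ge_zero)
      also have "\<dots> = (\<Sum>\<delta>\<in>P \<inter> ?D. ?G \<delta> * ?T \<delta> \<alpha>)"
        unfolding sum_distrib_right
      proof (rule sum.cong[OF refl])
        fix \<delta> assume "\<delta> \<in> P \<inter> ?D"
        then show "norm (g \<delta> * t (\<sigma> \<delta>) (\<alpha> - (\<delta> - \<sigma> \<delta>))) * s powr weight \<omega> \<alpha> = ?G \<delta> * ?T \<delta> \<alpha>"
          using s by (simp add: majorant_def norm_mult weight_diff powr_diff)
      qed
      also have "\<dots> \<le> (\<Sum>\<delta>\<in>P. ?G \<delta> * ?T \<delta> \<alpha>)"
        using P by (intro sum_mono2) (auto simp: majorant_nonneg)
      finally have "norm (rewrite_terms B \<sigma> t g \<alpha>) * s powr weight \<omega> \<alpha> \<le> (\<Sum>\<delta>\<in>P. ?G \<delta> * ?T \<delta> \<alpha>)" .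
      moreover have "majorant \<omega> s g \<alpha> \<le> majorant \<omega> s h \<alpha> + norm (rewrite_terms B \<sigma> t g \<alpha>) * s powr weight \<omega> \<alpha>"
        unfolding majorant_def distrib_right[symmetric]
        by (subst g) (intro mult_right_mono norm_triangle_ineq powr_ge_zero)
      ultimately show ?thesis by linarith
    qed
    have T: "(\<Sum>\<alpha>\<in>C. ?T \<delta> \<alpha>) \<le> s powr weight \<omega> (\<sigma> \<delta>) / 2" if \<delta>: "\<delta> \<in> P" for \<delta>
    proof -
      let ?C = "{\<alpha> \<in> C. \<delta> - \<sigma> \<delta> \<le> \<alpha>}"
      have \<sigma>\<delta>: "\<sigma> \<delta> \<in> B" using \<sigma> \<delta> by (auto simp: P_def)
      have "(\<Sum>\<alpha>\<in>C. ?T \<delta> \<alpha>) = (\<Sum>\<alpha>\<in>?C. majorant \<omega> s (t (\<sigma> \<delta>)) (\<alpha> - (\<delta> - \<sigma> \<delta>)))"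
        using C by (simp add: sum.inter_filter)
      also have "\<dots> = sum (majorant \<omega> s (t (\<sigma> \<delta>))) ((\<lambda>\<alpha>. \<alpha> - (\<delta> - \<sigma> \<delta>)) ` ?C)"
      proof (subst sum.reindex)
        show "inj_on (\<lambda>\<alpha>. \<alpha> - (\<delta> - \<sigma> \<delta>)) ?C"
          by (rule inj_onI) (metis (mono_tags, lifting) exp_diff_add(1) mem_Collect_eq)
      qed (simp add: o_def)
      also have "\<dots> \<le> infsum (majorant \<omega> s (t (\<sigma> \<delta>))) UNIV"
        using tB(1)[OF \<sigma>\<delta>] C by (intro finite_sum_le_infsum) (auto simp: majorant_nonneg)
      finally show ?thesis using tB(2)[OF \<sigma>\<delta>] by linarith
    qed
    have "(\<Sum>\<alpha>\<in>C. majorant \<omega> s g \<alpha>)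
        \<le> (\<Sum>\<alpha>\<in>C. majorant \<omega> s h \<alpha>) + (\<Sum>\<alpha>\<in>C. \<Sum>\<delta>\<in>P. ?G \<delta> * ?T \<delta> \<alpha>)"
      unfolding sum.distrib[symmetric] by (intro sum_mono step)
    also have "(\<Sum>\<alpha>\<in>C. \<Sum>\<delta>\<in>P. ?G \<delta> * ?T \<delta> \<alpha>) = (\<Sum>\<delta>\<in>P. ?G \<delta> * (\<Sum>\<alpha>\<in>C. ?T \<delta> \<alpha>))"
      unfolding sum_distrib_left by (rule sum.swap)
    also have "\<dots> \<le> (\<Sum>\<delta>\<in>P. ?G \<delta> * (s powr weight \<omega> (\<sigma> \<delta>) / 2))"
      by (intro sum_mono mult_left_mono T) auto
    also have "\<dots> = (\<Sum>\<delta>\<in>P. majorant \<omega> s g \<delta> / 2)"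
    proof (rule sum.cong[OF refl])
      fix \<delta> assume "\<delta> \<in> P"
      then have "\<sigma> \<delta> \<le> \<delta>" using \<sigma> by (auto simp: P_def)
      then show "?G \<delta> * (s powr weight \<omega> (\<sigma> \<delta>) / 2) = majorant \<omega> s g \<delta> / 2"
        using s by (simp add: majorant_def weight_diff powr_diff)
    qed
    also have "\<dots> \<le> (\<Sum>\<delta>\<in>C. majorant \<omega> s g \<delta> / 2)"
      using C by (intro sum_mono2) (auto simp: P_def majorant_nonneg)
    also have "\<dots> = (\<Sum>\<delta>\<in>C. majorant \<omega> s g \<delta>) / 2" by (simp add: sum_divide_distrib)
    also have "(\<Sum>\<alpha>\<in>C. majorant \<omega> s h \<alpha>) \<le> ?H"
      using hs C by (intro finite_sum_le_infsum) (auto simp: majorant_nonneg)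
    finally show ?thesis unfolding C_def by simp
  qed
  have "majorant \<omega> s g summable_on UNIV"
  proof (rule nonneg_bdd_above_summable_on)
    show "bdd_above (sum (majorant \<omega> s g) ` {F. F \<subseteq> UNIV \<and> finite F})"
    proof (rule bdd_aboveI2)
      fix F :: "(nat ^ 'n) set" assume "F \<in> {F. F \<subseteq> UNIV \<and> finite F}"
      then have F: "finite F" by simp
      define c where "c = Max (insert 0 (weight \<omega> ` F))"
      have "F \<subseteq> {\<alpha>. weight \<omega> \<alpha> \<le> c}" using F by (auto simp: c_def)
      then have "sum (majorant \<omega> s g) F \<le> (\<Sum>\<alpha> | weight \<omega> \<alpha> \<le> c. majorant \<omega> s g \<alpha>)"
        using finite_weight_le[OF \<omega>] by (intro sum_mono2) (auto simp: majorant_nonneg)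
      then show "sum (majorant \<omega> s g) F \<le> 2 * ?H" using bound[of c] by linarith
    qed
  qed (rule majorant_nonneg)
  then show ?thesis using s convergent_iff[OF \<omega>] by blast
qed

lemma series_ring_convergent: "series_ring {f :: (complex, 'n::finite) pow_series. convergent_series f}"
proof (rule series_ring.intro)
  interpret cring "formal_ring :: (complex, 'n) pow_series ring" by (rule formal_cring)
  show "subring {f :: (complex, 'n) pow_series. convergent_series f} formal_ring"
    by (rule subringI)
       (auto simp: convergent_mult convergent_add convergent_uminus convergent_one formal_ring_simps(1))
next
  fix B and t :: "nat ^ 'n \<Rightarrow> (complex, 'n) pow_series" and \<omega> s and h g :: "(complex, 'n) pow_series"
  assume "finite B" "\<And>b. b \<in> B \<Longrightarrow> t b \<in> {f. convergent_series f}" "positive_weight \<omega>"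
    "\<And>b \<gamma>. b \<in> B \<Longrightarrow> t b \<gamma> \<noteq> 0 \<Longrightarrow> weight \<omega> b < weight \<omega> \<gamma>"
    "\<And>\<delta>. \<delta> \<in> multiples B \<Longrightarrow> s \<delta> \<in> B \<and> s \<delta> \<le> \<delta>" "h \<in> {f. convergent_series f}"
    "\<And>\<alpha>. g \<alpha> = h \<alpha> + rewrite_terms B s t g \<alpha>"
  then have "convergent_series g" by (intro convergent_division[of B t \<omega> s h g]) simp_all
  then show "g \<in> {f. convergent_series f}" by simp
qed (use convergent_monomial convergent_geometric convergent_part convergent_shift in simp_all)

section \<open>Initial ideals\<close>

locale series_ideal = series_ring A for A :: "('k::field, 'n::finite) pow_series set" +
  fixes I :: "('k, 'n) pow_series set"
  assumes ideal: "ideal I (formal_ring\<lparr>carrier := A\<rparr>)"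
begin

abbreviation C :: "('k, 'n) pow_series ring" where
  "C \<equiv> formal_ring\<lparr>carrier := A\<rparr>"

lemma ideal_closed:
  "f \<in> I \<Longrightarrow> f \<in> A"
  "(\<lambda>\<alpha>. 0) \<in> I"
  "f \<in> I \<Longrightarrow> g \<in> I \<Longrightarrow> (\<lambda>\<alpha>. f \<alpha> + g \<alpha>) \<in> I"
  "a \<in> A \<Longrightarrow> f \<in> I \<Longrightarrow> a \<star> f \<in> I"
  using ideal.Icarr[OF ideal] additive_subgroup.zero_closed[OF ideal.axioms(1)[OF ideal]]
    additive_subgroup.a_closed[OF ideal.axioms(1)[OF ideal]] ideal.I_l_closed[OF ideal]
  by (simp_all add: formal_ring_simps)

lemma ideal_diff:
  assumes "f \<in> I" "g \<in> I"
  shows "(\<lambda>\<alpha>. f \<alpha> - g \<alpha>) \<in> I"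
proof -
  have "g \<star> monomial (-1) 0 \<in> I"
    using ideal_closed(4)[OF monomial_closed assms(2)] by (simp only: conv_comm)
  moreover have "g \<star> monomial (-1) 0 = (\<lambda>\<alpha>. - g \<alpha>)"
    by (rule ext) (simp add: conv_monomial less_eq_vec_def vec_eq_iff)
  ultimately show ?thesis using ideal_closed(3)[OF assms(1), of "\<lambda>\<alpha>. - g \<alpha>"] by simp
qed

lemma ideal_sum:
  assumes "finite B" "\<And>b. b \<in> B \<Longrightarrow> a b \<in> A" "\<And>b. b \<in> B \<Longrightarrow> f b \<in> I"
  shows "(\<lambda>\<alpha>. \<Sum>b\<in>B. (a b \<star> f b) \<alpha>) \<in> I"
  using assms by (induction B) (simp_all add: ideal_closed)

lemma gr_simps:
  "carrier (gr C u) = {f \<in> A. finite (restrict_exp u ` Supp f)}"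
  "f \<otimes>\<^bsub>gr C u\<^esub> g = f \<star> g"
  "f \<oplus>\<^bsub>gr C u\<^esub> g = (\<lambda>\<alpha>. f \<alpha> + g \<alpha>)"
  "\<zero>\<^bsub>gr C u\<^esub> = (\<lambda>\<alpha>. 0)"
  by (simp_all add: gr_def formal_ring_simps)

lemma gr_cring: "cring (gr C u)"
proof -
  interpret cring "formal_ring :: ('k, 'n) pow_series ring" by (rule formal_cring)
  let ?B = "{f :: ('k, 'n) pow_series. finite (restrict_exp u ` Supp f)}"
  have "subcring A formal_ring"
    by (rule subcringI'[OF subring])
  then have "subcring (A \<inter> ?B) formal_ring"
    using gr_subcring by (rule subcring_inter)
  moreover have "gr C u = formal_ring\<lparr>carrier := A \<inter> ?B\<rparr>"
  proof -
    have "A \<inter> ?B = {f \<in> A. finite (restrict_exp u ` Supp f)}" by blast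
    then show ?thesis by (simp add: gr_def)
  qed
  ultimately show ?thesis
    using subcring_iff[of "A \<inter> ?B"] by (simp add: formal_ring_simps(1))
qed

lemma gr_a_inv:
  assumes "f \<in> carrier (gr C u)"
  shows "\<ominus>\<^bsub>gr C u\<^esub> f = (\<lambda>\<alpha>. - f \<alpha>)" "(\<lambda>\<alpha>. - f \<alpha>) \<in> carrier (gr C u)"
proof -
  interpret cring "gr C u" by (rule gr_cring)
  show *: "(\<lambda>\<alpha>. - f \<alpha>) \<in> carrier (gr C u)"
    using assms closed(2)[OF closed(1), of f] by (simp add: gr_simps Supp_def)
  show "\<ominus>\<^bsub>gr C u\<^esub> f = (\<lambda>\<alpha>. - f \<alpha>)"
    by (rule minus_equality) (use assms * in \<open>simp_all add: gr_simps\<close>)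
qed

lemma homogeneous_part_in_gr:
  assumes "u \<in> U_loc" "f \<in> A"
  shows "part {\<alpha>. weight u \<alpha> = k} f \<in> carrier (gr C u)"
proof -
  have "restrict_exp u ` Supp (part {\<alpha>. weight u \<alpha> = k} f) \<subseteq> restrict_exp u ` {\<alpha>. weight u \<alpha> \<ge> k}"
    by (auto simp: Supp_def part_def split: if_splits)
  then have "finite (restrict_exp u ` Supp (part {\<alpha>. weight u \<alpha> = k} f))"
    by (rule finite_subset) (rule finite_restrict_exp_weight[OF assms(1)])
  then show ?thesis using part_closed[OF assms(2)] by (simp add: gr_simps)
qed

lemma initial_form_as_part: "initial_form u f = part {\<alpha>. weight u \<alpha> = ord_wt u f} f"
  by (simp add: initial_form_def part_def)

lemma initial_form_in_gr: "u \<in> U_loc \<Longrightarrow> f \<in> A \<Longrightarrow> initial_form u f \<in> carrier (gr C u)"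
  unfolding initial_form_as_part by (rule homogeneous_part_in_gr)

lemma ord_wt_eqI:
  assumes "f \<alpha> \<noteq> 0" "\<And>\<beta>. f \<beta> \<noteq> 0 \<Longrightarrow> weight u \<beta> \<le> weight u \<alpha>"
  shows "ord_wt u f = weight u \<alpha>"
  unfolding ord_wt_def
proof (rule Greatest_equality)
  show "weight u \<alpha> \<in> weight u ` Supp f" using assms(1) by (intro imageI) (simp add: Supp_def)
  show "k \<le> weight u \<alpha>" if "k \<in> weight u ` Supp f" for k
    using that assms(2) by (auto simp: Supp_def)
qed

text \<open>
  So a homogeneous element of \<open>in\<^sub>u(I)\<close> is an initial form or zero, and not only a combination of
  initial forms. Saying that the part of weight \<open>k\<close> extends by terms of smaller weight to an element
  of \<open>I\<close>, instead of saying that it is an initial form, makes the condition additive in \<open>h\<close>; thus the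
  \<open>h\<close> that satisfy it for all \<open>k\<close> form an ideal.
\<close>
lemma initial_ideal_homogeneous:
  assumes u: "u \<in> U_loc" and h: "h \<in> initial_ideal C I u"
  shows "\<exists>f\<in>I. (\<forall>\<alpha>. f \<alpha> \<noteq> 0 \<longrightarrow> weight u \<alpha> \<le> k) \<and> (\<forall>\<alpha>. weight u \<alpha> = k \<longrightarrow> f \<alpha> = h \<alpha>)"
proof -
  interpret cring "gr C u" by (rule gr_cring)
  define lifts where "lifts = (\<lambda>k (h :: ('k, 'n) pow_series) (f :: ('k, 'n) pow_series). (\<forall>\<alpha>. f \<alpha> \<noteq> 0 \<longrightarrow> weight u \<alpha> \<le> k) \<and> (\<forall>\<alpha>. weight u \<alpha> = k \<longrightarrow> f \<alpha> = h \<alpha>))"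
  define Z where "Z = {h \<in> carrier (gr C u). \<forall>k. \<exists>f\<in>I. lifts k h f}"
  have mult: "a \<star> h \<in> Z" if h: "h \<in> Z" and a: "a \<in> carrier (gr C u)" for a h
  proof -
    have hA: "h \<in> carrier (gr C u)" using h by (simp add: Z_def)
    let ?W = "weight u ` Supp a"
    have "?W = weight u ` restrict_exp u ` Supp a" by (simp add: image_image weight_restrict_exp)
    then have W: "finite ?W" using a by (simp add: gr_simps)
    have "\<exists>f\<in>I. lifts k (a \<star> h) f" for k
    proof -
      have "\<forall>j. \<exists>f\<in>I. lifts (k - j) h f" using h by (simp add: Z_def)
      then obtain f where f: "\<And>j. f j \<in> I" "\<And>j. lifts (k - j) h (f j)" by metis
      let ?a = "\<lambda>j. part {\<beta>. weight u \<beta> = j} a"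
      let ?F = "\<lambda>\<alpha>. \<Sum>j\<in>?W. (?a j \<star> f j) \<alpha>"
      have aA: "?a j \<in> A" for j using a by (intro part_closed) (simp add: gr_simps)
      have FI: "?F \<in> I" using ideal_sum[OF W aA f(1)] .
      have F1: "weight u \<alpha> \<le> k" if "?F \<alpha> \<noteq> 0" for \<alpha>
      proof -
        have "\<exists>j\<in>?W. (?a j \<star> f j) \<alpha> \<noteq> 0"
          using that by (metis (mono_tags, lifting) sum.neutral)
        then obtain j where "(?a j \<star> f j) \<alpha> \<noteq> 0" by blast
        then obtain \<beta> \<gamma> where \<alpha>: "\<alpha> = \<beta> + \<gamma>" and *: "?a j \<beta> \<noteq> 0" "f j \<gamma> \<noteq> 0" by (rule conv_nonzeroE)
        have "weight u \<beta> = j" using *(1) by (simp add: part_def split: if_splits)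
        moreover have "weight u \<gamma> \<le> k - j" using f(2)[of j] *(2) by (simp add: lifts_def)
        ultimately show ?thesis by (simp add: \<alpha> weight_add)
      qed
      have F2: "?F \<alpha> = (a \<star> h) \<alpha>" if \<alpha>: "weight u \<alpha> = k" for \<alpha>
      proof -
        have "?F \<alpha> = (\<Sum>j\<in>?W. \<Sum>\<beta> | \<beta> \<le> \<alpha>. if j = weight u \<beta> then a \<beta> * h (\<alpha> - \<beta>) else 0)"
          unfolding conv_eq
        proof (intro sum.cong refl)
          fix j \<beta> assume "\<beta> \<in> {\<beta>. \<beta> \<le> \<alpha>}"
          then have "weight u (\<alpha> - \<beta>) = k - weight u \<beta>" using \<alpha> by (simp add: weight_diff)
          then show "?a j \<beta> * f j (\<alpha> - \<beta>) = (if j = weight u \<beta> then a \<beta> * h (\<alpha> - \<beta>) else 0)"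
            using f(2)[of j] by (cases "j = weight u \<beta>") (simp_all add: part_def lifts_def)
        qed
        also have "\<dots> = (\<Sum>\<beta> | \<beta> \<le> \<alpha>. \<Sum>j\<in>?W. if j = weight u \<beta> then a \<beta> * h (\<alpha> - \<beta>) else 0)"
          by (rule sum.swap)
        also have "\<dots> = (\<Sum>\<beta> | \<beta> \<le> \<alpha>. a \<beta> * h (\<alpha> - \<beta>))"
          by (intro sum.cong refl) (use W in \<open>auto simp: sum.delta Supp_def\<close>)
        finally show ?thesis by (simp add: conv_eq)
      qed
      have "lifts k (a \<star> h) ?F" unfolding lifts_def by (intro conjI allI impI F1 F2)
      then show ?thesis using FI by (rule bexI)
    qed
    then show ?thesis using m_closed[OF a hA] by (simp add: Z_def gr_simps(2))
  qed
  have "ideal Z (gr C u)"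
  proof (rule idealI[OF ring_axioms])
    show "subgroup Z (add_monoid (gr C u))"
    proof
      show "Z \<subseteq> carrier (add_monoid (gr C u))" by (auto simp: Z_def)
      show "x \<otimes>\<^bsub>add_monoid (gr C u)\<^esub> y \<in> Z" if xy: "x \<in> Z" "y \<in> Z" for x y
      proof -
        have "\<exists>f\<in>I. lifts k (\<lambda>\<alpha>. x \<alpha> + y \<alpha>) f" for k
        proof -
          obtain f g where f: "f \<in> I" "lifts k x f" and g: "g \<in> I" "lifts k y g"
            using xy unfolding Z_def by blast
          have "weight u \<alpha> \<le> k" if "f \<alpha> + g \<alpha> \<noteq> 0" for \<alpha>
          proof -
            have "f \<alpha> \<noteq> 0 \<or> g \<alpha> \<noteq> 0" using that by auto
            then show ?thesis using f(2) g(2) by (auto simp: lifts_def)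
          qed
          then have "lifts k (\<lambda>\<alpha>. x \<alpha> + y \<alpha>) (\<lambda>\<alpha>. f \<alpha> + g \<alpha>)"
            using f(2) g(2) by (simp add: lifts_def)
          then show ?thesis using ideal_closed(3)[OF f(1) g(1)] by (rule bexI)
        qed
        moreover have "x \<oplus>\<^bsub>gr C u\<^esub> y \<in> carrier (gr C u)" using xy by (intro a_closed) (auto simp: Z_def)
        ultimately show ?thesis by (simp add: Z_def gr_simps(3))
      qed
      have "lifts k (\<lambda>\<alpha>. 0) (\<lambda>\<alpha>. 0)" for k by (simp add: lifts_def)
      then show "\<one>\<^bsub>add_monoid (gr C u)\<^esub> \<in> Z"
        using zero_closed ideal_closed(2) by (auto simp: Z_def gr_simps(4) intro!: bexI[of _ "\<lambda>\<alpha>. 0"])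
      show "inv\<^bsub>add_monoid (gr C u)\<^esub> x \<in> Z" if x: "x \<in> Z" for x
      proof -
        have "x \<in> carrier (gr C u)" using x by (simp add: Z_def)
        then have "inv\<^bsub>add_monoid (gr C u)\<^esub> x = (\<lambda>\<alpha>. - x \<alpha>)"
          using gr_a_inv by (simp add: a_inv_def)
        moreover have "monomial (-1) 0 \<in> carrier (gr C u)"
          using monomial_closed by (auto simp: gr_simps Supp_def monomial_def)
        then have "monomial (-1) 0 \<star> x \<in> Z" using mult x by blast
        moreover have "monomial (-1) 0 \<star> x = (\<lambda>\<alpha>. - x \<alpha>)"
          by (rule ext, subst conv_comm) (simp add: conv_monomial less_eq_vec_def vec_eq_iff)
        ultimately show ?thesis by simp
      qed
    qed
  qed (use mult in \<open>simp_all add: gr_simps(2) conv_comm\<close>)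
  moreover have "initial_form u f \<in> Z" if f: "f \<in> I" for f
  proof -
    have "\<exists>g\<in>I. lifts k (initial_form u f) g" for k
    proof (cases "f \<noteq> (\<lambda>\<alpha>. 0) \<and> k = ord_wt u f")
      case True
      then have "lifts k (initial_form u f) f"
        using ord_attained(2)[OF u] by (auto simp: lifts_def initial_form_def Supp_def)
      then show ?thesis using f by blast
    next
      case False
      then have "lifts k (initial_form u f) (\<lambda>\<alpha>. 0)" by (auto simp: lifts_def initial_form_def)
      then show ?thesis using ideal_closed(2) by blast
    qed
    then show ?thesis using initial_form_in_gr[OF u ideal_closed(1)[OF f]] by (simp add: Z_def)
  qed
  ultimately have "initial_ideal C I u \<subseteq> Z"
    unfolding initial_ideal_def by (intro genideal_minimal) auto
  then have "\<exists>f\<in>I. lifts k h f" using h by (auto simp: Z_def)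
  then show ?thesis unfolding lifts_def .
qed

section \<open>Reduced standard bases\<close>

text \<open>
  A reduced standard basis with staircase \<open>E\<close>: each \<open>g e\<close> is a power product with minimal exponent
  in \<open>E\<close> plus terms outside \<open>E\<close>. No monomial order is fixed. That \<open>E\<close> is the set of leading
  exponents of \<open>I\<close> for some local order is expressed by the weight \<open>\<omega>\<close>, which makes division
  possible, together with the last clause, which makes the remainder of an element of \<open>I\<close> vanish.
\<close>
definition standard_basis :: "(nat ^ 'n) set \<Rightarrow> (nat ^ 'n \<Rightarrow> ('k, 'n) pow_series) \<Rightarrow> bool" where
  "standard_basis E g \<longleftrightarrow>
     (\<forall>\<alpha>\<in>E. \<forall>\<beta>. \<alpha> \<le> \<beta> \<longrightarrow> \<beta> \<in> E) \<and>
     (\<forall>e\<in>minimal_exps E. g e \<in> I \<and> g e e = 1 \<and> (\<forall>\<alpha>\<in>E. g e \<alpha> \<noteq> 0 \<longrightarrow> \<alpha> = e)) \<and>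
     (\<exists>\<omega>. positive_weight \<omega> \<and>
       (\<forall>e\<in>minimal_exps E. \<forall>\<alpha>. g e \<alpha> \<noteq> 0 \<longrightarrow> \<alpha> \<noteq> e \<longrightarrow> weight \<omega> e < weight \<omega> \<alpha>)) \<and>
     (\<forall>f\<in>I. (\<forall>\<alpha>\<in>E. f \<alpha> = 0) \<longrightarrow> f = (\<lambda>\<alpha>. 0))"

text \<open>
  The weights \<open>u\<close> for which the basis is still a standard basis; those in \<open>U_loc\<close> form a closed
  polyhedral cone.
\<close>
definition selects :: "real ^ 'n \<Rightarrow> (nat ^ 'n) set \<Rightarrow> (nat ^ 'n \<Rightarrow> ('k, 'n) pow_series) \<Rightarrow> bool" where
  "selects u E g \<longleftrightarrow> (\<forall>e\<in>minimal_exps E. \<forall>\<alpha>. g e \<alpha> \<noteq> 0 \<longrightarrow> weight u \<alpha> \<le> weight u e)"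

lemma standard_basisD:
  assumes "standard_basis E g"
  shows "multiples (minimal_exps E) = E"
    "e \<in> minimal_exps E \<Longrightarrow> g e \<in> I" "e \<in> minimal_exps E \<Longrightarrow> g e e = 1"
    "e \<in> minimal_exps E \<Longrightarrow> \<alpha> \<in> E \<Longrightarrow> g e \<alpha> \<noteq> 0 \<Longrightarrow> \<alpha> = e"
    "f \<in> I \<Longrightarrow> (\<And>\<alpha>. \<alpha> \<in> E \<Longrightarrow> f \<alpha> = 0) \<Longrightarrow> f = (\<lambda>\<alpha>. 0)"
proof -
  note E = assms[unfolded standard_basis_def, THEN conjunct1]
  note g = assms[unfolded standard_basis_def, THEN conjunct2, THEN conjunct1]
  note I = assms[unfolded standard_basis_def, THEN conjunct2, THEN conjunct2, THEN conjunct2]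
  show "multiples (minimal_exps E) = E" by (rule multiples_minimal_exps[OF E])
  show "e \<in> minimal_exps E \<Longrightarrow> g e \<in> I" "e \<in> minimal_exps E \<Longrightarrow> g e e = 1"
    "e \<in> minimal_exps E \<Longrightarrow> \<alpha> \<in> E \<Longrightarrow> g e \<alpha> \<noteq> 0 \<Longrightarrow> \<alpha> = e"
    using g by simp_all
  show "f \<in> I \<Longrightarrow> (\<And>\<alpha>. \<alpha> \<in> E \<Longrightarrow> f \<alpha> = 0) \<Longrightarrow> f = (\<lambda>\<alpha>. 0)"
    using I by simp
qed

lemma standard_basis_division:
  assumes sb: "standard_basis E g" and h: "h \<in> A"
  shows "\<exists>q r. (\<forall>e\<in>minimal_exps E. q e \<in> A) \<and> (\<forall>\<alpha>\<in>E. r \<alpha> = 0) \<and>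
    (\<forall>\<alpha>. h \<alpha> = (\<Sum>e\<in>minimal_exps E. (q e \<star> g e) \<alpha>) + r \<alpha>) \<and>
    (\<forall>u c. selects u E g \<longrightarrow> (\<forall>\<alpha>. h \<alpha> \<noteq> 0 \<longrightarrow> weight u \<alpha> \<le> c) \<longrightarrow>
       (\<forall>e\<in>minimal_exps E. \<forall>\<beta>. q e \<beta> \<noteq> 0 \<longrightarrow> weight u \<beta> + weight u e \<le> c))"
proof -
  obtain \<omega> where \<omega>: "positive_weight \<omega>"
    "\<And>e \<alpha>. e \<in> minimal_exps E \<Longrightarrow> g e \<alpha> \<noteq> 0 \<Longrightarrow> \<alpha> \<noteq> e \<Longrightarrow> weight \<omega> e < weight \<omega> \<alpha>"
    using sb[unfolded standard_basis_def, THEN conjunct2, THEN conjunct2, THEN conjunct1] by auto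
  have g: "g e \<in> A \<and> g e e = 1" if "e \<in> minimal_exps E" for e
    using standard_basisD(2,3)[OF sb that] ideal_closed(1) by blast
  show ?thesis
  proof (rule division[OF finite_minimal_exps \<omega>(1) h g \<omega>(2)])
    fix q r
    assume q: "\<And>e. e \<in> minimal_exps E \<Longrightarrow> q e \<in> A"
      and r: "\<And>\<alpha>. \<alpha> \<in> multiples (minimal_exps E) \<Longrightarrow> r \<alpha> = 0"
      and hqr: "\<And>\<alpha>. h \<alpha> = (\<Sum>e\<in>minimal_exps E. (q e \<star> g e) \<alpha>) + r \<alpha>"
      and small: "\<And>u c e \<beta>. (\<And>e \<gamma>. e \<in> minimal_exps E \<Longrightarrow> g e \<gamma> \<noteq> 0 \<Longrightarrow> weight u \<gamma> \<le> weight u e) \<Longrightarrow>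
       (\<And>\<alpha>. h \<alpha> \<noteq> 0 \<Longrightarrow> weight u \<alpha> \<le> c) \<Longrightarrow>
       e \<in> minimal_exps E \<Longrightarrow> q e \<beta> \<noteq> 0 \<Longrightarrow> weight u \<beta> + weight u e \<le> c"
    show ?thesis
    proof (intro exI conjI ballI allI impI)
      show "weight u \<beta> + weight u e \<le> c"
        if "selects u E g" "\<forall>\<alpha>. h \<alpha> \<noteq> 0 \<longrightarrow> weight u \<alpha> \<le> c" "e \<in> minimal_exps E" "q e \<beta> \<noteq> 0" for u c e \<beta>
        by (rule small) (use that in \<open>auto simp: selects_def\<close>)
      show "r \<alpha> = 0" if "\<alpha> \<in> E" for \<alpha>
        using r that by (simp add: standard_basisD(1)[OF sb])
    qed (use q hqr in blast)+
  qed
qed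

text \<open>
  If no monomial of the leading part were in \<open>E\<close>, dividing only the lower terms of \<open>f\<close> would leave
  the leading part untouched and produce an element of \<open>I\<close> without monomials in \<open>E\<close>.
\<close>
lemma leading_part_meets_staircase:
  assumes sb: "standard_basis E g" and u: "u \<in> U_loc" "selects u E g" and f: "f \<in> I"
    and le: "\<forall>\<alpha>. f \<alpha> \<noteq> 0 \<longrightarrow> weight u \<alpha> \<le> k" and \<alpha>: "f \<alpha> \<noteq> 0" "weight u \<alpha> = k"
  shows "\<exists>\<beta>\<in>E. f \<beta> \<noteq> 0 \<and> weight u \<beta> = k"
proof (rule ccontr)
  assume no: "\<not> (\<exists>\<beta>\<in>E. f \<beta> \<noteq> 0 \<and> weight u \<beta> = k)"
  let ?h = "part {\<alpha>. weight u \<alpha> < k} f"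
  have hA: "?h \<in> A" using part_closed ideal_closed(1)[OF f] by blast
  obtain c where c: "c < k" "\<And>\<beta>. ?h \<beta> \<noteq> 0 \<Longrightarrow> weight u \<beta> \<le> c"
  proof (cases "?h = (\<lambda>\<alpha>. 0)")
    case True
    show ?thesis
    proof (rule that[of "k - 1"])
      show "weight u \<beta> \<le> k - 1" if "?h \<beta> \<noteq> 0" for \<beta> using that True by metis
    qed simp
  next
    case False
    show ?thesis
    proof (rule that[of "ord_wt u ?h"])
      show "ord_wt u ?h < k"
        using ord_attained(1)[OF u(1) False] by (auto simp: Supp_def part_def split: if_splits)
      show "weight u \<beta> \<le> ord_wt u ?h" if "?h \<beta> \<noteq> 0" for \<beta>
        using ord_attained(2)[OF u(1) False] that by (simp add: Supp_def)
    qed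
  qed
  obtain q r where q: "\<forall>e\<in>minimal_exps E. q e \<in> A" and r: "\<forall>\<alpha>\<in>E. r \<alpha> = 0"
    and hqr: "\<forall>\<alpha>. ?h \<alpha> = (\<Sum>e\<in>minimal_exps E. (q e \<star> g e) \<alpha>) + r \<alpha>"
    and small: "\<forall>u c. selects u E g \<longrightarrow> (\<forall>\<alpha>. ?h \<alpha> \<noteq> 0 \<longrightarrow> weight u \<alpha> \<le> c) \<longrightarrow>
       (\<forall>e\<in>minimal_exps E. \<forall>\<beta>. q e \<beta> \<noteq> 0 \<longrightarrow> weight u \<beta> + weight u e \<le> c)"
    using standard_basis_division[OF sb hA] by (elim exE conjE)
  have small: "weight u \<beta> + weight u e \<le> c" if "e \<in> minimal_exps E" "q e \<beta> \<noteq> 0" for e \<beta>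
    using small u(2) c(2) that by simp
  let ?S = "\<lambda>\<alpha>. \<Sum>e\<in>minimal_exps E. (q e \<star> g e) \<alpha>"
  have "?S \<in> I" using q by (intro ideal_sum finite_minimal_exps standard_basisD(2)[OF sb]) auto
  then have FI: "(\<lambda>\<alpha>. f \<alpha> - ?S \<alpha>) \<in> I" by (rule ideal_diff[OF f])
  have "f \<beta> - ?S \<beta> = 0" if \<beta>: "\<beta> \<in> E" for \<beta>
  proof -
    have "?h \<beta> = f \<beta>" using no \<beta> le by (cases "f \<beta> = 0") (auto simp: part_def less_le)
    then show ?thesis using hqr[rule_format, of \<beta>] r \<beta> by simp
  qed
  then have "(\<lambda>\<alpha>. f \<alpha> - ?S \<alpha>) = (\<lambda>\<alpha>. 0)" by (rule standard_basisD(5)[OF sb FI])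
  from fun_cong[OF this, of \<alpha>] have "?S \<alpha> \<noteq> 0" using \<alpha>(1) by simp
  then obtain e where e: "e \<in> minimal_exps E" "(q e \<star> g e) \<alpha> \<noteq> 0"
    by (rule sum.not_neutral_contains_not_neutral)
  obtain \<beta> \<gamma> where \<beta>: "\<alpha> = \<beta> + \<gamma>" "q e \<beta> \<noteq> 0" "g e \<gamma> \<noteq> 0" using e(2) by (rule conv_nonzeroE)
  have "weight u \<gamma> \<le> weight u e" using u(2) e(1) \<beta>(3) by (simp add: selects_def)
  then show False using small[OF e(1) \<beta>(2)] c(1) \<alpha>(2) by (simp add: \<beta>(1) weight_add)
qed

lemma initial_form_standard_basis:
  assumes "standard_basis E g" "selects u E g" "e \<in> minimal_exps E"
  shows "initial_form u (g e) = part {\<alpha>. weight u \<alpha> = weight u e} (g e)"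
proof -
  have "ord_wt u (g e) = weight u e"
    by (rule ord_wt_eqI) (use assms in \<open>auto simp: selects_def standard_basisD(3)\<close>)
  then show ?thesis by (simp add: initial_form_as_part)
qed

text \<open>
  Divide \<open>f \<in> I\<close> by the basis. The remainder is zero, and the terms of largest weight in
  \<open>f = \<Sum> q\<^sub>e g\<^sub>e\<close> are the products of the terms of largest weight in the factors.
\<close>
lemma initial_ideal_standard_basis:
  assumes sb: "standard_basis E g" and u: "u \<in> U_loc" "selects u E g"
  shows "initial_ideal C I u = Idl\<^bsub>gr C u\<^esub> ((\<lambda>e. initial_form u (g e)) ` minimal_exps E)" (is "_ = ?J")
proof
  interpret cring "gr C u" by (rule gr_cring)
  let ?G = "(\<lambda>e. initial_form u (g e)) ` minimal_exps E"
  have G: "?G \<subseteq> carrier (gr C u)"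
    using initial_form_in_gr[OF u(1)] ideal_closed(1) standard_basisD(2)[OF sb] by blast
  have J: "ideal ?J (gr C u)" by (rule genideal_ideal[OF G])
  have I: "initial_form u ` I \<subseteq> carrier (gr C u)"
    using initial_form_in_gr[OF u(1)] ideal_closed(1) by blast
  show "?J \<subseteq> initial_ideal C I u"
    unfolding initial_ideal_def
    using genideal_self[OF I] standard_basisD(2)[OF sb]
    by (intro genideal_minimal genideal_ideal[OF I]) blast
  have "initial_form u f \<in> ?J" if f: "f \<in> I" for f
  proof (cases "f = (\<lambda>\<alpha>. 0)")
    case True
    then have "initial_form u f = \<zero>\<^bsub>gr C u\<^esub>" by (simp add: initial_form_def gr_simps)
    then show ?thesis using additive_subgroup.zero_closed[OF ideal.axioms(1)[OF J]] by simp
  next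
    case False
    let ?k = "ord_wt u f"
    obtain q r where q: "\<forall>e\<in>minimal_exps E. q e \<in> A" and r: "\<forall>\<alpha>\<in>E. r \<alpha> = 0"
      and fqr: "\<forall>\<alpha>. f \<alpha> = (\<Sum>e\<in>minimal_exps E. (q e \<star> g e) \<alpha>) + r \<alpha>"
      and small: "\<forall>u c. selects u E g \<longrightarrow> (\<forall>\<alpha>. f \<alpha> \<noteq> 0 \<longrightarrow> weight u \<alpha> \<le> c) \<longrightarrow>
         (\<forall>e\<in>minimal_exps E. \<forall>\<beta>. q e \<beta> \<noteq> 0 \<longrightarrow> weight u \<beta> + weight u e \<le> c)"
      using standard_basis_division[OF sb ideal_closed(1)[OF f]] by (elim exE conjE)
    have "\<forall>\<alpha>. f \<alpha> \<noteq> 0 \<longrightarrow> weight u \<alpha> \<le> ?k"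
      using ord_attained(2)[OF u(1) False] by (simp add: Supp_def)
    then have small: "weight u \<beta> + weight u e \<le> ?k" if "e \<in> minimal_exps E" "q e \<beta> \<noteq> 0" for e \<beta>
      using small u(2) that by simp
    let ?S = "\<lambda>\<alpha>. \<Sum>e\<in>minimal_exps E. (q e \<star> g e) \<alpha>"
    have rfS: "r = (\<lambda>\<alpha>. f \<alpha> - ?S \<alpha>)"
    proof
      show "r \<alpha> = f \<alpha> - ?S \<alpha>" for \<alpha> using fqr[rule_format, of \<alpha>] by simp
    qed
    have "?S \<in> I" using q by (intro ideal_sum finite_minimal_exps standard_basisD(2)[OF sb]) auto
    then have "r \<in> I" unfolding rfS by (rule ideal_diff[OF f])
    then have "r = (\<lambda>\<alpha>. 0)" using r by (intro standard_basisD(5)[OF sb]) auto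
    then have fS: "f \<alpha> = ?S \<alpha>" for \<alpha> using fqr[rule_format, of \<alpha>] by simp
    let ?p = "\<lambda>e. part {\<beta>. weight u \<beta> = ?k - weight u e} (q e)"
    have "initial_form u f = (\<lambda>\<alpha>. \<Sum>e\<in>minimal_exps E. (?p e \<star> initial_form u (g e)) \<alpha>)"
    proof
      fix \<alpha>
      \<comment> \<open>A product of terms of \<open>q e\<close> and \<open>g e\<close> reaches the weight of \<open>in f\<close> only if both factors
        have the largest weight possible.\<close>
      have eq: "(?p e \<star> initial_form u (g e)) \<alpha> = (if weight u \<alpha> = ?k then (q e \<star> g e) \<alpha> else 0)"
        if e: "e \<in> minimal_exps E" for e
      proof -
        have "?p e \<beta> * initial_form u (g e) (\<alpha> - \<beta>)
            = (if weight u \<alpha> = ?k then q e \<beta> * g e (\<alpha> - \<beta>) else 0)" if \<beta>: "\<beta> \<le> \<alpha>" for \<beta>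
        proof (cases "q e \<beta> = 0 \<or> g e (\<alpha> - \<beta>) = 0")
          case False
          then have "weight u \<beta> + weight u e \<le> ?k" "weight u (\<alpha> - \<beta>) \<le> weight u e"
            using small[OF e] u(2) e by (auto simp: selects_def)
          then have "weight u \<alpha> = ?k \<longleftrightarrow> weight u \<beta> = ?k - weight u e \<and> weight u (\<alpha> - \<beta>) = weight u e"
            using \<beta> by (auto simp: weight_diff)
          then show ?thesis
            unfolding initial_form_standard_basis[OF sb u(2) e] by (auto simp: part_def)
        qed (auto simp: part_def initial_form_def)
        then show ?thesis by (simp add: conv_eq)
      qed
      show "initial_form u f \<alpha> = (\<Sum>e\<in>minimal_exps E. (?p e \<star> initial_form u (g e)) \<alpha>)"
      proof -
        have "(\<Sum>e\<in>minimal_exps E. (?p e \<star> initial_form u (g e)) \<alpha>)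
            = (\<Sum>e\<in>minimal_exps E. if weight u \<alpha> = ?k then (q e \<star> g e) \<alpha> else 0)"
          by (intro sum.cong refl eq)
        then show ?thesis using fS[of \<alpha>] by (simp add: initial_form_def[of u f])
      qed
    qed
    also have "\<dots> \<in> ?J"
    proof -
      have "(\<lambda>\<alpha>. \<Sum>e\<in>B. (?p e \<star> initial_form u (g e)) \<alpha>) \<in> ?J" if "finite B" "B \<subseteq> minimal_exps E" for B
        using that
      proof (induction B)
        case empty
        then show ?case
          using additive_subgroup.zero_closed[OF ideal.axioms(1)[OF J]] by (simp add: gr_simps)
      next
        case (insert e B)
        have "?p e \<in> carrier (gr C u)"
          using insert.prems q by (intro homogeneous_part_in_gr u) auto
        moreover have "initial_form u (g e) \<in> ?J" using genideal_self[OF G] insert.prems by blast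
        ultimately have "?p e \<star> initial_form u (g e) \<in> ?J"
          using ideal.I_l_closed[OF J] by (simp only: gr_simps(2))
        then show ?case
          using additive_subgroup.a_closed[OF ideal.axioms(1)[OF J]] insert by (simp add: gr_simps(3))
      qed
      then show ?thesis using finite_minimal_exps by blast
    qed
    finally show ?thesis .
  qed
  then show "initial_ideal C I u \<subseteq> ?J"
    unfolding initial_ideal_def by (intro genideal_minimal J) blast
qed

text \<open>
  The initial form of \<open>g e\<close> for \<open>u'\<close> lies in the initial ideal for \<open>u\<close>, so each of its nonzero
  \<open>u\<close>-homogeneous parts has an exponent in \<open>E\<close>. The only candidate is \<open>e\<close>. Hence there is only one
  such part, and it contains the exponent \<open>e\<close>.
\<close>
lemma initial_ideal_determines_leading_parts:
  assumes sb: "standard_basis E g" and u: "u \<in> U_loc" "selects u E g" and u': "u' \<in> U_loc"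
    and eq: "initial_ideal C I u' = initial_ideal C I u"
  shows "selects u' E g"
    "e \<in> minimal_exps E \<Longrightarrow> g e \<alpha> \<noteq> 0 \<Longrightarrow> weight u' \<alpha> = weight u' e \<Longrightarrow> weight u \<alpha> = weight u e"
proof -
  interpret cring "gr C u'" by (rule gr_cring)
  have key: "weight u \<alpha> = weight u e \<and> weight u' e = ord_wt u' (g e)"
    if e: "e \<in> minimal_exps E" and \<alpha>: "g e \<alpha> \<noteq> 0" "weight u' \<alpha> = ord_wt u' (g e)" for e \<alpha>
  proof -
    let ?h = "initial_form u' (g e)"
    have "initial_form u' ` I \<subseteq> carrier (gr C u')"
      using initial_form_in_gr[OF u'] ideal_closed(1) by blast
    then have "initial_form u' ` I \<subseteq> initial_ideal C I u"
      unfolding eq[symmetric] unfolding initial_ideal_def by (rule genideal_self)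
    then have "?h \<in> initial_ideal C I u" using standard_basisD(2)[OF sb e] by blast
    from initial_ideal_homogeneous[OF u(1) this]
    obtain f where f: "f \<in> I" "\<forall>\<beta>. f \<beta> \<noteq> 0 \<longrightarrow> weight u \<beta> \<le> weight u \<alpha>"
      "\<forall>\<beta>. weight u \<beta> = weight u \<alpha> \<longrightarrow> f \<beta> = ?h \<beta>" by blast
    have "f \<alpha> \<noteq> 0" using f(3) \<alpha> by (simp add: initial_form_def)
    from leading_part_meets_staircase[OF sb u f(1,2) this refl]
    obtain \<beta> where \<beta>: "\<beta> \<in> E" "f \<beta> \<noteq> 0" "weight u \<beta> = weight u \<alpha>" by blast
    then have h\<beta>: "?h \<beta> \<noteq> 0" using f(3) by simp
    then have "g e \<beta> \<noteq> 0" "weight u' \<beta> = ord_wt u' (g e)" by (auto simp: initial_form_def split: if_splits)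
    then show ?thesis using standard_basisD(4)[OF sb e \<beta>(1)] \<beta>(3) by metis
  qed
  have ord: "weight u' e = ord_wt u' (g e)" and le: "\<And>\<alpha>. g e \<alpha> \<noteq> 0 \<Longrightarrow> weight u' \<alpha> \<le> ord_wt u' (g e)"
    if e: "e \<in> minimal_exps E" for e
  proof -
    have "g e \<noteq> (\<lambda>\<alpha>. 0)" using standard_basisD(3)[OF sb e] by (metis zero_neq_one)
    note att = ord_attained[OF u' this]
    show "\<And>\<alpha>. g e \<alpha> \<noteq> 0 \<Longrightarrow> weight u' \<alpha> \<le> ord_wt u' (g e)" using att(2) by (simp add: Supp_def)
    obtain \<alpha> where "g e \<alpha> \<noteq> 0" "weight u' \<alpha> = ord_wt u' (g e)" using att(1) by (auto simp: Supp_def)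
    then show "weight u' e = ord_wt u' (g e)" using key[OF e] by blast
  qed
  show "selects u' E g" unfolding selects_def
  proof (intro ballI allI impI)
    show "weight u' \<alpha> \<le> weight u' e" if "e \<in> minimal_exps E" "g e \<alpha> \<noteq> 0" for e \<alpha>
      using le[OF that] unfolding ord[OF that(1)] .
  qed
  show "weight u \<alpha> = weight u e"
    if e: "e \<in> minimal_exps E" and "g e \<alpha> \<noteq> 0" "weight u' \<alpha> = weight u' e"
    using that(3) unfolding ord[OF e] by (rule key[OF that(1,2), THEN conjunct1])
qed

end

section \<open>Existence of standard bases\<close>

text \<open>
  The logarithms of distinct primes: the weight of an exponent vector is then the logarithm of an
  integer that determines the vector by unique factorization.
\<close>
lemma ex_injective_weight: "\<exists>w :: real ^ 'n::finite. positive_weight w \<and> inj (weight w)"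
proof -
  obtain p :: "'n \<Rightarrow> nat" where p: "inj p" "range p \<subseteq> {q. prime q}"
  proof -
    obtain P :: "nat set" where P: "finite P" "card P = CARD('n)" "P \<subseteq> {q. prime q}"
      using infinite_arbitrarily_large[OF primes_infinite] by metis
    then obtain p :: "'n \<Rightarrow> nat" where "bij_betw p UNIV P"
      using finite_same_card_bij[of "UNIV :: 'n set" P] by auto
    then show ?thesis using that P(3) by (auto simp: bij_betw_def)
  qed
  have prime: "prime (p i)" for i using p(2) by auto
  define w :: "real ^ 'n" where "w = (\<chi> i. ln (real (p i)))"
  let ?N = "\<lambda>\<alpha> :: nat ^ 'n. \<Prod>i\<in>UNIV. p i ^ (\<alpha> $ i)"
  have w: "positive_weight w"
    using prime_gt_1_nat[OF prime] by (simp add: positive_weight_def w_def ln_gt_zero)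
  have exp_w: "exp (weight w \<alpha>) = real (?N \<alpha>)" for \<alpha>
  proof -
    have "exp (weight w \<alpha>) = (\<Prod>i\<in>UNIV. exp (real (\<alpha> $ i) * ln (real (p i))))"
      by (simp add: weight_def w_def exp_sum mult.commute)
    also have "\<dots> = (\<Prod>i\<in>UNIV. real (p i) ^ (\<alpha> $ i))"
      using prime_gt_0_nat[OF prime] by (simp add: exp_of_nat_mult)
    finally show ?thesis by simp
  qed
  have mult: "multiplicity (p i) (?N \<alpha>) = \<alpha> $ i" for i \<alpha>
  proof -
    have "multiplicity (p i) (\<Prod>j\<in>UNIV. p j ^ (\<alpha> $ j)) = (if p i \<in> range p then \<alpha> $ (inv_into UNIV p (p i)) else 0)"
    proof -
      have "(\<Prod>j\<in>UNIV. p j ^ (\<alpha> $ j)) = (\<Prod>q\<in>range p. q ^ (\<alpha> $ (inv_into UNIV p q)))"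
        using p(1) by (simp add: prod.reindex)
      then show ?thesis using multiplicity_prod_prime_powers[of "range p" "p i" "\<lambda>q. \<alpha> $ (inv_into UNIV p q)"] p(2) prime
        by auto
    qed
    then show ?thesis using p(1) by simp
  qed
  have "\<alpha> = \<beta>" if "weight w \<alpha> = weight w \<beta>" for \<alpha> \<beta>
  proof -
    have "?N \<alpha> = ?N \<beta>" using exp_w that by (metis of_nat_eq_iff)
    then show ?thesis using mult by (metis vec_eq_iff)
  qed
  then show ?thesis using w by (intro exI[of _ w]) (auto simp: inj_def)
qed

text \<open>
  The leading exponent for the local order given by the weight \<open>u\<close>, with ties broken by \<open>w\<close>. In
  a local order multiples are smaller; therefore a tie goes to the exponent of smaller weight for
  the positive weight \<open>w\<close>.
\<close>
definition leads :: "real ^ 'n::finite \<Rightarrow> real ^ 'n \<Rightarrow> ('k::field, 'n) pow_series \<Rightarrow> nat ^ 'n \<Rightarrow> bool" where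
  "leads u w f \<alpha> \<longleftrightarrow> f \<alpha> \<noteq> 0 \<and>
     (\<forall>\<beta>. f \<beta> \<noteq> 0 \<longrightarrow> weight u \<beta> < weight u \<alpha> \<or> weight u \<beta> = weight u \<alpha> \<and> weight w \<alpha> \<le> weight w \<beta>)"

lemma leads_exists:
  assumes u: "u \<in> U_loc" and w: "positive_weight w" and f: "f \<noteq> (\<lambda>\<alpha>. 0)"
  shows "\<exists>\<alpha>. leads u w f \<alpha>"
proof -
  note att = ord_attained[OF u f]
  obtain \<alpha>0 where "\<alpha>0 \<in> Supp f \<inter> {\<alpha>. weight u \<alpha> = ord_wt u f}" using att(1) by auto
  from wfE_min[OF wf_weight[OF w] this]
  obtain \<alpha> where \<alpha>: "\<alpha> \<in> Supp f \<inter> {\<alpha>. weight u \<alpha> = ord_wt u f}"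
    "\<And>\<beta>. (\<beta>, \<alpha>) \<in> {(\<alpha>, \<beta>). weight w \<alpha> < weight w \<beta>} \<Longrightarrow> \<beta> \<notin> Supp f \<inter> {\<alpha>. weight u \<alpha> = ord_wt u f}"
    by blast
  have "leads u w f \<alpha>"
    unfolding leads_def
  proof (intro conjI allI impI)
    show "f \<alpha> \<noteq> 0" using \<alpha>(1) by (simp add: Supp_def)
    fix \<beta> assume "f \<beta> \<noteq> 0"
    then have \<beta>: "\<beta> \<in> Supp f" by (simp add: Supp_def)
    show "weight u \<beta> < weight u \<alpha> \<or> weight u \<beta> = weight u \<alpha> \<and> weight w \<alpha> \<le> weight w \<beta>"
      using att(2)[OF \<beta>] \<alpha>(1) \<alpha>(2)[of \<beta>] \<beta> by (auto simp: not_less intro: leI)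
  qed
  then show ?thesis by blast
qed

text \<open>
  Only the finitely many minimal exponents of each \<open>f b\<close> have to be compared with \<open>b\<close>, and for them
  the lexicographic order by \<open>u\<close>, then \<open>w\<close>, is the order by the single weight \<open>- N u + w\<close>
  once \<open>N\<close> is large.
\<close>
lemma weight_realizing_leads:
  assumes u: "u \<in> U_loc" and w: "positive_weight w" "inj (weight w)"
    and B: "finite B" and f: "\<And>b. b \<in> B \<Longrightarrow> leads u w (f b) b"
  obtains \<omega> where "positive_weight \<omega>"
    "\<And>b \<alpha>. b \<in> B \<Longrightarrow> f b \<alpha> \<noteq> 0 \<Longrightarrow> \<alpha> \<noteq> b \<Longrightarrow> weight \<omega> b < weight \<omega> \<alpha>"
proof -
  let ?T = "SIGMA b:B. {\<beta> \<in> minimal_exps (Supp (f b)). weight u \<beta> < weight u b}"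
  have T: "finite ?T" by (intro finite_SigmaI B) (simp add: finite_minimal_exps)
  have "eventually (\<lambda>N::real. \<forall>(b, \<beta>)\<in>?T. weight w b < N * (weight u b - weight u \<beta>)) at_top"
  proof (rule eventually_ball_finite[OF T], clarify)
    fix b \<beta> assume "weight u \<beta> < weight u b"
    then have "filterlim (\<lambda>N::real. N * (weight u b - weight u \<beta>)) at_top at_top"
      by (intro filterlim_at_top_mult_tendsto_pos[OF tendsto_const _ filterlim_ident]) simp
    then show "eventually (\<lambda>N. weight w b < N * (weight u b - weight u \<beta>)) at_top"
      by (simp add: filterlim_at_top_dense)
  qed
  then have "eventually (\<lambda>N::real. 0 \<le> N \<and> (\<forall>(b, \<beta>)\<in>?T. weight w b < N * (weight u b - weight u \<beta>))) at_top"
    using eventually_ge_at_top[of 0] by (rule eventually_conj[rotated])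
  then obtain N :: real where N: "0 \<le> N" "\<forall>(b, \<beta>)\<in>?T. weight w b < N * (weight u b - weight u \<beta>)"
    unfolding eventually_at_top_linorder by blast
  define \<omega> where "\<omega> = w - N *\<^sub>R u"
  have \<omega>: "weight \<omega> \<alpha> = weight w \<alpha> - N * weight u \<alpha>" for \<alpha>
    by (simp add: \<omega>_def weight_def left_diff_distrib sum_subtractf sum_distrib_left mult.assoc)
  have pos: "positive_weight \<omega>"
    unfolding positive_weight_def
  proof
    fix i
    have "N * u $ i \<le> 0" using N(1) u by (simp add: U_loc_def mult_nonneg_nonpos)
    moreover have "w $ i > 0" using w(1) by (simp add: positive_weight_def)
    ultimately show "0 < \<omega> $ i" by (simp add: \<omega>_def)
  qed
  show ?thesis
  proof (rule that[OF pos])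
    fix b \<alpha> assume b: "b \<in> B" and \<alpha>: "f b \<alpha> \<noteq> 0" "\<alpha> \<noteq> b"
    have "\<alpha> \<in> Supp (f b)" using \<alpha> by (simp add: Supp_def)
    then obtain \<beta> where \<beta>: "\<beta> \<in> minimal_exps (Supp (f b))" "\<beta> \<le> \<alpha>" by (rule obtain_minimal_exp)
    show "weight \<omega> b < weight \<omega> \<alpha>"
    proof (cases "\<beta> = b")
      case True
      then show ?thesis using weight_strict_mono[OF pos] \<beta>(2) \<alpha>(2) by blast
    next
      case False
      have "f b \<beta> \<noteq> 0" using \<beta>(1) minimal_exps_subset[of "Supp (f b)"] by (auto simp: Supp_def)
      then consider "weight u \<beta> < weight u b" | "weight u \<beta> = weight u b" "weight w b \<le> weight w \<beta>"
        using f[OF b] unfolding leads_def by blast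
      then have "weight \<omega> b < weight \<omega> \<beta>"
      proof cases
        case 1
        then have "(b, \<beta>) \<in> ?T" using b \<beta>(1) by simp
        then have "weight w b < N * (weight u b - weight u \<beta>)" using N(2) by blast
        then show ?thesis using weight_nonneg[OF w(1), of \<beta>] by (simp add: \<omega> right_diff_distrib)
      next
        case 2
        moreover have "weight w b \<noteq> weight w \<beta>" using w(2) False by (auto simp: inj_eq)
        ultimately show ?thesis by (simp add: \<omega>)
      qed
      also have "\<dots> \<le> weight \<omega> \<alpha>"
        using weight_mono[OF positive_weight_uminus[OF pos] \<beta>(2)] by (simp add: weight_uminus)
      finally show ?thesis .
    qed
  qed
qed

context series_ideal
begin

text \<open>
  \<open>E\<close> consists of the leading exponents of elements of \<open>I\<close>. Dividing \<open>x\<^sup>e\<close> by elements of \<open>I\<close> with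
  the minimal leading exponents leaves a remainder outside \<open>E\<close>, and the difference is the reduced
  element of \<open>I\<close>. The division needs a single positive weight, hence \<open>weight_realizing_leads\<close>; the
  reduced elements have the same leading exponents but other tails, so it is used a second time.
\<close>
lemma standard_basis_exists:
  assumes u: "u \<in> U_loc"
  shows "\<exists>E g. standard_basis E g \<and> selects u E g"
proof -
  obtain w :: "real ^ 'n" where w: "positive_weight w" "inj (weight w)"
    using ex_injective_weight by blast
  define E where "E = {\<alpha>. \<exists>f\<in>I. leads u w f \<alpha>}"
  have up: "\<forall>\<alpha>\<in>E. \<forall>\<beta>. \<alpha> \<le> \<beta> \<longrightarrow> \<beta> \<in> E"
  proof (intro ballI allI impI)
    fix \<alpha> \<beta> assume "\<alpha> \<in> E" and le: "\<alpha> \<le> \<beta>"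
    then obtain f where f: "f \<in> I" "leads u w f \<alpha>" by (auto simp: E_def)
    let ?F = "f \<star> monomial 1 (\<beta> - \<alpha>)"
    have "?F \<in> I" using ideal_closed(4)[OF monomial_closed f(1)] by (simp only: conv_comm)
    moreover have "leads u w ?F \<beta>"
      unfolding leads_def
    proof (intro conjI allI impI)
      have "\<beta> - \<alpha> \<le> \<beta>" "\<beta> - (\<beta> - \<alpha>) = \<alpha>" using le by (auto simp: less_eq_vec_def vec_eq_iff)
      then show "?F \<beta> \<noteq> 0" using f(2) by (simp add: conv_monomial leads_def)
      fix \<gamma> assume "?F \<gamma> \<noteq> 0"
      then have \<gamma>: "\<beta> - \<alpha> \<le> \<gamma>" "f (\<gamma> - (\<beta> - \<alpha>)) \<noteq> 0" by (auto simp: conv_monomial split: if_splits)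
      have "weight v (\<gamma> - (\<beta> - \<alpha>)) = weight v \<gamma> - weight v \<beta> + weight v \<alpha>" for v
        using \<gamma>(1) le by (simp add: weight_diff)
      then show "weight u \<gamma> < weight u \<beta> \<or> weight u \<gamma> = weight u \<beta> \<and> weight w \<beta> \<le> weight w \<gamma>"
        using f(2) \<gamma>(2) unfolding leads_def by fastforce
    qed
    ultimately show "\<beta> \<in> E" by (auto simp: E_def)
  qed
  have E: "multiples (minimal_exps E) = E" by (rule multiples_minimal_exps[OF up])
  have meets: "f = (\<lambda>\<alpha>. 0)" if f: "f \<in> I" "\<forall>\<alpha>\<in>E. f \<alpha> = 0" for f
  proof (rule ccontr)
    assume "f \<noteq> (\<lambda>\<alpha>. 0)"
    then obtain \<alpha> where "leads u w f \<alpha>" using leads_exists[OF u w(1)] by blast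
    then show False using f by (auto simp: E_def leads_def)
  qed
  have "\<exists>f\<in>I. leads u w f e \<and> f e = 1" if e: "e \<in> minimal_exps E" for e
  proof -
    obtain f where f: "f \<in> I" "leads u w f e" using e minimal_exps_subset[of E] by (auto simp: E_def)
    let ?F = "f \<star> monomial (1 / f e) 0"
    have "?F \<in> I" using ideal_closed(4)[OF monomial_closed f(1)] by (simp only: conv_comm)
    moreover have F: "?F \<alpha> = f \<alpha> / f e" for \<alpha>
    proof -
      have "0 \<le> \<alpha>" "\<alpha> - 0 = \<alpha>" by (simp_all add: less_eq_vec_def vec_eq_iff)
      then show ?thesis by (simp add: conv_monomial)
    qed
    ultimately show ?thesis using f(2) by (intro bexI[of _ ?F]) (auto simp: leads_def F)
  qed
  then obtain f where f: "\<forall>e\<in>minimal_exps E. f e \<in> I \<and> leads u w (f e) e \<and> f e e = 1" by metis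
  obtain \<omega> where \<omega>: "positive_weight \<omega>"
    "\<And>e \<alpha>. e \<in> minimal_exps E \<Longrightarrow> f e \<alpha> \<noteq> 0 \<Longrightarrow> \<alpha> \<noteq> e \<Longrightarrow> weight \<omega> e < weight \<omega> \<alpha>"
  proof (rule weight_realizing_leads[OF u w finite_minimal_exps])
    show "leads u w (f e) e" if "e \<in> minimal_exps E" for e using f that by blast
  qed blast
  have fA: "f e \<in> A \<and> f e e = 1" if "e \<in> minimal_exps E" for e using f that ideal_closed(1) by blast
  have "\<exists>g. g \<in> I \<and> g e = 1 \<and> (\<forall>\<alpha>\<in>E. g \<alpha> \<noteq> 0 \<longrightarrow> \<alpha> = e)" if e: "e \<in> minimal_exps E" for e
  proof (rule division[OF finite_minimal_exps \<omega>(1) monomial_closed[of 1 e] fA \<omega>(2)])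
    fix q r
    assume q: "\<And>b. b \<in> minimal_exps E \<Longrightarrow> q b \<in> A"
      and r: "\<And>\<alpha>. \<alpha> \<in> multiples (minimal_exps E) \<Longrightarrow> r \<alpha> = 0"
      and eq: "\<And>\<alpha>. monomial 1 e \<alpha> = (\<Sum>b\<in>minimal_exps E. (q b \<star> f b) \<alpha>) + r \<alpha>"
    let ?g = "\<lambda>\<alpha>. \<Sum>b\<in>minimal_exps E. (q b \<star> f b) \<alpha>"
    have "?g \<in> I" using q f by (intro ideal_sum finite_minimal_exps) auto
    moreover have "?g \<alpha> = monomial 1 e \<alpha>" if "\<alpha> \<in> E" for \<alpha>
      using eq[of \<alpha>] r[of \<alpha>] that unfolding E by simp
    moreover have "e \<in> E" using e minimal_exps_subset by blast
    ultimately show ?thesis by (intro exI[of _ ?g]) (simp add: monomial_def)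
  qed
  then obtain g where g: "\<And>e. e \<in> minimal_exps E \<Longrightarrow> g e \<in> I \<and> g e e = 1 \<and> (\<forall>\<alpha>\<in>E. g e \<alpha> \<noteq> 0 \<longrightarrow> \<alpha> = e)"
    by metis
  have lead: "leads u w (g e) e" if e: "e \<in> minimal_exps E" for e
  proof -
    have "g e \<noteq> (\<lambda>\<alpha>. 0)" using g[OF e] by (metis zero_neq_one)
    then obtain \<alpha> where \<alpha>: "leads u w (g e) \<alpha>" using leads_exists[OF u w(1)] by blast
    then have "\<alpha> \<in> E" using g[OF e] by (auto simp: E_def)
    then show ?thesis using \<alpha> g[OF e] by (auto simp: leads_def)
  qed
  obtain \<omega>' where \<omega>': "positive_weight \<omega>'"
    "\<And>e \<alpha>. e \<in> minimal_exps E \<Longrightarrow> g e \<alpha> \<noteq> 0 \<Longrightarrow> \<alpha> \<noteq> e \<Longrightarrow> weight \<omega>' e < weight \<omega>' \<alpha>"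
    using weight_realizing_leads[OF u w finite_minimal_exps lead] by blast
  have "standard_basis E g"
    unfolding standard_basis_def
  proof (intro conjI exI[of _ \<omega>'] ballI allI impI)
    show "\<beta> \<in> E" if "\<alpha> \<in> E" "\<alpha> \<le> \<beta>" for \<alpha> \<beta> using up that by blast
    show "f = (\<lambda>\<alpha>. 0)" if "f \<in> I" "\<forall>\<alpha>\<in>E. f \<alpha> = 0" for f by (rule meets[OF that])
  qed (use g \<omega>' in simp_all)
  moreover have "selects u E g"
    unfolding selects_def
  proof (intro ballI allI impI)
    show "weight u \<alpha> \<le> weight u e" if "e \<in> minimal_exps E" "g e \<alpha> \<noteq> 0" for e \<alpha>
      using lead[OF that(1)] that(2) unfolding leads_def by fastforce
  qed
  ultimately show ?thesis by blast
qed

section \<open>Finiteness\<close>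

lemma standard_basis_unique:
  assumes sb: "standard_basis E g" "standard_basis E g'" and e: "e \<in> minimal_exps E"
  shows "g e = g' e"
proof -
  have "(\<lambda>\<alpha>. g e \<alpha> - g' e \<alpha>) = (\<lambda>\<alpha>. 0)"
  proof (rule standard_basisD(5)[OF sb(1)])
    show "(\<lambda>\<alpha>. g e \<alpha> - g' e \<alpha>) \<in> I"
      by (rule ideal_diff[OF standard_basisD(2)[OF sb(1) e] standard_basisD(2)[OF sb(2) e]])
    show "g e \<alpha> - g' e \<alpha> = 0" if "\<alpha> \<in> E" for \<alpha>
    proof (cases "\<alpha> = e")
      case True
      then show ?thesis using standard_basisD(3)[OF sb(1) e] standard_basisD(3)[OF sb(2) e] by simp
    next
      case False
      then have "g e \<alpha> = 0" "g' e \<alpha> = 0"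
        using standard_basisD(4)[OF sb(1) e that] standard_basisD(4)[OF sb(2) e that] by blast+
      then show ?thesis by simp
    qed
  qed
  from fun_cong[OF this] show ?thesis by (intro ext) simp
qed

text \<open>
  For the weight \<open>- \<omega>\<close> the terms of largest weight have minimal exponents, since \<open>\<omega>\<close> is strictly
  monotone.
\<close>
lemma minimal_exp_in_staircase:
  assumes sb: "standard_basis E g" and f: "f \<in> I" "f \<noteq> (\<lambda>\<alpha>. 0)"
  shows "\<exists>m\<in>minimal_exps (Supp f). m \<in> E"
proof -
  obtain \<omega> where \<omega>: "positive_weight \<omega>"
    "\<And>e \<alpha>. e \<in> minimal_exps E \<Longrightarrow> g e \<alpha> \<noteq> 0 \<Longrightarrow> \<alpha> \<noteq> e \<Longrightarrow> weight \<omega> e < weight \<omega> \<alpha>"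
    using sb[unfolded standard_basis_def, THEN conjunct2, THEN conjunct2, THEN conjunct1] by auto
  have u: "- \<omega> \<in> U_loc" by (rule positive_weight_uminus[OF \<omega>(1)])
  have "selects (- \<omega>) E g"
    unfolding selects_def weight_uminus
  proof (intro ballI allI impI)
    show "- weight \<omega> \<alpha> \<le> - weight \<omega> e" if "e \<in> minimal_exps E" "g e \<alpha> \<noteq> 0" for e \<alpha>
      using \<omega>(2)[OF that] by (cases "\<alpha> = e") auto
  qed
  moreover note att = ord_attained[OF u f(2)]
  obtain \<alpha> where "f \<alpha> \<noteq> 0" "weight (- \<omega>) \<alpha> = ord_wt (- \<omega>) f" using att(1) by (auto simp: Supp_def)
  moreover have "\<forall>\<alpha>. f \<alpha> \<noteq> 0 \<longrightarrow> weight (- \<omega>) \<alpha> \<le> ord_wt (- \<omega>) f" using att(2) by (simp add: Supp_def)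
  ultimately obtain m where m: "m \<in> E" "f m \<noteq> 0" "weight (- \<omega>) m = ord_wt (- \<omega>) f"
    using leading_part_meets_staircase[OF sb u _ f(1)] by blast
  have "\<beta> = m" if \<beta>: "\<beta> \<in> Supp f" "\<beta> \<le> m" for \<beta>
  proof (rule ccontr)
    assume "\<beta> \<noteq> m"
    then have "weight \<omega> \<beta> < weight \<omega> m" by (rule weight_strict_mono[OF \<omega>(1) \<beta>(2)])
    then show False using att(2)[OF \<beta>(1)] m(3) by (simp add: weight_uminus)
  qed
  then have "m \<in> minimal_exps (Supp f)" using m(2) by (simp add: minimal_exps_def Supp_def)
  then show ?thesis using m(1) by blast
qed

text \<open>
  Noetherian induction: among the staircases above a monomial ideal \<open>X\<close> there is at most \<open>X\<close> itself,
  or one of them yields an element of \<open>I\<close> without exponents in \<open>X\<close>; then all of them lie above one of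
  finitely many larger monomial ideals.
\<close>
lemma finitely_many_staircases: "finite {E. \<exists>g. standard_basis E g}"
proof -
  let ?F = "\<lambda>X. {E. X \<subseteq> E \<and> (\<exists>g. standard_basis E g)}"
  have "\<forall>S. X = multiples S \<longrightarrow> finite (?F X)" for X
    using wf_multiples
  proof (induction X rule: wf_induct_rule)
    case (less X)
    show ?case
    proof (intro allI impI)
      fix S assume X: "X = multiples S"
      show "finite (?F X)"
      proof (cases "?F X \<subseteq> {X}")
        case True
        then show ?thesis by (rule finite_subset) simp
      next
        case False
        then obtain E0 g0 where E0: "X \<subseteq> E0" "E0 \<noteq> X" and sb0: "standard_basis E0 g0" by blast
        obtain e where e: "e \<in> minimal_exps E0" "e \<notin> X"
        proof (rule ccontr)
          assume "\<not> thesis"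
          then have "minimal_exps E0 \<subseteq> X" using that by blast
          then have "multiples (minimal_exps E0) \<subseteq> X"
            unfolding X multiples_def by (blast intro: order_trans)
          then show False using E0 standard_basisD(1)[OF sb0] by blast
        qed
        \<comment> \<open>This element of \<open>I\<close> has no exponent in \<open>X\<close>, so each staircase above \<open>X\<close> also contains one
          of its finitely many minimal exponents.\<close>
        let ?f = "g0 e"
        have f: "?f \<in> I" "?f \<noteq> (\<lambda>\<alpha>. 0)"
          using standard_basisD(2,3)[OF sb0 e(1)] by (auto simp: fun_eq_iff intro: exI[of _ e])
        have fX: "?f \<alpha> = 0" if "\<alpha> \<in> X" for \<alpha>
          using standard_basisD(4)[OF sb0 e(1), of \<alpha>] that E0(1) e(2) by blast
        have "?F X \<subseteq> (\<Union>m\<in>minimal_exps (Supp ?f). ?F (multiples (insert m S)))"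
        proof
          fix E assume E: "E \<in> ?F X"
          then obtain g where g: "standard_basis E g" by blast
          obtain m where m: "m \<in> minimal_exps (Supp ?f)" "m \<in> E"
            using minimal_exp_in_staircase[OF g f] by blast
          have "multiples (insert m S) \<subseteq> E"
          proof
            fix \<alpha> assume "\<alpha> \<in> multiples (insert m S)"
            then consider "m \<le> \<alpha>" | "\<alpha> \<in> X" unfolding X multiples_def by blast
            then show "\<alpha> \<in> E"
            proof cases
              case 1
              then show ?thesis using m(2) g[unfolded standard_basis_def, THEN conjunct1] by blast
            qed (use E in blast)
          qed
          then show "E \<in> (\<Union>m\<in>minimal_exps (Supp ?f). ?F (multiples (insert m S)))"
            using m(1) g by blast
        qed
        moreover have "finite (?F (multiples (insert m S)))" if m: "m \<in> minimal_exps (Supp ?f)" for m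
        proof -
          have "m \<in> Supp ?f" using m minimal_exps_subset by blast
          then have "m \<notin> X" using fX by (auto simp: Supp_def)
          moreover have "m \<in> multiples (insert m S)" by (auto simp: multiples_def)
          moreover have "X \<subseteq> multiples (insert m S)" by (auto simp: X multiples_def)
          ultimately have "X \<subset> multiples (insert m S)" by blast
          then have "(multiples (insert m S), X) \<in> {(multiples T, multiples S) |S T. multiples S \<subset> multiples T}"
            unfolding X by blast
          from less.IH[OF this] show ?thesis by blast
        qed
        ultimately show ?thesis by (meson finite_UN_I finite_minimal_exps finite_subset)
      qed
    qed
  qed
  then have "finite (?F (multiples {}))" by blast
  then show ?thesis by (simp add: multiples_def)
qed

section \<open>The fan of an ideal\<close>

definition real_exp :: "nat ^ 'n \<Rightarrow> real ^ 'n" where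
  "real_exp \<alpha> = (\<chi> i. real (\<alpha> $ i))"

text \<open>
  For the minimal exponents of \<open>g e\<close> these are the conditions of \<open>selects\<close>. The unit vectors
  describe \<open>U_loc\<close>, and the set of those that are tight at \<open>u\<close> is the set of \<open>i\<close> with \<open>u\<^sub>i = 0\<close>,
  so cells also record which ring contains the initial ideal.
\<close>
definition inequalities :: "(nat ^ 'n) set \<Rightarrow> (nat ^ 'n \<Rightarrow> ('k, 'n) pow_series) \<Rightarrow> (real ^ 'n) set" where
  "inequalities E g = range (\<lambda>i. axis i 1) \<union>
     (\<Union>e\<in>minimal_exps E. (\<lambda>\<alpha>. real_exp \<alpha> - real_exp e) ` minimal_exps (Supp (g e)))"

lemma inner_real_exp: "u \<bullet> real_exp \<alpha> = weight u \<alpha>"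
  by (simp add: real_exp_def weight_def inner_vec_def)

lemma ball_inequalities:
  "(\<forall>d\<in>inequalities E g. P (u \<bullet> d)) \<longleftrightarrow> (\<forall>i. P (u $ i)) \<and>
     (\<forall>e\<in>minimal_exps E. \<forall>\<alpha>\<in>minimal_exps (Supp (g e)). P (weight u \<alpha> - weight u e))"
  by (auto simp: inequalities_def ball_Un inner_axis inner_diff_right inner_real_exp)

lemma ball_inequalities2:
  "(\<forall>d\<in>inequalities E g. P (u \<bullet> d) (v \<bullet> d)) \<longleftrightarrow> (\<forall>i. P (u $ i) (v $ i)) \<and>
     (\<forall>e\<in>minimal_exps E. \<forall>\<alpha>\<in>minimal_exps (Supp (g e)).
       P (weight u \<alpha> - weight u e) (weight v \<alpha> - weight v e))"
  by (auto simp: inequalities_def ball_Un inner_axis inner_diff_right inner_real_exp)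

lemma polar_cone_inequalities: "u \<in> polar_cone (inequalities E g) \<longleftrightarrow> u \<in> U_loc \<and> selects u E g"
proof -
  have "(\<forall>\<alpha>. g e \<alpha> \<noteq> 0 \<longrightarrow> weight u \<alpha> \<le> weight u e) \<longleftrightarrow>
      (\<forall>\<alpha>\<in>minimal_exps (Supp (g e)). weight u \<alpha> \<le> weight u e)" if u: "u \<in> U_loc" for e
  proof (intro iffI ballI allI impI)
    show "weight u \<alpha> \<le> weight u e" if "\<forall>\<alpha>. g e \<alpha> \<noteq> 0 \<longrightarrow> weight u \<alpha> \<le> weight u e"
      "\<alpha> \<in> minimal_exps (Supp (g e))" for \<alpha>
      using that minimal_exps_subset[of "Supp (g e)"] by (auto simp: Supp_def)
    fix \<alpha> assume *: "\<forall>\<alpha>\<in>minimal_exps (Supp (g e)). weight u \<alpha> \<le> weight u e" and "g e \<alpha> \<noteq> 0"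
    then have "\<alpha> \<in> Supp (g e)" by (simp add: Supp_def)
    then obtain \<beta> where "\<beta> \<in> minimal_exps (Supp (g e))" "\<beta> \<le> \<alpha>" by (rule obtain_minimal_exp)
    then show "weight u \<alpha> \<le> weight u e" using * weight_mono[OF u] order_trans by blast
  qed
  moreover have "u \<in> polar_cone (inequalities E g) \<longleftrightarrow> u \<in> U_loc \<and>
      (\<forall>e\<in>minimal_exps E. \<forall>\<alpha>\<in>minimal_exps (Supp (g e)). weight u \<alpha> \<le> weight u e)"
    using ball_inequalities[of E g "\<lambda>x. x \<le> 0" u] by (simp add: polar_cone_def U_loc_def)
  ultimately show ?thesis unfolding selects_def by auto
qed

lemma same_gr_iff:
  "gr C u' = gr C u \<longleftrightarrow> (\<forall>i. u' $ i = 0 \<longleftrightarrow> u $ i = 0)"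
proof
  assume eq: "gr C u' = gr C u"
  have "v $ i \<noteq> 0" if "gr C v = gr C v'" "v' $ i \<noteq> 0" for i and v v' :: "real ^ 'n"
  proof
    assume "v $ i = 0"
    let ?geo = "\<lambda>\<alpha> :: nat ^ 'n. if \<forall>j. j \<noteq> i \<longrightarrow> \<alpha> $ j = 0 then 1 else (0 :: 'k)"
    have "restrict_exp v ` Supp ?geo \<subseteq> {0}"
      using \<open>v $ i = 0\<close> by (auto simp: restrict_exp_def Supp_def vec_eq_iff)
    then have "?geo \<in> carrier (gr C v)"
      using geometric_closed[of i] by (simp add: gr_simps(1) finite_subset)
    then have "finite (restrict_exp v' ` Supp ?geo)" using that(1) by (simp add: gr_simps(1))
    moreover have "(\<chi> j. if j = i then k else 0) \<in> restrict_exp v' ` Supp ?geo" for k :: nat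
      using that(2)
      by (intro image_eqI[of _ _ "\<chi> j. if j = i then k else 0"])
         (auto simp: restrict_exp_def Supp_def vec_eq_iff)
    then have "range (\<lambda>k :: nat. \<chi> j. if j = i then k else 0) \<subseteq> restrict_exp v' ` Supp ?geo" by blast
    moreover have "inj (\<lambda>k :: nat. (\<chi> j. if j = i then k else 0) :: nat ^ 'n)"
      by (auto simp: inj_def vec_eq_iff)
    then have "infinite (range (\<lambda>k :: nat. (\<chi> j. if j = i then k else 0) :: nat ^ 'n))"
      using range_inj_infinite by blast
    ultimately show False using finite_subset by blast
  qed
  from this[OF eq] this[OF eq[symmetric]] show "\<forall>i. u' $ i = 0 \<longleftrightarrow> u $ i = 0" by blast
next
  assume "\<forall>i. u' $ i = 0 \<longleftrightarrow> u $ i = 0"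
  then have "restrict_exp u' = restrict_exp u" by (simp add: restrict_exp_def fun_eq_iff)
  then show "gr C u' = gr C u" by (simp add: gr_def)
qed

text \<open>
  For weights in \<open>U_loc\<close>, equality with a divisor of the exponent depends only on which coordinates
  vanish. Thus ties at minimal exponents, together with this pattern, determine whole initial forms.
\<close>
lemma weight_eq_by_zero_pattern:
  assumes u: "u \<in> U_loc" and zero: "\<And>i. u $ i = 0 \<Longrightarrow> u' $ i = 0"
    and "\<beta> \<le> \<alpha>" "weight u \<alpha> = weight u \<beta>"
  shows "weight u' \<alpha> = weight u' \<beta>"
proof -
  have "weight u (\<alpha> - \<beta>) = 0" using assms(3,4) by (simp add: weight_diff)
  then have "(\<Sum>i\<in>UNIV. - (u $ i * real ((\<alpha> - \<beta>) $ i))) = 0" by (simp add: weight_def sum_negf)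
  moreover have "- (u $ i * real ((\<alpha> - \<beta>) $ i)) \<ge> 0" for i
    using u by (simp add: U_loc_def mult_nonpos_nonneg)
  ultimately have "\<forall>i. - (u $ i * real ((\<alpha> - \<beta>) $ i)) = 0"
    by (subst (asm) sum_nonneg_eq_0_iff) auto
  then have "u' $ i * real ((\<alpha> - \<beta>) $ i) = 0" for i using zero[of i] by (cases "u $ i = 0") auto
  then have "weight u' (\<alpha> - \<beta>) = 0" unfolding weight_def by (intro sum.neutral) simp
  then show ?thesis using assms(3) by (simp add: weight_diff)
qed

text \<open>
  Equal initial ideals give the same ties by \<open>initial_ideal_determines_leading_parts\<close>, used in both
  directions. Conversely the ties determine the initial forms of the basis, and these generate the
  initial ideals.
\<close>
lemma groebner_cone_eq_cell:
  assumes sb: "standard_basis E g" and u: "u \<in> polar_cone (inequalities E g)"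
  shows "groebner_cone C I u = cell (inequalities E g) u"
proof (intro Set.set_eqI iffI)
  have uU: "u \<in> U_loc" and sel: "selects u E g" using u by (simp_all add: polar_cone_inequalities)
  fix u'
  let ?pattern = "\<lambda>v v'. \<forall>d\<in>inequalities E g. v' \<bullet> d = 0 \<longleftrightarrow> v \<bullet> d = 0"
  {
    assume "u' \<in> groebner_cone C I u"
    then have u'U: "u' \<in> U_loc" and gr: "gr C u' = gr C u"
      and eq: "initial_ideal C I u' = initial_ideal C I u"
      by (auto simp: groebner_cone_def same_gr_def)
    note sel' = initial_ideal_determines_leading_parts(1)[OF sb uU sel u'U eq]
    have "weight u' \<alpha> = weight u' e \<longleftrightarrow> weight u \<alpha> = weight u e"
      if "e \<in> minimal_exps E" "\<alpha> \<in> minimal_exps (Supp (g e))" for e \<alpha>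
    proof -
      have \<alpha>: "g e \<alpha> \<noteq> 0" using that(2) minimal_exps_subset[of "Supp (g e)"] by (auto simp: Supp_def)
      show ?thesis
        using initial_ideal_determines_leading_parts(2)[OF sb uU sel u'U eq that(1) \<alpha>]
          initial_ideal_determines_leading_parts(2)[OF sb u'U sel' uU eq[symmetric] that(1) \<alpha>] by blast
    qed
    then have "?pattern u u'"
      using gr ball_inequalities2[of E g "\<lambda>x y. x = 0 \<longleftrightarrow> y = 0" u' u] by (simp add: same_gr_iff)
    then show "u' \<in> cell (inequalities E g) u"
      using u'U sel' by (simp add: cell_def polar_cone_inequalities)
  next
    assume "u' \<in> cell (inequalities E g) u"
    then have u'U: "u' \<in> U_loc" and sel': "selects u' E g" and "?pattern u u'"
      by (simp_all add: cell_def polar_cone_inequalities)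
    then have zero: "\<And>i. u' $ i = 0 \<longleftrightarrow> u $ i = 0"
      and tie: "\<And>e \<alpha>. e \<in> minimal_exps E \<Longrightarrow> \<alpha> \<in> minimal_exps (Supp (g e)) \<Longrightarrow>
        weight u' \<alpha> = weight u' e \<longleftrightarrow> weight u \<alpha> = weight u e"
      using ball_inequalities2[of E g "\<lambda>x y. x = 0 \<longleftrightarrow> y = 0" u' u] by auto
    have step: "weight v' \<alpha> = weight v' e"
      if e: "e \<in> minimal_exps E" and \<alpha>: "g e \<alpha> \<noteq> 0" "weight v \<alpha> = weight v e"
        and v: "v \<in> U_loc" "selects v E g" "\<And>i. v $ i = 0 \<Longrightarrow> v' $ i = 0"
        and tie: "\<And>\<alpha>. \<alpha> \<in> minimal_exps (Supp (g e)) \<Longrightarrow> weight v \<alpha> = weight v e \<Longrightarrow> weight v' \<alpha> = weight v' e"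
      for e \<alpha> and v v' :: "real ^ 'n"
    proof -
      have "\<alpha> \<in> Supp (g e)" using \<alpha>(1) by (simp add: Supp_def)
      then obtain \<beta> where \<beta>: "\<beta> \<in> minimal_exps (Supp (g e))" "\<beta> \<le> \<alpha>" by (rule obtain_minimal_exp)
      have "g e \<beta> \<noteq> 0" using \<beta>(1) minimal_exps_subset[of "Supp (g e)"] by (auto simp: Supp_def)
      then have "weight v \<beta> \<le> weight v e" using v(2) e by (simp add: selects_def)
      then have eq: "weight v \<beta> = weight v e" using weight_mono[OF v(1) \<beta>(2)] \<alpha>(2) by simp
      then have "weight v' \<alpha> = weight v' \<beta>"
        using \<alpha>(2) by (intro weight_eq_by_zero_pattern[OF v(1,3) \<beta>(2)]) simp_all
      then show ?thesis using tie[OF \<beta>(1) eq] by simp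
    qed
    have "initial_form u' (g e) = initial_form u (g e)" if e: "e \<in> minimal_exps E" for e
    proof -
      have "weight u' \<alpha> = weight u' e \<longleftrightarrow> weight u \<alpha> = weight u e" if "g e \<alpha> \<noteq> 0" for \<alpha>
        using step[OF e that _ uU sel] step[OF e that _ u'U sel'] zero tie[OF e] by blast
      then show ?thesis
        unfolding initial_form_standard_basis[OF sb sel e] initial_form_standard_basis[OF sb sel' e]
        by (auto simp: part_def fun_eq_iff)
    qed
    then have "(\<lambda>e. initial_form u' (g e)) ` minimal_exps E = (\<lambda>e. initial_form u (g e)) ` minimal_exps E"
      by (intro image_cong) auto
    moreover have gr: "gr C u' = gr C u" using zero by (simp add: same_gr_iff)
    ultimately have "initial_ideal C I u = initial_ideal C I u'"
      unfolding initial_ideal_standard_basis[OF sb uU sel] initial_ideal_standard_basis[OF sb u'U sel']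
      by simp
    then show "u' \<in> groebner_cone C I u"
      using u'U gr by (simp add: groebner_cone_def same_gr_def)
  }
qed

theorem closed_groebner_fan_rational: "rational_polyhedral_fan (closed_groebner_fan C I)"
  unfolding closed_groebner_fan_def open_groebner_fan_def
proof (rule rational_polyhedral_fan_of_cells)
  let ?\<D> = "{inequalities E g | E g. standard_basis E g}"
  have "?\<D> \<subseteq> (\<lambda>E. inequalities E (SOME g. standard_basis E g)) ` {E. \<exists>g. standard_basis E g}"
  proof clarify
    fix E g assume sb: "standard_basis E g"
    let ?g = "SOME g. standard_basis E g"
    have "standard_basis E ?g" using sb by (rule someI[of "standard_basis E"])
    then have "inequalities E g = inequalities E ?g"
      using standard_basis_unique[OF sb] by (simp add: inequalities_def)
    then show "inequalities E g \<in> (\<lambda>E. inequalities E (SOME g. standard_basis E g)) ` {E. \<exists>g. standard_basis E g}"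
      using sb by blast
  qed
  then show "finite ?\<D>" using finitely_many_staircases by (meson finite_imageI finite_subset)
  show "finite D \<and> range (\<lambda>i. axis i 1) \<subseteq> D \<and> (\<forall>d\<in>D. \<forall>i. d $ i \<in> \<rat>)" if "D \<in> ?\<D>" for D
    using that finite_minimal_exps by (auto simp: inequalities_def axis_def real_exp_def)
  show "\<exists>D\<in>?\<D>. u \<in> polar_cone D" if u: "u \<in> U_loc" for u
  proof -
    obtain E g where "standard_basis E g" "selects u E g" using standard_basis_exists[OF u] by blast
    then show ?thesis using u by (intro bexI[of _ "inequalities E g"]) (auto simp: polar_cone_inequalities)
  qed
  show "groebner_cone C I u = cell D u" if "D \<in> ?\<D>" "u \<in> polar_cone D" for D u
    using that groebner_cone_eq_cell by blast
qed

end

theorem theorem2p0p1: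
  fixes I :: "('k::field, 'n::finite) pow_series set"
    and J :: "(complex, 'n) pow_series set"
  shows "(ideal I formal_ring \<longrightarrow> rational_polyhedral_fan (closed_groebner_fan formal_ring I)) \<and>
         (ideal J germ_ring \<longrightarrow> rational_polyhedral_fan (closed_groebner_fan germ_ring J))"
proof (intro conjI impI)
  assume I: "ideal I formal_ring"
  have C: "formal_ring\<lparr>carrier := UNIV\<rparr> = (formal_ring :: ('k, 'n) pow_series ring)"
    by (simp add: formal_ring_def)
  have "series_ideal UNIV I"
    by (intro series_ideal.intro series_ideal_axioms.intro series_ring_UNIV) (simp add: C I)
  then show "rational_polyhedral_fan (closed_groebner_fan formal_ring I)"
    using series_ideal.closed_groebner_fan_rational C by metis
next
  assume "ideal J germ_ring"
  then have "series_ideal {f. convergent_series f} J"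
    by (intro series_ideal.intro series_ideal_axioms.intro series_ring_convergent) (simp add: germ_ring_def)
  then show "rational_polyhedral_fan (closed_groebner_fan germ_ring J)"
    unfolding germ_ring_def by (rule series_ideal.closed_groebner_fan_rational)
qed

end
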